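(* Let $\mathcal A_q=\mathcal A_q(\underline x=(X_1,\dots,X_r),B,L,G)$ be a graded quantum cluster algebra. Let $\sigma:\mathcal A_q\to\mathcal A_q$ be an algebra automorphism such that for each $1\le i\le r$ there exists $c_i\in\mathbb{Z}$ with $\sigma(X_i)=q^{c_i}X_i$. Then the skew-Laurent extension $\mathcal A_q[y^{\pm1};\sigma]$ is a graded quantum cluster algebra, with initial data $(\underline x',B',L',G')$ where - $\underline x'=(X_1,\dots,X_r,y,y^{-1})$, with $y$ and $y^{-1}$ additional coefficients (frozen variables); - the quiver of $B'$ is the disjoint union of the quiver of $B$ with two isolated frozen vertices $y$ and $y^{-1}$ (i.e. $B'$ is $B$ extended by zero rows and columns); - $L'$ is determined by the quasi-commutation data in $L$ and the automorphism $\sigma$ (i.e. it extends $L$ and records the relations $yX_i=q^{c_i}X_iy$); - $G'_i=G_i$ for $1\le i\le r$, $G'_{r+1}=1$ and $G'_{r+2}=-1$.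
   Context: $\mathbb{K}=\mathbb{Q}(q^{1/2})$. A quantum seed $(\underline{x},B,L)$ of cardinality $r$, with a fixed subset of $\{1,\dots,r\}$ of mutable indices (the others are frozen; the corresponding variables are called coefficients), consists of: a skew-symmetric integer matrix $L=(l_{ij})$; a tuple $\underline{x}=(X_1,\dots,X_r)$ generating, as a skew-field over $\mathbb{K}$, the skew-field of fractions $\mathcal F$ of the quantum torus with generators $X_i^{\pm1}$ and relations $X_iX_j=q^{l_{ij}}X_jX_i$; and a skew-symmetric integer $r\times r$ matrix $B=(b_{ij})$ with $b_{ij}=0$ if $i,j$ are both frozen, compatible with $L$: for some positive integer $d$, $\sum_k b_{ki}l_{kj}=d\delta_{ij}$ for all mutable $i$ and all $j$. For $\underline a\in\mathbb{Z}^r$ put $M(\underline a)=q^{\frac12\sum_{i<j}a_ia_jl_{ji}}X_1^{a_1}\cdots X_r^{a_r}$. For mutable $k$ put $\underline b_k^+=-\underline e_k+\sum_{b_{ik}>0}b_{ik}\underline e_i$, $\underline b_k^-=-\underline e_k-\sum_{b_{ik}<0}b_{ik}\underline e_i$. Mutation in direction $k$ replaces $X_k$ by $X_k'=M(\underline b_k^+)+M(\underline b_k^-)$, leaves the other $X_i$ unchanged, and replaces $B,L$ by $EBE^T$ (entries with both indices frozen reset to $0$) and $E^TLE$, where $E_{rs}=\delta_{rs}$ if $s\ne k$, $E_{kk}=-1$, $E_{rk}=\max(0,-b_{rk})$ if $r\neq k$. The quantum cluster variables are all entries (including frozen ones) of all seeds obtained from the initial one by iterated mutation; the quantum cluster algebra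 $\mathcal A_q(\underline x,B,L)$ is the $\mathbb{K}$-subalgebra of $\mathcal F$ they generate. A graded quantum seed is $(\underline x,B,L,G)$ where $(\underline x,B,L)$ is a quantum seed and $G\in\mathbb{Z}^r$ satisfies $B_iG=0$ for every mutable $i$ ($B_i$ the $i$th row of $B$); the quantum cluster algebra of a graded quantum seed is called graded, with $\deg X_i=G_i$. Convention: a cluster may list an invertible coefficient $y$ together with $y^{-1}$ as two separate frozen entries (with zero rows and columns in $B$); the independence requirement in the definition of a seed is then imposed on the tuple with $y^{-1}$ omitted. In the skew-Laurent extension $A[y^{\pm1};\sigma]$ one has $ya=\sigma(a)y$ for $a\in A$. *)

theory Defs
  imports "HOL-Computational_Algebra.Polynomial" "HOL-Computational_Algebra.Fraction_Field"
    "HOL-Algebra.Algebraic_Closure_Type" "HOL-Algebra.Generated_Rings"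
begin

text \<open>
  Throughout, indices are shifted to start at 0: a seed of cardinality \<open>r\<close> is indexed by
  \<open>{..<r}\<close>. Tuples, vectors and matrices are functions on \<open>nat\<close>, of which only the values at
  indices below \<open>r\<close> are meaningful.
\<close>

section \<open>Algebras over the field of rational functions in the square root of q\<close>

type_synonym qfield = "rat poly fract"

text \<open>The variable of this field of rational functions is the square root of \<open>q\<close>, so that
  \<open>q\<^bsup>m/2\<^esup> = qhalf powi m\<close>.\<close>

definition qhalf :: qfield where
  "qhalf = Fract [:0, 1:] 1"

definition qpow :: "int \<Rightarrow> qfield" where
  "qpow n = qhalf powi (2 * n)"

text \<open>The library locale \<open>algebra\<close> covers commutative algebras only.\<close>

definition K_algebra :: "(qfield, 'a) module \<Rightarrow> bool" where
  "K_algebra A \<longleftrightarrow> module (ring_of_type_algebra :: qfield ring) A \<and> ring A \<and>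
     (\<forall>c. \<forall>x \<in> carrier A. \<forall>y \<in> carrier A.
        (c \<odot>\<^bsub>A\<^esub> x) \<otimes>\<^bsub>A\<^esub> y = c \<odot>\<^bsub>A\<^esub> (x \<otimes>\<^bsub>A\<^esub> y) \<and>
        x \<otimes>\<^bsub>A\<^esub> (c \<odot>\<^bsub>A\<^esub> y) = c \<odot>\<^bsub>A\<^esub> (x \<otimes>\<^bsub>A\<^esub> y))"

definition K_skew_field :: "(qfield, 'a) module \<Rightarrow> bool" where
  "K_skew_field F \<longleftrightarrow> K_algebra F \<and> Units F = carrier F - {\<zero>\<^bsub>F\<^esub>}"

definition K_subalgebra_gen :: "(qfield, 'a) module \<Rightarrow> 'a set \<Rightarrow> (qfield, 'a) module" where
  "K_subalgebra_gen F S =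
     F\<lparr>carrier := generate_ring F (range (\<lambda>c. c \<odot>\<^bsub>F\<^esub> \<one>\<^bsub>F\<^esub>) \<union> S)\<rparr>"

definition K_algebra_iso ::
  "(qfield, 'a) module \<Rightarrow> (qfield, 'b) module \<Rightarrow> ('a \<Rightarrow> 'b) set" where
  "K_algebra_iso A B =
     {h \<in> ring_iso A B. \<forall>c. \<forall>x \<in> carrier A. h (c \<odot>\<^bsub>A\<^esub> x) = c \<odot>\<^bsub>B\<^esub> h x}"


section \<open>Laurent monomials and quantum tori\<close>

definition ordered_monomial ::
  "(qfield, 'a) module \<Rightarrow> nat \<Rightarrow> (nat \<Rightarrow> 'a) \<Rightarrow> (nat \<Rightarrow> int) \<Rightarrow> 'a" where
  "ordered_monomial F r x a =
     foldr (\<lambda>i z. (x i [^]\<^bsub>F\<^esub> a i) \<otimes>\<^bsub>F\<^esub> z) [0..<r] \<one>\<^bsub>F\<^esub>"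

definition normalised_monomial ::
  "(qfield, 'a) module \<Rightarrow> nat \<Rightarrow> (nat \<Rightarrow> 'a) \<Rightarrow> (nat \<Rightarrow> nat \<Rightarrow> int) \<Rightarrow> (nat \<Rightarrow> int) \<Rightarrow> 'a" where
  "normalised_monomial F r x L a =
     (qhalf powi (\<Sum>j<r. \<Sum>i<j. a i * a j * L j i)) \<odot>\<^bsub>F\<^esub> ordered_monomial F r x a"

text \<open>
  \<open>x\<close> satisfies the relations given by \<open>L\<close>, the subalgebra \<open>T\<close> generated by the \<open>x\<^sub>i\<close> and
  their inverses with \<open>i \<in> I\<close> is the quantum torus on these generators, and \<open>F\<close> is the skew-field
  of fractions of \<open>T\<close>.
  The relations alone imply that \<open>T\<close> is a quotient of the quantum torus and that it is spanned by
  the ordered Laurent monomials. These form a basis of the quantum torus, so it is their linear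
  independence that makes \<open>T\<close> the quantum torus itself.
  Requiring every element of \<open>F\<close> to be a fraction of elements of \<open>T\<close> in particular makes
  \<open>x\<close> a generating tuple of the skew-field \<open>F\<close>.
\<close>

definition quantum_torus_fractions ::
  "(qfield, 'a) module \<Rightarrow> nat \<Rightarrow> nat set \<Rightarrow> (nat \<Rightarrow> 'a) \<Rightarrow> (nat \<Rightarrow> nat \<Rightarrow> int) \<Rightarrow> bool" where
  "quantum_torus_fractions F r I x L \<longleftrightarrow>
     (\<forall>i<r. x i \<in> carrier F - {\<zero>\<^bsub>F\<^esub>}) \<and>
     (\<forall>i<r. \<forall>j<r. x i \<otimes>\<^bsub>F\<^esub> x j = qpow (L i j) \<odot>\<^bsub>F\<^esub> (x j \<otimes>\<^bsub>F\<^esub> x i)) \<and>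
     (\<forall>S u. finite S \<and> S \<subseteq> {a. \<forall>i. i \<notin> I \<longrightarrow> a i = 0} \<and>
        (\<Oplus>\<^bsub>F\<^esub>a\<in>S. u a \<odot>\<^bsub>F\<^esub> ordered_monomial F r x a) = \<zero>\<^bsub>F\<^esub> \<longrightarrow> (\<forall>a\<in>S. u a = 0)) \<and>
     (let T = K_subalgebra_gen F (x ` I \<union> (\<lambda>i. inv\<^bsub>F\<^esub> x i) ` I)
      in \<forall>f \<in> carrier F. \<exists>s \<in> carrier T. \<exists>t \<in> carrier T. t \<noteq> \<zero>\<^bsub>F\<^esub> \<and> f = s \<otimes>\<^bsub>F\<^esub> inv\<^bsub>F\<^esub> t)"


section \<open>Quantum seeds\<close>

text \<open>
  \<open>mut\<close> is the set of mutable indices; the remaining indices below \<open>r\<close> are frozen.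
  \<open>P\<close> records the invertible coefficients that are listed together with their inverses:
  \<open>(i, j) \<in> P\<close> means that \<open>x\<^sub>j\<close> is the inverse of \<open>x\<^sub>i\<close>, in which case \<open>j\<close> is omitted from
  the independence requirement. For \<open>P = {}\<close> this is the usual notion of a quantum seed.
\<close>

definition inverse_pairs ::
  "(qfield, 'a) module \<Rightarrow> nat \<Rightarrow> nat set \<Rightarrow> (nat \<times> nat) set \<Rightarrow> (nat \<Rightarrow> 'a) \<Rightarrow>
   (nat \<Rightarrow> nat \<Rightarrow> int) \<Rightarrow> bool" where
  "inverse_pairs F r mut P x B \<longleftrightarrow>
     fst ` P \<inter> snd ` P = {} \<and> inj_on fst P \<and> inj_on snd P \<and>
     (\<forall>(i, j) \<in> P. i \<in> {..<r} - mut \<and> j \<in> {..<r} - mut \<and> x j = inv\<^bsub>F\<^esub> x i \<and>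
        (\<forall>k<r. B i k = 0 \<and> B k i = 0 \<and> B j k = 0 \<and> B k j = 0))"

definition compatible ::
  "nat \<Rightarrow> nat set \<Rightarrow> (nat \<Rightarrow> nat \<Rightarrow> int) \<Rightarrow> (nat \<Rightarrow> nat \<Rightarrow> int) \<Rightarrow> bool" where
  "compatible r mut B L \<longleftrightarrow>
     (\<exists>d>0. \<forall>i \<in> mut. \<forall>j<r. (\<Sum>k<r. B k i * L k j) = (if i = j then d else 0))"

definition quantum_seed ::
  "(qfield, 'a) module \<Rightarrow> nat \<Rightarrow> nat set \<Rightarrow> (nat \<times> nat) set \<Rightarrow> (nat \<Rightarrow> 'a) \<Rightarrow>
   (nat \<Rightarrow> nat \<Rightarrow> int) \<Rightarrow> (nat \<Rightarrow> nat \<Rightarrow> int) \<Rightarrow> bool" where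
  "quantum_seed F r mut P x B L \<longleftrightarrow>
     K_skew_field F \<and> mut \<subseteq> {..<r} \<and>
     (\<forall>i<r. \<forall>j<r. L i j = - L j i) \<and>
     (\<forall>i<r. \<forall>j<r. B i j = - B j i) \<and>
     (\<forall>i \<in> {..<r} - mut. \<forall>j \<in> {..<r} - mut. B i j = 0) \<and>
     compatible r mut B L \<and>
     inverse_pairs F r mut P x B \<and>
     quantum_torus_fractions F r ({..<r} - snd ` P) x L"

text \<open>The last condition, void for \<open>P = {}\<close>, makes \<open>deg x\<^sub>i = G\<^sub>i\<close> consistent with
  \<open>x\<^sub>j\<close> being the inverse of \<open>x\<^sub>i\<close>.\<close>

definition graded_quantum_seed ::
  "(qfield, 'a) module \<Rightarrow> nat \<Rightarrow> nat set \<Rightarrow> (nat \<times> nat) set \<Rightarrow> (nat \<Rightarrow> 'a) \<Rightarrow>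
   (nat \<Rightarrow> nat \<Rightarrow> int) \<Rightarrow> (nat \<Rightarrow> nat \<Rightarrow> int) \<Rightarrow> (nat \<Rightarrow> int) \<Rightarrow> bool" where
  "graded_quantum_seed F r mut P x B L G \<longleftrightarrow>
     quantum_seed F r mut P x B L \<and>
     (\<forall>i \<in> mut. (\<Sum>j<r. B i j * G j) = 0) \<and>
     (\<forall>(i, j) \<in> P. G j = - G i)"


section \<open>Mutation and quantum cluster algebras\<close>

definition b_plus :: "(nat \<Rightarrow> nat \<Rightarrow> int) \<Rightarrow> nat \<Rightarrow> nat \<Rightarrow> int" where
  "b_plus B k i = (if i = k then -1 else 0) + (if B i k > 0 then B i k else 0)"

definition b_minus :: "(nat \<Rightarrow> nat \<Rightarrow> int) \<Rightarrow> nat \<Rightarrow> nat \<Rightarrow> int" where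
  "b_minus B k i = (if i = k then -1 else 0) - (if B i k < 0 then B i k else 0)"

definition mut_E :: "(nat \<Rightarrow> nat \<Rightarrow> int) \<Rightarrow> nat \<Rightarrow> nat \<Rightarrow> nat \<Rightarrow> int" where
  "mut_E B k i j =
     (if j \<noteq> k then (if i = j then 1 else 0) else if i = k then -1 else max 0 (- B i k))"

definition mut_X ::
  "(qfield, 'a) module \<Rightarrow> nat \<Rightarrow> nat \<Rightarrow> (nat \<Rightarrow> 'a) \<Rightarrow> (nat \<Rightarrow> nat \<Rightarrow> int) \<Rightarrow>
   (nat \<Rightarrow> nat \<Rightarrow> int) \<Rightarrow> nat \<Rightarrow> 'a" where
  "mut_X F r k x B L =
     x(k := normalised_monomial F r x L (b_plus B k) \<oplus>\<^bsub>F\<^esub> normalised_monomial F r x L (b_minus B k))"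

definition mut_B :: "nat \<Rightarrow> nat set \<Rightarrow> nat \<Rightarrow> (nat \<Rightarrow> nat \<Rightarrow> int) \<Rightarrow> nat \<Rightarrow> nat \<Rightarrow> int" where
  "mut_B r mut k B i j =
     (if i \<notin> mut \<and> j \<notin> mut then 0
      else \<Sum>s<r. \<Sum>t<r. mut_E B k i s * B s t * mut_E B k j t)"

definition mut_L ::
  "nat \<Rightarrow> nat \<Rightarrow> (nat \<Rightarrow> nat \<Rightarrow> int) \<Rightarrow> (nat \<Rightarrow> nat \<Rightarrow> int) \<Rightarrow> nat \<Rightarrow> nat \<Rightarrow> int" where
  "mut_L r k B L i j = (\<Sum>s<r. \<Sum>t<r. mut_E B k s i * L s t * mut_E B k t j)"

inductive_set mutation_class ::
  "(qfield, 'a) module \<Rightarrow> nat \<Rightarrow> nat set \<Rightarrow> (nat \<Rightarrow> 'a) \<Rightarrow> (nat \<Rightarrow> nat \<Rightarrow> int) \<Rightarrow>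
   (nat \<Rightarrow> nat \<Rightarrow> int) \<Rightarrow> ((nat \<Rightarrow> 'a) \<times> (nat \<Rightarrow> nat \<Rightarrow> int) \<times> (nat \<Rightarrow> nat \<Rightarrow> int)) set"
  for F r mut x B L where
  initial: "(x, B, L) \<in> mutation_class F r mut x B L"
| mutate: "(Y, C, M) \<in> mutation_class F r mut x B L \<Longrightarrow> k \<in> mut \<Longrightarrow>
     (mut_X F r k Y C M, mut_B r mut k C, mut_L r k C M) \<in> mutation_class F r mut x B L"

definition quantum_cluster_variables ::
  "(qfield, 'a) module \<Rightarrow> nat \<Rightarrow> nat set \<Rightarrow> (nat \<Rightarrow> 'a) \<Rightarrow> (nat \<Rightarrow> nat \<Rightarrow> int) \<Rightarrow>
   (nat \<Rightarrow> nat \<Rightarrow> int) \<Rightarrow> 'a set" where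
  "quantum_cluster_variables F r mut x B L =
     {Y i | Y C M i. (Y, C, M) \<in> mutation_class F r mut x B L \<and> i < r}"

definition quantum_cluster_algebra ::
  "(qfield, 'a) module \<Rightarrow> nat \<Rightarrow> nat set \<Rightarrow> (nat \<Rightarrow> 'a) \<Rightarrow> (nat \<Rightarrow> nat \<Rightarrow> int) \<Rightarrow>
   (nat \<Rightarrow> nat \<Rightarrow> int) \<Rightarrow> (qfield, 'a) module" where
  "quantum_cluster_algebra F r mut x B L =
     K_subalgebra_gen F (quantum_cluster_variables F r mut x B L)"


section \<open>Skew-Laurent extensions\<close>

definition auto_pow :: "(qfield, 'a) module \<Rightarrow> ('a \<Rightarrow> 'a) \<Rightarrow> int \<Rightarrow> 'a \<Rightarrow> 'a" where
  "auto_pow A \<sigma> n =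
     (if n \<ge> 0 then \<sigma> ^^ nat n else inv_into (carrier A) \<sigma> ^^ nat (- n))"

text \<open>A finitely supported \<open>f\<close> stands for the sum of the \<open>f(n) y\<^sup>n\<close>. The product is the one
  determined by \<open>y\<^sup>n a = \<sigma>\<^sup>n(a) y\<^sup>n\<close>.\<close>

definition skew_laurent ::
  "(qfield, 'a) module \<Rightarrow> ('a \<Rightarrow> 'a) \<Rightarrow> (qfield, int \<Rightarrow> 'a) module" where
  "skew_laurent A \<sigma> =
     \<lparr>carrier = {f. (\<forall>n. f n \<in> carrier A) \<and> finite {n. f n \<noteq> \<zero>\<^bsub>A\<^esub>}},
      monoid.mult = (\<lambda>f g n. \<Oplus>\<^bsub>A\<^esub>m\<in>{m. f m \<noteq> \<zero>\<^bsub>A\<^esub>}. f m \<otimes>\<^bsub>A\<^esub> auto_pow A \<sigma> m (g (n - m))),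
      one = (\<lambda>n. if n = 0 then \<one>\<^bsub>A\<^esub> else \<zero>\<^bsub>A\<^esub>),
      ring.zero = (\<lambda>n. \<zero>\<^bsub>A\<^esub>),
      ring.add = (\<lambda>f g n. f n \<oplus>\<^bsub>A\<^esub> g n),
      module.smult = (\<lambda>c f n. c \<odot>\<^bsub>A\<^esub> f n)\<rparr>"

definition laurent_term :: "(qfield, 'a) module \<Rightarrow> 'a \<Rightarrow> int \<Rightarrow> int \<Rightarrow> 'a" where
  "laurent_term A a m = (\<lambda>n. if n = m then a else \<zero>\<^bsub>A\<^esub>)"


section \<open>The extended initial data\<close>

text \<open>Index \<open>r\<close> belongs to \<open>y\<close> and index \<open>r + 1\<close> to the inverse of \<open>y\<close>.\<close>

definition ext_X ::
  "(qfield, 'a) module \<Rightarrow> nat \<Rightarrow> (nat \<Rightarrow> 'a) \<Rightarrow> nat \<Rightarrow> int \<Rightarrow> 'a" where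
  "ext_X A r x i =
     (if i < r then laurent_term A (x i) 0
      else if i = r then laurent_term A \<one>\<^bsub>A\<^esub> 1
      else laurent_term A \<one>\<^bsub>A\<^esub> (-1))"

definition ext_B :: "nat \<Rightarrow> (nat \<Rightarrow> nat \<Rightarrow> int) \<Rightarrow> nat \<Rightarrow> nat \<Rightarrow> int" where
  "ext_B r B i j = (if i < r \<and> j < r then B i j else 0)"

text \<open>The new entries record \<open>y x\<^sub>i = q\<^bsup>c\<^sub>i\<^esup> x\<^sub>i y\<close> and its consequences for the inverse
  of \<open>y\<close>.\<close>

definition ext_L ::
  "nat \<Rightarrow> (nat \<Rightarrow> nat \<Rightarrow> int) \<Rightarrow> (nat \<Rightarrow> int) \<Rightarrow> nat \<Rightarrow> nat \<Rightarrow> int" where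
  "ext_L r L c i j =
     (if i < r \<and> j < r then L i j
      else if i = r \<and> j < r then c j
      else if i < r \<and> j = r then - c i
      else if i = r + 1 \<and> j < r then - c j
      else if i < r \<and> j = r + 1 then c i
      else 0)"

definition ext_G :: "nat \<Rightarrow> (nat \<Rightarrow> int) \<Rightarrow> nat \<Rightarrow> int" where
  "ext_G r G i = (if i < r then G i else if i = r then 1 else -1)"

end

theory Submission
  imports Defs "HOL-Library.Function_Algebras"
begin

text \<open>
  The extended seed is compatible only if \<open>\<Sum>\<^sub>k b\<^sub>k\<^sub>i c\<^sub>k = 0\<close> for every mutable \<open>i\<close>, that is, if \<open>\<sigma>\<close>
  multiplies the two monomials of each exchange relation by the same power of \<open>q\<close>. Otherwise the
  difference of \<open>\<sigma>(x\<^sub>i')\<close> and a multiple of \<open>x\<^sub>i'\<close> would be a nonzero multiple of one of the monomials,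
  which would therefore lie in the cluster algebra. By the quantum Laurent phenomenon that algebra
  is contained in the subalgebra of the torus generated by \<open>x\<^sub>i, x\<^sub>i'\<close> and the \<open>x\<^sub>j\<^sup>\<plusminus>\<close> with
  \<open>j \<noteq> i\<close>, and neither of the two monomials is in there.

  Every element of \<open>F\<close> is a right fraction of elements of the cluster algebra, so \<open>\<sigma>\<close> extends to
  \<open>F\<close>. The Laurent polynomials over \<open>F\<close> sit in the skew-field of skew Laurent series and satisfy
  the right Ore condition, so their fractions form a skew-field \<open>F'\<close> containing
  \<open>A[y\<^sup>\<plusminus>;\<sigma>]\<close>, and \<open>\<phi>\<close> is the inclusion. As \<open>y\<close> takes no part in any exchange relation, the
  mutations of the extended seed are those of the given one.
\<close>

subsection \<open>Algebras over the base field\<close>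

text \<open>Coefficients of noncommutative Laurent polynomials are compared through eigenvalues:
  conjugation by a unit \<open>u\<close> multiplies a monomial by a power of \<open>qhalf\<close>,
  distinct powers differ, and so a subspace stable under the conjugation contains the homogeneous
  components of its elements. Compatibility supplies two gradings for a mutable direction
  \<open>i\<close>. Conjugation by the monomial with exponents \<open>B j i\<close> reads off the
  exponent of \<open>x i\<close> times \<open>2 * d\<close>, and the ratio \<open>Y\<close> of the
  two exchange monomials has degree 0; conjugation by \<open>x i\<close> gives \<open>Y\<close> the
  degree \<open>- 2 * d\<close>. The first isolates the part of exponent -1 in \<open>x i\<close>,
  the second makes \<open>1 + Y\<close> cancellable and not invertible.

  The Laurent phenomenon is reduced to one mutation at \<open>k\<close>: elements of the mutated
  upper algebra enter the ring of direction \<open>i\<close> after left multiplication by a power of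
  the new variable, and that power is cancelled with the second grading for \<open>k\<close>.

  Series come first because they form an explicit ring in which inverses are computed by recursion;
  the field wanted is then a subset, and no equivalence classes of fractions have to be
  formed.\<close>

abbreviation hp :: "int \<Rightarrow> qfield" where
  "hp n \<equiv> qhalf powi n"

lemma qhalf_nonzero [simp]: "qhalf \<noteq> 0"
  by (simp add: qhalf_def Zero_fract_def eq_fract)

lemma qhalf_power: "qhalf ^ n = Fract (monom 1 n) 1"
proof (induction n)
  case 0
  show ?case by (simp add: One_fract_def monom_0 one_pCons)
next
  case (Suc n)
  then show ?case by (simp add: qhalf_def monom_Suc)
qed

lemma hp_add: "hp (m + n) = hp m * hp n"
  by (simp add: power_int_add)

text \<open>The degree of a monomial recovers its exponent, so \<open>qhalf\<close> is not a root of
  unity. All separation of homogeneous components rests on this.\<close>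

lemma hp_eq_1_iff [simp]: "hp n = 1 \<longleftrightarrow> n = 0"
proof -
  have nat: "m = 0" if "qhalf ^ m = 1" for m
  proof -
    have "(monom 1 m :: rat poly) = 1"
      using that by (simp add: qhalf_power One_fract_def eq_fract)
    then have "degree (monom 1 m :: rat poly) = 0"
      by simp
    then show ?thesis by (simp add: degree_monom_eq)
  qed
  show ?thesis
    using nat[of "nat n"] nat[of "nat (- n)"] by (auto simp: power_int_def power_inverse)
qed

lemma hp_inject [simp]: "hp m = hp n \<longleftrightarrow> m = n"
proof
  assume "hp m = hp n"
  then have "hp (m - n) = 1"
    by (simp add: power_int_diff)
  then show "m = n" by simp
qed simp

lemma hp_uminus_mult [simp]: "hp (- n) * hp n = 1" "hp n * hp (- n) = 1"
  by (simp_all add: power_int_minus)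

locale Kalg =
  fixes F :: "(qfield, 'a) module" (structure)
  assumes K_algebra: "K_algebra F"

sublocale Kalg \<subseteq> ring F
  using K_algebra by (simp add: K_algebra_def)

context Kalg
begin

lemma Kmodule: "module (ring_of_type_algebra :: qfield ring) F"
  using K_algebra by (simp add: K_algebra_def)

lemma sm_closed [simp, intro]: "x \<in> carrier F \<Longrightarrow> c \<odot> x \<in> carrier F"
  using module.smult_closed[OF Kmodule, of c x] by (simp add: ring_of_type_algebra_def)

lemma sm_add_left: "x \<in> carrier F \<Longrightarrow> (c + d) \<odot> x = c \<odot> x \<oplus> d \<odot> x"
  using module.smult_l_distr[OF Kmodule, of c d x] by (simp add: ring_of_type_algebra_def)

lemma sm_add_right: "x \<in> carrier F \<Longrightarrow> y \<in> carrier F \<Longrightarrow> c \<odot> (x \<oplus> y) = c \<odot> x \<oplus> c \<odot> y"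
  using module.smult_r_distr[OF Kmodule, of c x y] by (simp add: ring_of_type_algebra_def)

lemma sm_sm [simp]: "x \<in> carrier F \<Longrightarrow> c \<odot> (d \<odot> x) = (c * d) \<odot> x"
  using module.smult_assoc1[OF Kmodule, of c d x] by (simp add: ring_of_type_algebra_def)

lemma sm_one [simp]: "x \<in> carrier F \<Longrightarrow> 1 \<odot> x = x"
  using module.smult_one[OF Kmodule, of x] by (simp add: ring_of_type_algebra_def)

lemma sm_mult_left [simp]: "x \<in> carrier F \<Longrightarrow> y \<in> carrier F \<Longrightarrow> (c \<odot> x) \<otimes> y = c \<odot> (x \<otimes> y)"
  using K_algebra by (simp add: K_algebra_def)

lemma sm_mult_right [simp]: "x \<in> carrier F \<Longrightarrow> y \<in> carrier F \<Longrightarrow> x \<otimes> (c \<odot> y) = c \<odot> (x \<otimes> y)"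
  using K_algebra by (simp add: K_algebra_def)

lemma sm_zero_left [simp]: "x \<in> carrier F \<Longrightarrow> 0 \<odot> x = \<zero>"
  using sm_add_left[of x 0 0] by simp

lemma sm_zero_right [simp]: "c \<odot> \<zero> = \<zero>"
  using sm_add_right[of \<zero> \<zero> c] by simp

lemma sm_uminus: "x \<in> carrier F \<Longrightarrow> (- c) \<odot> x = \<ominus> (c \<odot> x)"
  using sm_add_left[of x "- c" c] by (simp add: minus_equality)

lemma sm_minus_one: "x \<in> carrier F \<Longrightarrow> (- 1) \<odot> x = \<ominus> x"
  by (simp add: sm_uminus)

lemma sm_diff_left: "x \<in> carrier F \<Longrightarrow> (c - d) \<odot> x = c \<odot> x \<ominus> d \<odot> x"
  using sm_add_left[of x c "- d"] by (simp add: sm_uminus a_minus_def)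

lemma sm_eq_zero_iff [simp]:
  assumes "x \<in> carrier F"
  shows "c \<odot> x = \<zero> \<longleftrightarrow> c = 0 \<or> x = \<zero>"
proof
  assume eq: "c \<odot> x = \<zero>"
  show "c = 0 \<or> x = \<zero>"
  proof (rule disjCI)
    assume "x \<noteq> \<zero>"
    show "c = 0"
    proof (rule ccontr)
      assume "c \<noteq> 0"
      then have "x = inverse c \<odot> (c \<odot> x)" using assms by simp
      with eq \<open>x \<noteq> \<zero>\<close> show False by simp
    qed
  qed
qed (use assms in auto)

lemma sm_move:
  assumes "x \<in> carrier F" "hp n \<odot> x = y"
  shows "x = hp (- n) \<odot> y"
  using assms by auto

lemma sm_finsum:
  "f \<in> S \<rightarrow> carrier F \<Longrightarrow> c \<odot> (\<Oplus>i\<in>S. f i) = (\<Oplus>i\<in>S. c \<odot> f i)"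
  by (induction S rule: infinite_finite_induct) (auto simp: sm_add_right Pi_def)

section \<open>Subspaces, generated subalgebras and linear spans\<close>

definition subsp :: "'a set \<Rightarrow> bool" where
  "subsp V \<longleftrightarrow> V \<subseteq> carrier F \<and> \<zero> \<in> V \<and> (\<forall>x\<in>V. \<forall>y\<in>V. x \<oplus> y \<in> V) \<and> (\<forall>c. \<forall>x\<in>V. c \<odot> x \<in> V)"

lemma subspI:
  assumes "V \<subseteq> carrier F" "\<zero> \<in> V" "\<And>x y. x \<in> V \<Longrightarrow> y \<in> V \<Longrightarrow> x \<oplus> y \<in> V"
    "\<And>c x. x \<in> V \<Longrightarrow> c \<odot> x \<in> V"
  shows "subsp V"
  using assms by (auto simp: subsp_def)

lemma subsp_carrier: "subsp V \<Longrightarrow> x \<in> V \<Longrightarrow> x \<in> carrier F"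
  and subsp_zero: "subsp V \<Longrightarrow> \<zero> \<in> V"
  and subsp_add: "subsp V \<Longrightarrow> x \<in> V \<Longrightarrow> y \<in> V \<Longrightarrow> x \<oplus> y \<in> V"
  and subsp_sm: "subsp V \<Longrightarrow> x \<in> V \<Longrightarrow> c \<odot> x \<in> V"
  by (auto simp: subsp_def)

lemma subsp_uminus: "subsp V \<Longrightarrow> x \<in> V \<Longrightarrow> \<ominus> x \<in> V"
  using subsp_sm[of V x "- 1"] by (simp add: sm_minus_one subsp_carrier)

lemma subsp_minus: "subsp V \<Longrightarrow> x \<in> V \<Longrightarrow> y \<in> V \<Longrightarrow> x \<ominus> y \<in> V"
  by (simp add: a_minus_def subsp_add subsp_uminus)

lemma subsp_sm_iff: "subsp V \<Longrightarrow> x \<in> carrier F \<Longrightarrow> c \<noteq> 0 \<Longrightarrow> c \<odot> x \<in> V \<longleftrightarrow> x \<in> V"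
  using subsp_sm[of V "c \<odot> x" "inverse c"] subsp_sm[of V x c] by auto

lemma subsp_finsum:
  assumes "subsp V" "\<And>i. i \<in> S \<Longrightarrow> f i \<in> V"
  shows "(\<Oplus>i\<in>S. f i) \<in> V"
  using assms(2)
proof (induction S rule: infinite_finite_induct)
  case (insert i S)
  then have "f \<in> S \<rightarrow> carrier F" "f i \<in> carrier F"
    using subsp_carrier[OF assms(1)] by auto
  then show ?case using insert by (simp add: subsp_add[OF assms(1)])
qed (auto simp: subsp_zero[OF assms(1)])

definition subalg :: "'a set \<Rightarrow> bool" where
  "subalg V \<longleftrightarrow> subsp V \<and> \<one> \<in> V \<and> (\<forall>x\<in>V. \<forall>y\<in>V. x \<otimes> y \<in> V)"

lemma subalgI: "subsp V \<Longrightarrow> \<one> \<in> V \<Longrightarrow> (\<And>x y. x \<in> V \<Longrightarrow> y \<in> V \<Longrightarrow> x \<otimes> y \<in> V) \<Longrightarrow> subalg V"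
  by (simp add: subalg_def)

lemma subalg_subsp: "subalg V \<Longrightarrow> subsp V"
  and subalg_one: "subalg V \<Longrightarrow> \<one> \<in> V"
  and subalg_mult: "subalg V \<Longrightarrow> x \<in> V \<Longrightarrow> y \<in> V \<Longrightarrow> x \<otimes> y \<in> V"
  by (simp_all add: subalg_def)

lemma subalg_carrier: "subalg V \<Longrightarrow> x \<in> V \<Longrightarrow> x \<in> carrier F"
  using subalg_subsp subsp_carrier by blast

lemma subalg_pow: "subalg V \<Longrightarrow> x \<in> V \<Longrightarrow> x [^] (n::nat) \<in> V"
  by (induction n) (auto simp: subalg_one subalg_mult)

lemma K_algebra_subalg:
  assumes V: "subalg V"
  shows "K_algebra (F\<lparr>carrier := V\<rparr>)"
proof -
  have "subring V F"
    using V subsp_uminus[OF subalg_subsp[OF V]]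
    by (intro subringI) (auto simp: subalg_def subsp_def)
  then have ring: "ring (F\<lparr>carrier := V\<rparr>)"
    using subring_iff subalg_carrier[OF V] by blast
  have "module (ring_of_type_algebra :: qfield ring) (F\<lparr>carrier := V\<rparr>)"
    using cring_from_type_algebra[where 'a = qfield] ring subalg_carrier[OF V]
    by (intro module.intro module_axioms.intro ring.is_abelian_group)
       (auto simp: ring_of_type_algebra_def sm_add_left sm_add_right subsp_sm[OF subalg_subsp[OF V]])
  with ring show ?thesis
    using subalg_carrier[OF V] by (simp add: K_algebra_def)
qed

definition Kgen :: "'a set \<Rightarrow> 'a set" where
  "Kgen S = generate_ring F (range (\<lambda>c. c \<odot> \<one>) \<union> S)"

lemma carrier_K_subalgebra_gen: "carrier (K_subalgebra_gen F S) = Kgen S"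
  by (simp add: K_subalgebra_gen_def Kgen_def)

lemma Kgen_incl: "S \<subseteq> Kgen S"
  by (simp add: Kgen_def subset_iff generate_ring.incl)

lemma subalg_Kgen:
  assumes "S \<subseteq> carrier F"
  shows "subalg (Kgen S)"
proof -
  have carr: "Kgen S \<subseteq> carrier F"
    using assms unfolding Kgen_def by (intro generate_ring_incl) auto
  have "c \<odot> x \<in> Kgen S" if "x \<in> Kgen S" for c x
  proof -
    have "(c \<odot> \<one>) \<otimes> x \<in> Kgen S"
      using that unfolding Kgen_def by (intro generate_ring.eng_mult[OF generate_ring.incl]) auto
    moreover have "x \<in> carrier F"
      using that carr by blast
    ultimately show ?thesis by simp
  qed
  then show ?thesis
    using carr unfolding subalg_def subsp_def Kgen_def
    by (simp add: generate_ring.one generate_ring.eng_add generate_ring.eng_mult zero_in_generate)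
qed

lemma Kgen_minimal:
  assumes "subalg V" "S \<subseteq> V"
  shows "Kgen S \<subseteq> V"
proof
  fix x assume "x \<in> Kgen S"
  then show "x \<in> V"
    unfolding Kgen_def
    by (induction rule: generate_ring.induct)
      (use assms in \<open>auto simp: subalg_def subsp_def subsp_uminus\<close>)
qed

text \<open>The elements that carry \<open>W\<close> into itself by left multiplication form a
  subalgebra; it contains \<open>S\<close>, and applying its elements to \<open>\<one>\<close> lands
  in \<open>W\<close>. This bounds a generated algebra by a subspace for which closure under
  products would be awkward to show directly.\<close>

lemma Kgen_left_module:
  assumes W: "subsp W" "\<one> \<in> W" and S: "S \<subseteq> carrier F"
    and step: "\<And>s w. s \<in> S \<Longrightarrow> w \<in> W \<Longrightarrow> s \<otimes> w \<in> W"
  shows "Kgen S \<subseteq> W"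
proof -
  define V where "V = {f \<in> carrier F. \<forall>w\<in>W. f \<otimes> w \<in> W}"
  have Wc: "w \<in> carrier F" if "w \<in> W" for w
    using that W(1) subsp_carrier by blast
  have "subalg V"
    using W(1) Wc unfolding subalg_def subsp_def V_def
    by (auto simp: l_distr m_assoc)
  then have "Kgen S \<subseteq> V"
    using S step by (intro Kgen_minimal) (auto simp: V_def)
  then show ?thesis
    using W(2) by (force simp: V_def)
qed

text \<open>The linear span, built one scalar multiple at a time: homogeneous decompositions and
  common denominators are later constructed by induction along this.\<close>

inductive_set lspan :: "'a set \<Rightarrow> 'a set" for S where
  zero: "\<zero> \<in> lspan S"
| add: "f \<in> lspan S \<Longrightarrow> s \<in> S \<Longrightarrow> f \<oplus> c \<odot> s \<in> lspan S"

lemma lspan_carrier: "S \<subseteq> carrier F \<Longrightarrow> lspan S \<subseteq> carrier F"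
proof
  fix f assume "f \<in> lspan S" "S \<subseteq> carrier F"
  then show "f \<in> carrier F" by (induction) auto
qed

lemma subsp_lspan:
  assumes S: "S \<subseteq> carrier F"
  shows "subsp (lspan S)"
proof (rule subspI)
  show carr: "lspan S \<subseteq> carrier F" by (rule lspan_carrier[OF S])
  show "\<zero> \<in> lspan S" by (rule lspan.zero)
  fix x y assume x: "x \<in> lspan S"
  show "x \<oplus> y \<in> lspan S" if "y \<in> lspan S"
    using that
  proof (induction)
    case zero
    then show ?case using x carr by auto
  next
    case (add f s c)
    have "x \<oplus> (f \<oplus> c \<odot> s) = (x \<oplus> f) \<oplus> c \<odot> s"
      using x carr add S by (intro a_assoc[symmetric]) auto
    then show ?case using add lspan.add by auto
  qed
next
  fix c x assume "x \<in> lspan S"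
  then show "c \<odot> x \<in> lspan S"
  proof (induction)
    case (add f s d)
    have "c \<odot> (f \<oplus> d \<odot> s) = c \<odot> f \<oplus> (c * d) \<odot> s"
      using add S lspan_carrier[OF S] by (subst sm_add_right) auto
    then show ?case using add lspan.add by auto
  qed (simp add: lspan.zero)
qed

lemma lspan_base: "S \<subseteq> carrier F \<Longrightarrow> s \<in> S \<Longrightarrow> s \<in> lspan S"
  using lspan.add[OF lspan.zero, of s S 1] by auto

lemma lspan_minimal: "subsp V \<Longrightarrow> S \<subseteq> V \<Longrightarrow> lspan S \<subseteq> V"
proof
  fix f assume "f \<in> lspan S" "subsp V" "S \<subseteq> V"
  then show "f \<in> V"
    by induction (auto intro: subsp_zero subsp_add subsp_sm)
qed

lemma subsp_preimage_left:
  assumes "subsp W" "a \<in> carrier F"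
  shows "subsp {f \<in> carrier F. a \<otimes> f \<in> W}"
  using assms by (intro subspI) (auto simp: r_distr subsp_def)

lemma subsp_preimage_right:
  assumes "subsp W" "a \<in> carrier F"
  shows "subsp {f \<in> carrier F. f \<otimes> a \<in> W}"
  using assms by (intro subspI) (auto simp: l_distr subsp_def)

lemma lspan_mult:
  assumes "S \<subseteq> carrier F" "S' \<subseteq> carrier F" "subsp W"
    and step: "\<And>s s'. s \<in> S \<Longrightarrow> s' \<in> S' \<Longrightarrow> s \<otimes> s' \<in> W"
    and f: "f \<in> lspan S" and g: "g \<in> lspan S'"
  shows "f \<otimes> g \<in> W"
proof -
  have "lspan S' \<subseteq> {g \<in> carrier F. s \<otimes> g \<in> W}" if "s \<in> S" for s
    using that assms(1,2) step
    by (intro lspan_minimal subsp_preimage_left assms(3)) auto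
  then have "lspan S \<subseteq> {f \<in> carrier F. f \<otimes> g \<in> W}"
    using g assms(1) subsetD[OF lspan_carrier[OF assms(2)] g]
    by (intro lspan_minimal subsp_preimage_right assms(3)) auto
  then show ?thesis using f by auto
qed

end

section \<open>Skew-fields over the base field\<close>

locale Kskew = Kalg +
  assumes Units_eq: "Units F = carrier F - {\<zero>}"

lemma K_skew_field_iff_Kskew: "K_skew_field F \<longleftrightarrow> Kskew F"
  by (auto simp: K_skew_field_def Kskew_def Kskew_axioms_def Kalg_def)

context Kskew
begin

lemma one_not_zero [simp]: "\<one> \<noteq> \<zero>" "\<zero> \<noteq> \<one>"
  using Units_one_closed Units_eq by auto

lemma Units_iff: "x \<in> Units F \<longleftrightarrow> x \<in> carrier F \<and> x \<noteq> \<zero>"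
  using Units_eq by auto

lemma mult_eq_zero_iff [simp]:
  assumes "x \<in> carrier F" "y \<in> carrier F"
  shows "x \<otimes> y = \<zero> \<longleftrightarrow> x = \<zero> \<or> y = \<zero>"
  using assms Units_m_closed[of x y] by (auto simp: Units_iff)

lemma Units_sm [simp]: "x \<in> Units F \<Longrightarrow> c \<noteq> 0 \<Longrightarrow> c \<odot> x \<in> Units F"
  by (auto simp: Units_iff)

lemma inv_nonzero [simp]: "x \<in> carrier F \<Longrightarrow> x \<noteq> \<zero> \<Longrightarrow> inv x \<noteq> \<zero>"
  using Units_inv_Units Units_iff by blast

lemma left_cancel:
  assumes "x \<in> carrier F" "x \<noteq> \<zero>" "y \<in> carrier F" "z \<in> carrier F" "x \<otimes> y = x \<otimes> z"
  shows "y = z"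
  using assms Units_l_cancel[of x y z] by (simp add: Units_iff)

lemma right_cancel:
  assumes "x \<in> carrier F" "x \<noteq> \<zero>" "y \<in> carrier F" "z \<in> carrier F" "y \<otimes> x = z \<otimes> x"
  shows "y = z"
proof -
  have "y = y \<otimes> x \<otimes> inv x" "z = z \<otimes> x \<otimes> inv x"
    using assms(1-4) by (simp_all add: m_assoc Units_iff)
  then show ?thesis using assms(5) by simp
qed

end

subsection \<open>Integer powers of units and quasi-commutation\<close>

context Kskew
begin

declare Units_closed [simp]

text \<open>The laws of integer exponents hold in groups; powers in the ring are moved to its group
  of units to make use of them.\<close>

lemma int_pow_units_of: "x \<in> Units F \<Longrightarrow> x [^] (n::int) = x [^]\<^bsub>units_of F\<^esub> n"
proof -
  assume x: "x \<in> Units F"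
  have "inv\<^bsub>units_of F\<^esub> (x [^]\<^bsub>units_of F\<^esub> k) = inv (x [^] k)" for k :: nat
    using units_of_inv[of "x [^]\<^bsub>units_of F\<^esub> k"] x units_of_pow[OF x, of k]
      monoid.nat_pow_closed[OF group.is_monoid[OF units_group], of x k]
    by (simp add: units_of_carrier)
  then show ?thesis
    unfolding int_pow_def2 using units_of_pow[OF x] by (simp del: pow_nat)
qed

lemma ipow_Units [simp]: "x \<in> Units F \<Longrightarrow> x [^] (n::int) \<in> Units F"
  using group.int_pow_closed[OF units_group, of x n] by (simp add: int_pow_units_of units_of_carrier)

lemma ipow_add: "x \<in> Units F \<Longrightarrow> x [^] (m + n :: int) = x [^] m \<otimes> x [^] n"
  using group.int_pow_mult[OF units_group, of x m n]
  by (simp add: int_pow_units_of units_of_carrier units_of_mult)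

lemma ipow_one [simp]: "x \<in> Units F \<Longrightarrow> x [^] (1::int) = x"
  using group.int_pow_1[OF units_group, of x] by (simp add: int_pow_units_of units_of_carrier)

lemma ipow_minus_one [simp]: "x \<in> Units F \<Longrightarrow> x [^] (-1::int) = inv x"
  using group.int_pow_neg[OF units_group, of x 1]
  by (simp add: int_pow_units_of units_of_carrier units_of_inv[symmetric]
      group.int_pow_1[OF units_group, simplified units_of_carrier])

text \<open>\<open>n\<close> counts powers of the square root of \<open>q\<close>; a relation
  recorded by \<open>L i j\<close> thus reads \<open>quasi_comm (2 * L i j)\<close>.\<close>

definition quasi_comm :: "int \<Rightarrow> 'a \<Rightarrow> 'a \<Rightarrow> bool" where
  "quasi_comm n x y \<longleftrightarrow> x \<otimes> y = hp n \<odot> (y \<otimes> x)"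

lemma quasi_comm_sym:
  assumes "quasi_comm n x y" "x \<in> carrier F" "y \<in> carrier F"
  shows "quasi_comm (- n) y x"
  using assms unfolding quasi_comm_def by simp

lemma quasi_comm_mult:
  assumes "quasi_comm m x y" "quasi_comm n x z" and [simp]: "x \<in> carrier F" "y \<in> carrier F" "z \<in> carrier F"
  shows "quasi_comm (m + n) x (y \<otimes> z)"
proof -
  have "x \<otimes> (y \<otimes> z) = hp m \<odot> (y \<otimes> x) \<otimes> z"
    using assms(1) by (simp add: quasi_comm_def flip: m_assoc)
  also have "\<dots> = hp m \<odot> (y \<otimes> (x \<otimes> z))" by (simp add: m_assoc)
  also have "\<dots> = hp (m + n) \<odot> (y \<otimes> z \<otimes> x)"
    using assms(2) by (simp add: quasi_comm_def hp_add m_assoc)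
  finally show ?thesis by (simp add: quasi_comm_def)
qed

lemma quasi_comm_one [simp]: "x \<in> carrier F \<Longrightarrow> quasi_comm 0 x \<one>"
  by (simp add: quasi_comm_def)

lemma quasi_comm_sm [simp]:
  assumes "quasi_comm n x y" "x \<in> carrier F" "y \<in> carrier F"
  shows "quasi_comm n x (c \<odot> y)"
  using assms by (simp add: quasi_comm_def mult.commute)

lemma quasi_comm_add:
  assumes "quasi_comm n x y" "quasi_comm n x z" "x \<in> carrier F" "y \<in> carrier F" "z \<in> carrier F"
  shows "quasi_comm n x (y \<oplus> z)"
  using assms by (simp add: quasi_comm_def r_distr l_distr sm_add_right)

lemma quasi_comm_inv:
  assumes "quasi_comm n x y" and [simp]: "x \<in> carrier F" "y \<in> Units F"
  shows "quasi_comm (- n) x (inv y)"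
proof -
  have [simp]: "y \<in> carrier F" using assms(3) by blast
  have "y \<otimes> (x \<otimes> inv y) = hp (- n) \<odot> (x \<otimes> y) \<otimes> inv y"
    using quasi_comm_sym[OF assms(1)] by (simp add: quasi_comm_def flip: m_assoc)
  also have "\<dots> = y \<otimes> (hp (- n) \<odot> (inv y \<otimes> x))"
    by (simp add: m_assoc) (simp flip: m_assoc)
  finally show ?thesis
    unfolding quasi_comm_def by (subst (asm) Units_l_cancel) auto
qed

lemma quasi_comm_pow:
  assumes "quasi_comm l x y" and [simp]: "x \<in> carrier F" "y \<in> Units F"
  shows "quasi_comm (l * n) x (y [^] (n::int))"
proof -
  have [simp]: "y \<in> carrier F" using assms(3) by blast
  show ?thesis
  proof (induction n rule: int_induct[of _ 0])
    case base
    then show ?case by simp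
  next
    case (step1 i)
    then show ?case
      using quasi_comm_mult[OF step1(2) assms(1)] ipow_add[of y i 1] by (simp add: distrib_left)
  next
    case (step2 i)
    then show ?case
      using quasi_comm_mult[OF step2(2) quasi_comm_inv[OF assms(1)]] ipow_add[of y i "-1"] by (simp add: right_diff_distrib)
  qed
qed

end

subsection \<open>Homogeneous components under conjugation by a unit\<close>

context Kskew
begin

text \<open>For a unit \<open>u\<close> this is the eigenspace of the conjugation by
  \<open>u\<close> with eigenvalue \<open>hp m\<close>.\<close>

definition homog :: "'a \<Rightarrow> int \<Rightarrow> 'a set" where
  "homog u m = {f \<in> carrier F. quasi_comm m u f}"

lemma homog_carrier: "f \<in> homog u m \<Longrightarrow> f \<in> carrier F"
  by (simp add: homog_def)

lemma subsp_homog: "u \<in> carrier F \<Longrightarrow> subsp (homog u m)"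
proof (rule subspI)
  assume u: "u \<in> carrier F"
  then show "\<zero> \<in> homog u m" by (simp add: homog_def quasi_comm_def)
  show "x \<oplus> y \<in> homog u m" if "x \<in> homog u m" "y \<in> homog u m" for x y
    using that u by (simp add: homog_def quasi_comm_add)
  show "c \<odot> x \<in> homog u m" if "x \<in> homog u m" for c x
    using that u by (simp add: homog_def)
qed (auto simp: homog_def)

lemma homog_mult: "u \<in> carrier F \<Longrightarrow> f \<in> homog u m \<Longrightarrow> g \<in> homog u n \<Longrightarrow> f \<otimes> g \<in> homog u (m + n)"
  by (simp add: homog_def quasi_comm_mult)

definition conj_stable :: "'a \<Rightarrow> 'a set \<Rightarrow> bool" where
  "conj_stable u V \<longleftrightarrow> (\<forall>f\<in>V. u \<otimes> f \<otimes> inv u \<in> V)"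

lemma conj_homog:
  assumes "u \<in> Units F" "f \<in> homog u m"
  shows "u \<otimes> f \<otimes> inv u = hp m \<odot> f"
  using assms by (simp add: homog_def quasi_comm_def) (simp add: m_assoc)

text \<open>The eigenvalues of the conjugation on different degrees are different, so that a stable
  subspace contains the components of its elements.\<close>

lemma homog_components:
  assumes u: "u \<in> Units F" and V: "subsp V" "conj_stable u V"
    and "finite S" "\<And>m. m \<in> S \<Longrightarrow> f m \<in> homog u m" "(\<Oplus>m\<in>S. f m) \<in> V" "m \<in> S"
  shows "f m \<in> V"
  using assms(4-)
proof (induction S arbitrary: f m rule: finite_induct)
  case empty
  then show ?case by simp
next
  case (insert n S)
  define g where "g = (\<Oplus>m\<in>insert n S. f m)"
  have fc: "f m \<in> carrier F" if "m \<in> insert n S" for m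
    using insert.prems(1)[OF that] by (rule homog_carrier)
  have gc: "g \<in> carrier F"
    unfolding g_def using fc by (intro finsum_closed) auto
  have g_eq: "g = f n \<oplus> (\<Oplus>m\<in>S. f m)"
    unfolding g_def using insert.hyps fc by (intro finsum_insert) auto
  have conj_g: "u \<otimes> g \<otimes> inv u = (\<Oplus>m\<in>insert n S. hp m \<odot> f m)"
  proof -
    have "u \<otimes> g = (\<Oplus>m\<in>insert n S. u \<otimes> f m)"
      unfolding g_def using u fc insert.hyps by (intro finsum_rdistr) auto
    then have "u \<otimes> g \<otimes> inv u = (\<Oplus>m\<in>insert n S. u \<otimes> f m \<otimes> inv u)"
      using u fc insert.hyps by (simp only:) (intro finsum_ldistr, auto)
    also have "\<dots> = (\<Oplus>m\<in>insert n S. hp m \<odot> f m)"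
      using conj_homog[OF u insert.prems(1)] fc by (intro finsum_cong' refl) blast+
    finally show ?thesis .
  qed
  \<comment> \<open>Conjugation minus \<open>hp n\<close> annihilates the component of degree
    \<open>n\<close> and multiplies every other one by a nonzero scalar, which leaves a shorter sum
    in \<open>V\<close>.\<close>
  have "(\<Oplus>m\<in>S. (hp m - hp n) \<odot> f m) = (\<Oplus>m\<in>insert n S. (hp m - hp n) \<odot> f m)"
    using insert.hyps fc by (subst finsum_insert) (auto intro!: l_zero[symmetric] finsum_closed)
  also have "\<dots> = (\<Oplus>m\<in>insert n S. hp m \<odot> f m \<oplus> (- hp n) \<odot> f m)"
    using fc by (intro finsum_cong') (auto simp: sm_diff_left sm_uminus a_minus_def)
  also have "\<dots> = u \<otimes> g \<otimes> inv u \<oplus> (- hp n) \<odot> g"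
    unfolding conj_g using fc by (subst finsum_addf) (auto simp: g_def sm_finsum)
  also have "\<dots> \<in> V"
    using V insert.prems(2) by (auto simp: g_def conj_stable_def intro!: subsp_add subsp_sm)
  finally have sum: "(\<Oplus>m\<in>S. (hp m - hp n) \<odot> f m) \<in> V" .
  have S: "f m \<in> V" if "m \<in> S" for m
  proof -
    have "(hp m - hp n) \<odot> f m \<in> V"
    proof (rule insert.IH[OF _ sum that])
      show "(hp k - hp n) \<odot> f k \<in> homog u k" if "k \<in> S" for k
        using that insert.prems(1)[of k] u by (intro subsp_sm subsp_homog) auto
    qed
    moreover have "m \<noteq> n" using that insert.hyps by auto
    ultimately show ?thesis
      using fc that by (subst (asm) subsp_sm_iff[OF V(1)]) auto
  qed
  have "(\<Oplus>m\<in>S. f m) \<in> V" using S by (intro subsp_finsum[OF V(1)]) auto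
  then have "g \<ominus> (\<Oplus>m\<in>S. f m) \<in> V"
    using V insert.prems(2) by (auto simp: g_def intro!: subsp_minus)
  moreover have "g \<ominus> (\<Oplus>m\<in>S. f m) = f n"
  proof -
    have "(\<Oplus>m\<in>S. f m) \<in> carrier F" using fc by (intro finsum_closed) auto
    then show ?thesis
      using fc[of n] unfolding g_eq a_minus_def by (simp add: a_assoc r_neg)
  qed
  ultimately show ?case using S insert.prems(3) by auto
qed

lemma homog_sum_zero:
  assumes u: "u \<in> Units F" and "finite S" "\<And>m. m \<in> S \<Longrightarrow> f m \<in> homog u m"
    "(\<Oplus>m\<in>S. f m) = \<zero>" "m \<in> S"
  shows "f m = \<zero>"
proof -
  have "subsp {\<zero>}" "conj_stable u {\<zero>}"
    using u by (simp_all add: subsp_def conj_stable_def)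
  from homog_components[OF u this assms(2,3) _ assms(5)] show ?thesis
    using assms(4) by auto
qed

text \<open>\<open>S\<close> only has to contain the support of the total family \<open>f\<close>,
  so that two decompositions can be moved to a common index set and then added or compared.\<close>

definition decomposes :: "'a \<Rightarrow> int set \<Rightarrow> (int \<Rightarrow> 'a) \<Rightarrow> 'a \<Rightarrow> bool" where
  "decomposes u S f g \<longleftrightarrow> finite S \<and> (\<forall>m. f m \<in> homog u m) \<and> (\<forall>m. m \<notin> S \<longrightarrow> f m = \<zero>) \<and>
     g = (\<Oplus>m\<in>S. f m)"

lemma decomposes_mono:
  assumes "decomposes u S f g" "S \<subseteq> S'" "finite S'"
  shows "decomposes u S' f g"
proof -
  have "(\<Oplus>m\<in>S. f m) = (\<Oplus>m\<in>S'. f m)"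
    using assms by (intro add.finprod_mono_neutral_cong_left)
      (auto simp: decomposes_def intro: homog_carrier)
  then show ?thesis using assms by (auto simp: decomposes_def)
qed

lemma decomposes_add:
  assumes u: "u \<in> carrier F" and "decomposes u S f g" "decomposes u S f' g'"
  shows "decomposes u S (\<lambda>m. f m \<oplus> f' m) (g \<oplus> g')"
  using assms subsp_add[OF subsp_homog[OF u]]
  by (auto simp: decomposes_def finsum_addf homog_def)

lemma decomposes_mult:
  assumes u: "u \<in> carrier F" and "decomposes u S f g" and h: "h \<in> homog u e"
  shows "decomposes u ((\<lambda>m. m + e) ` S) (\<lambda>m. h \<otimes> f (m - e)) (h \<otimes> g)"
    and "decomposes u ((\<lambda>m. m + e) ` S) (\<lambda>m. f (m - e) \<otimes> h) (g \<otimes> h)"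
proof -
  have f: "finite S" "\<And>m. f m \<in> homog u m" "\<And>m. m \<notin> S \<Longrightarrow> f m = \<zero>" "g = (\<Oplus>m\<in>S. f m)"
    using assms(2) by (auto simp: decomposes_def)
  have fc: "f m \<in> carrier F" for m by (rule homog_carrier[OF f(2)])
  have hc: "h \<in> carrier F" by (rule homog_carrier[OF h])
  have nS: "f (m - e) = \<zero>" if "m \<notin> (\<lambda>m. m + e) ` S" for m
    using that f(3)[of "m - e"] by force
  have inj: "inj_on (\<lambda>m. m + e) S" by (simp add: inj_on_def)
  have "h \<otimes> f (m - e) \<in> homog u m" "f (m - e) \<otimes> h \<in> homog u m" for m
    using homog_mult[OF u h f(2), of "m - e"] homog_mult[OF u f(2) h, of "m - e"] by auto
  then show "decomposes u ((\<lambda>m. m + e) ` S) (\<lambda>m. h \<otimes> f (m - e)) (h \<otimes> g)"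
    "decomposes u ((\<lambda>m. m + e) ` S) (\<lambda>m. f (m - e) \<otimes> h) (g \<otimes> h)"
    using f(1,4) nS hc fc inj
    by (auto simp: decomposes_def finsum_reindex finsum_rdistr finsum_ldistr)
qed

lemma decomposes_components:
  assumes u: "u \<in> Units F" and V: "subsp V" "conj_stable u V"
    and "decomposes u S f g" "g \<in> V"
  shows "f m \<in> V"
proof (cases "m \<in> S")
  case True
  then show ?thesis
    using assms(4,5) by (intro homog_components[OF u V, of S f m]) (simp_all add: decomposes_def)
next
  case False
  then show ?thesis using assms(4) subsp_zero[OF V(1)] by (simp add: decomposes_def)
qed

text \<open>The difference of the two families decomposes zero, and the zero subspace is stable
  under conjugation.\<close>

lemma decomposes_unique:
  assumes u: "u \<in> Units F" and "decomposes u S f g" "decomposes u S' f' g"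
  shows "f m = f' m"
proof -
  define T where "T = S \<union> S'"
  have T: "decomposes u T f g" "decomposes u T f' g"
    using assms(2,3) decomposes_mono[OF assms(2), of T] decomposes_mono[OF assms(3), of T]
    by (simp_all add: T_def decomposes_def)
  then have fc: "f m \<in> carrier F" "f' m \<in> carrier F" for m
    by (auto simp: decomposes_def intro: homog_carrier)
  have "(\<lambda>m. \<ominus> f' m) = (\<lambda>m. (-1) \<odot> f' m)" using fc by (simp add: sm_minus_one)
  have "decomposes u T (\<lambda>m. (-1) \<odot> f' m) ((-1) \<odot> g)"
    using T(2) u fc by (auto simp: decomposes_def Pi_def sm_finsum subsp_sm[OF subsp_homog])
  from decomposes_add[OF _ T(1) this] have
    "decomposes u T (\<lambda>m. f m \<oplus> (-1) \<odot> f' m) (g \<oplus> (-1) \<odot> g)" using u by blast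
  moreover have "g \<oplus> (-1) \<odot> g = \<zero>"
    using T fc by (auto simp: decomposes_def sm_minus_one r_neg)
  ultimately have "f m \<oplus> (-1) \<odot> f' m \<in> {\<zero>}"
    using u by (intro decomposes_components[where V = "{\<zero>}" and u = u])
      (auto simp: subsp_def conj_stable_def)
  then show ?thesis
    using fc[of m] minus_equality[of "f m" "\<ominus> f' m"] by (simp add: sm_minus_one)
qed

lemma decomposes_homog:
  "u \<in> carrier F \<Longrightarrow> h \<in> homog u e \<Longrightarrow> decomposes u {e} (\<lambda>m. if m = e then h else \<zero>) h"
  using subsp_zero[OF subsp_homog] homog_carrier[of h u e] by (simp add: decomposes_def Pi_def)

text \<open>\<open>P\<close> transports a bound on the degrees of the spanning elements; with
  \<open>P = {0..}\<close> it shows that a polynomial in one variable has no part of negative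
  degree.\<close>

lemma lspan_decomposes:
  assumes u: "u \<in> Units F"
    and B: "\<And>s. s \<in> B \<Longrightarrow> \<exists>m\<in>P. s \<in> homog u m"
    and f: "f \<in> lspan B"
  shows "\<exists>S fam. S \<subseteq> P \<and> decomposes u S fam f"
  using f
proof (induction)
  case zero
  have "decomposes u {} (\<lambda>_. \<zero>) \<zero>"
    using u subsp_zero[OF subsp_homog] by (auto simp: decomposes_def)
  then show ?case by blast
next
  case (add f s c)
  then obtain S fam m where S: "S \<subseteq> P" "decomposes u S fam f" and m: "m \<in> P" "s \<in> homog u m"
    using B by blast
  have uc: "u \<in> carrier F" using u by blast
  define T where "T = insert m S"
  have T: "T \<subseteq> P" "finite T" using S m by (auto simp: T_def decomposes_def)
  have "decomposes u T fam f"
    using S T by (intro decomposes_mono[OF S(2)]) (auto simp: T_def)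
  moreover have "decomposes u T (\<lambda>n. if n = m then c \<odot> s else \<zero>) (c \<odot> s)"
    using m(2) T subsp_sm[OF subsp_homog[OF uc]]
    by (intro decomposes_mono[OF decomposes_homog[OF uc]]) (auto simp: T_def)
  ultimately show ?case
    using decomposes_add[OF uc] T by blast
qed

text \<open>Cancelling \<open>1 + Y\<close> where \<open>Y\<close> has nonzero degree: compare the components from the lowest
  (for positive degree of \<open>Y\<close>) or the highest (for negative degree) one on.\<close>

lemma one_plus_cancel:
  assumes u: "u \<in> Units F" and V: "subsp V" "conj_stable u V"
    and Y: "Y \<in> homog u e" "e \<noteq> 0" "\<And>f. f \<in> V \<Longrightarrow> Y \<otimes> f \<in> V"
    and f: "decomposes u S fam f" and mem: "(\<one> \<oplus> Y) \<otimes> f \<in> V"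
  shows "f \<in> V"
proof -
  have uc: "u \<in> carrier F" using u by blast
  have fin: "finite S" and fam: "\<And>m. fam m \<in> homog u m" "\<And>m. m \<notin> S \<Longrightarrow> fam m = \<zero>"
    and f_eq: "f = (\<Oplus>m\<in>S. fam m)"
    using f by (auto simp: decomposes_def)
  have fc: "fam m \<in> carrier F" for m by (rule homog_carrier[OF fam(1)])
  have Yc: "Y \<in> carrier F" by (rule homog_carrier[OF Y(1)])
  have fcc: "f \<in> carrier F" unfolding f_eq using fc by (intro finsum_closed) auto
  define T where "T = S \<union> (\<lambda>m. m + e) ` S"
  have "decomposes u T (\<lambda>m. fam m \<oplus> Y \<otimes> fam (m - e)) (f \<oplus> Y \<otimes> f)"
    using fin by (intro decomposes_add[OF uc] decomposes_mono[OF f]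
        decomposes_mono[OF decomposes_mult(1)[OF uc f Y(1)]]) (auto simp: T_def)
  then have comp: "fam m \<oplus> Y \<otimes> fam (m - e) \<in> V" for m
    using mem Yc fcc by (intro decomposes_components[OF u V]) (auto simp: l_distr)
  \<comment> \<open>The component of \<open>(\<one> \<oplus> Y) \<otimes> f\<close> in degree
    \<open>m\<close> involves only \<open>fam m\<close> and \<open>fam (m - e)\<close>, which gives
    a recursion in steps of \<open>e\<close>.\<close>
  have step: "fam m \<in> V" if "fam (m - e) \<in> V" for m
  proof -
    have "fam m \<oplus> Y \<otimes> fam (m - e) \<ominus> Y \<otimes> fam (m - e) \<in> V"
      by (intro subsp_minus[OF V(1)] comp Y(3) that)
    moreover have "fam m \<oplus> Y \<otimes> fam (m - e) \<ominus> Y \<otimes> fam (m - e) = fam m"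
      using fc Yc by (simp add: a_minus_def a_assoc r_neg)
    ultimately show ?thesis by simp
  qed
  obtain N :: nat where N: "\<And>m. m \<in> S \<Longrightarrow> \<bar>m\<bar> < int N"
    using fin by (metis finite_imageI finite_nat_set_iff_bounded image_eqI nat_less_iff abs_ge_zero)
  have "fam m \<in> V" for m
  proof -
    have aux: "fam (m - int k * e) \<in> V \<Longrightarrow> fam m \<in> V" for k
    proof (induction k)
      case (Suc k)
      then show ?case using step[of "m - int k * e"] by (simp add: algebra_simps)
    qed simp
    \<comment> \<open>As \<open>e\<close> is a nonzero integer, \<open>\<bar>m\<bar> + N\<close>
      steps lead outside the support, where the recursion starts with zero.\<close>
    have "\<bar>m - int (nat \<bar>m\<bar> + N) * e\<bar> \<ge> int N"
    proof -
      have "int (nat \<bar>m\<bar> + N) * 1 \<le> int (nat \<bar>m\<bar> + N) * \<bar>e\<bar>"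
        using Y(2) by (intro mult_left_mono) auto
      also have "\<dots> = \<bar>int (nat \<bar>m\<bar> + N) * e\<bar>" by (simp add: abs_mult)
      finally show ?thesis using abs_triangle_ineq2_sym[of "int (nat \<bar>m\<bar> + N) * e" m] by simp
    qed
    then have "m - int (nat \<bar>m\<bar> + N) * e \<notin> S" using N by fastforce
    then have "fam (m - int (nat \<bar>m\<bar> + N) * e) = \<zero>" by (rule fam(2))
    then show ?thesis using aux subsp_zero[OF V(1)] by metis
  qed
  then show ?thesis unfolding f_eq by (intro subsp_finsum[OF V(1)]) auto
qed

text \<open>Only degree 0 survives in the product. An element \<open>m\<close> of the support of
  \<open>t\<close> with \<open>m - e\<close> outside it must be 0, and one with \<open>m + e\<close>
  outside it must be \<open>- e\<close>. Applied to the two ends of the support, this puts the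
  minimum above the maximum, for either sign of \<open>e\<close>.\<close>

lemma one_plus_not_left_invertible:
  assumes u: "u \<in> Units F" and Y: "Y \<in> homog u e" "e \<noteq> 0" "Y \<noteq> \<zero>"
    and t: "decomposes u S fam t" and eq: "t \<otimes> (\<one> \<oplus> Y) = \<one>"
  shows False
proof -
  have uc: "u \<in> carrier F" using u by blast
  have fin: "finite S" and fam: "\<And>m. fam m \<in> homog u m" "\<And>m. m \<notin> S \<Longrightarrow> fam m = \<zero>"
    and t_eq: "t = (\<Oplus>m\<in>S. fam m)"
    using t by (auto simp: decomposes_def)
  have fc: "fam m \<in> carrier F" for m by (rule homog_carrier[OF fam(1)])
  have Yc: "Y \<in> carrier F" by (rule homog_carrier[OF Y(1)])
  have tc: "t \<in> carrier F" unfolding t_eq using fc by (intro finsum_closed) auto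
  define T where "T = S \<union> (\<lambda>m. m + e) ` S"
  have "decomposes u T (\<lambda>m. fam m \<oplus> fam (m - e) \<otimes> Y) (t \<oplus> t \<otimes> Y)"
    using fin by (intro decomposes_add[OF uc] decomposes_mono[OF t]
        decomposes_mono[OF decomposes_mult(2)[OF uc t Y(1)]]) (auto simp: T_def)
  moreover have "t \<oplus> t \<otimes> Y = \<one>" using eq tc Yc by (simp add: r_distr)
  ultimately have sum: "decomposes u T (\<lambda>m. fam m \<oplus> fam (m - e) \<otimes> Y) \<one>" by simp
  have "decomposes u {0} (\<lambda>m. if m = 0 then \<one> else \<zero>) \<one>"
    using uc by (intro decomposes_homog) (auto simp: homog_def)
  from decomposes_unique[OF u sum this]
  have comp: "fam m \<oplus> fam (m - e) \<otimes> Y = (if m = 0 then \<one> else \<zero>)" for m .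
  define A where "A = {m. fam m \<noteq> \<zero>}"
  have "A \<subseteq> S" using fam(2) by (auto simp: A_def)
  then have finA: "finite A" using fin by (rule finite_subset)
  have "A \<noteq> {}"
  proof
    assume "A = {}"
    then have "fam m = \<zero>" for m by (auto simp: A_def)
    then show False using comp[of 0] Yc by simp
  qed
  have low: "m = 0" if "m \<in> A" "m - e \<notin> A" for m
  proof (rule ccontr)
    assume "m \<noteq> 0"
    moreover have "fam (m - e) = \<zero>" using that(2) by (simp add: A_def)
    ultimately show False using comp[of m] that(1) fc[of m] Yc by (simp add: A_def)
  qed
  have high: "m = - e" if "m \<in> A" "m + e \<notin> A" for m
  proof (rule ccontr)
    assume "m \<noteq> - e"
    then have "m + e \<noteq> 0" by simp
    moreover have "fam (m + e) = \<zero>" using that(2) by (simp add: A_def)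
    ultimately have "fam m \<otimes> Y = \<zero>" using comp[of "m + e"] fc[of m] Yc by simp
    then show False using that(1) fc[of m] Yc Y(3) by (simp add: A_def)
  qed
  have Min: "Min A \<in> A" "Min A - k \<notin> A" if "k > 0" for k
  proof -
    show "Min A \<in> A" by (rule Min_in[OF finA \<open>A \<noteq> {}\<close>])
    show "Min A - k \<notin> A"
    proof
      assume "Min A - k \<in> A"
      from Min_le[OF finA this] that show False by linarith
    qed
  qed
  have Max: "Max A \<in> A" "Max A + k \<notin> A" if "k > 0" for k
  proof -
    show "Max A \<in> A" by (rule Max_in[OF finA \<open>A \<noteq> {}\<close>])
    show "Max A + k \<notin> A"
    proof
      assume "Max A + k \<in> A"
      from Max_ge[OF finA this] that show False by linarith
    qed
  qed
  have le: "Min A \<le> Max A" using Min_le[OF finA Max_in[OF finA \<open>A \<noteq> {}\<close>]] .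
  show False
  proof (cases "e > 0")
    case True
    then show ?thesis
      using low[OF Min[OF True]] high[OF Max[OF True]] le by linarith
  next
    case False
    then have e: "- e > 0" using Y(2) by simp
    have "Min A = - e" "Max A = 0"
      using high[of "Min A"] low[of "Max A"] Min[OF e] Max[OF e] by simp_all
    then show ?thesis using le e by linarith
  qed
qed

end

subsection \<open>Toric frames\<close>

text \<open>For the matrix of a seed this is the exponent in
  \<open>M a \<otimes> M b = hp (lf r L a b) \<odot> M (a + b)\<close>; the monomials therefore
  quasi-commute with twice its value.\<close>

definition lf :: "nat \<Rightarrow> (nat \<Rightarrow> nat \<Rightarrow> int) \<Rightarrow> (nat \<Rightarrow> int) \<Rightarrow> (nat \<Rightarrow> int) \<Rightarrow> int" where
  "lf r L a b = (\<Sum>i<r. \<Sum>j<r. a i * b j * L i j)"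

definition uvec :: "nat \<Rightarrow> nat \<Rightarrow> int" where
  "uvec i = (\<lambda>j. if j = i then 1 else 0)"

definition sc :: "int \<Rightarrow> (nat \<Rightarrow> int) \<Rightarrow> nat \<Rightarrow> int" where
  "sc n a = (\<lambda>j. n * a j)"

lemma sc_apply [simp]: "sc n a j = n * a j" by (simp add: sc_def)

lemma sc_simps [simp]: "sc 0 a = 0" "sc 1 a = a"
  by (auto simp: sc_def)

lemma uvec_simps [simp]: "uvec i i = 1" "j \<noteq> i \<Longrightarrow> uvec i j = 0"
  by (simp_all add: uvec_def)

lemma lf_cong: "(\<And>i. i < r \<Longrightarrow> a i = a' i) \<Longrightarrow> (\<And>i. i < r \<Longrightarrow> b i = b' i) \<Longrightarrow> lf r L a b = lf r L a' b'"
  by (simp add: lf_def)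

lemma lf_add: "lf r L (a + a') b = lf r L a b + lf r L a' b" "lf r L a (b + b') = lf r L a b + lf r L a b'"
  by (simp_all add: lf_def algebra_simps sum.distrib)

lemma lf_uminus: "lf r L (- a) b = - lf r L a b" "lf r L a (- b) = - lf r L a b"
  by (simp_all add: lf_def sum_negf)

lemma lf_sc: "lf r L (sc n a) b = n * lf r L a b" "lf r L a (sc n b) = n * lf r L a b"
  by (simp_all add: lf_def sum_distrib_left ac_simps)

lemma lf_skew:
  assumes "\<And>i j. i < r \<Longrightarrow> j < r \<Longrightarrow> L i j = - L j i"
  shows "lf r L a b = - lf r L b a"
proof -
  have "lf r L a b = (\<Sum>j<r. \<Sum>i<r. a i * b j * L i j)"
    unfolding lf_def by (rule sum.swap)
  also have "\<dots> = (\<Sum>j<r. \<Sum>i<r. - (b j * a i * L j i))"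
  proof (intro sum.cong refl)
    fix i j assume "j \<in> {..<r}" "i \<in> {..<r}"
    then have "L i j = - L j i" by (intro assms) simp_all
    then show "a i * b j * L i j = - (b j * a i * L j i)" by simp
  qed
  finally show ?thesis by (simp add: lf_def sum_negf)
qed

text \<open>Brings the form to a sum over pairs with \<open>i < j\<close>, the shape of the
  normalising exponent, so that the two can be compared term by term.\<close>

lemma lf_expand:
  assumes "\<And>i j. i < r \<Longrightarrow> j < r \<Longrightarrow> L i j = - L j i"
  shows "lf r L a b = (\<Sum>j<r. \<Sum>i<j. (a j * b i - a i * b j) * L j i)"
  using assms
proof (induction r)
  case 0
  then show ?case by (simp add: lf_def)
next
  case (Suc r)
  have L0: "L r r = 0" using Suc.prems[of r r] by simp
  have "lf (Suc r) L a b = lf r L a b + (\<Sum>j<r. a r * b j * L r j) + (\<Sum>i<r. a i * b r * L i r)"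
    using L0 by (simp add: lf_def sum.distrib)
  also have "(\<Sum>i<r. a i * b r * L i r) = (\<Sum>i<r. - (a i * b r * L r i))"
  proof (intro sum.cong refl)
    fix i assume "i \<in> {..<r}"
    then have "L i r = - L r i" by (intro Suc.prems) simp_all
    then show "a i * b r * L i r = - (a i * b r * L r i)" by simp
  qed
  also have "lf r L a b = (\<Sum>j<r. \<Sum>i<j. (a j * b i - a i * b j) * L j i)"
    by (intro Suc.IH Suc.prems) simp_all
  finally show ?case
    by (simp add: sum_negf left_diff_distrib sum_subtractf)
qed

context Kskew
begin

lemma foldr_mult_closed:
  assumes "\<And>i. i \<in> set js \<Longrightarrow> g i \<in> carrier F" "z \<in> carrier F"
  shows "foldr (\<lambda>i z. g i \<otimes> z) js z \<in> carrier F"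
  using assms by (induction js) simp_all

lemma foldr_mult_right:
  assumes "\<And>i. i \<in> set js \<Longrightarrow> g i \<in> carrier F" and z: "z \<in> carrier F"
  shows "foldr (\<lambda>i z. g i \<otimes> z) js z = foldr (\<lambda>i z. g i \<otimes> z) js \<one> \<otimes> z"
  using assms(1)
proof (induction js)
  case (Cons i js)
  have "foldr (\<lambda>i z. g i \<otimes> z) js \<one> \<in> carrier F"
    using Cons.prems by (intro foldr_mult_closed) simp_all
  moreover have "foldr (\<lambda>i z. g i \<otimes> z) js z = foldr (\<lambda>i z. g i \<otimes> z) js \<one> \<otimes> z"
    using Cons.prems by (intro Cons.IH) simp
  ultimately show ?case
    using Cons.prems[of i] z by (simp add: m_assoc)
qed (use z in simp)

lemma om_0 [simp]: "ordered_monomial F 0 x a = \<one>"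
  by (simp add: ordered_monomial_def)

text \<open>The fold opens at the first factor, whereas induction on the number of variables has to
  split off the last one.\<close>

lemma om_Suc:
  assumes "\<And>i. i < Suc r \<Longrightarrow> x i \<in> Units F"
  shows "ordered_monomial F (Suc r) x a = ordered_monomial F r x a \<otimes> x r [^] a r"
proof -
  have "foldr (\<lambda>i z. x i [^] a i \<otimes> z) [0..<r] (x r [^] a r) =
      foldr (\<lambda>i z. x i [^] a i \<otimes> z) [0..<r] \<one> \<otimes> x r [^] a r"
    using assms by (intro foldr_mult_right) auto
  then show ?thesis
    using assms[of r] by (simp add: ordered_monomial_def)
qed

lemma om_Units:
  assumes "\<And>i. i < r \<Longrightarrow> x i \<in> Units F"
  shows "ordered_monomial F r x a \<in> Units F"
  using assms by (induction r) (auto simp: om_Suc)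

lemma om_cong:
  assumes "\<And>i. i < r \<Longrightarrow> x i = y i" "\<And>i. i < r \<Longrightarrow> a i = b i"
  shows "ordered_monomial F r x a = ordered_monomial F r y b"
  unfolding ordered_monomial_def using assms by (intro foldr_cong) auto

lemma om_quasi_comm:
  assumes "\<And>i. i < r \<Longrightarrow> x i \<in> Units F" "\<And>i. i < r \<Longrightarrow> quasi_comm (l i) z (x i)" and z: "z \<in> carrier F"
  shows "quasi_comm (\<Sum>i<r. l i * a i) z (ordered_monomial F r x a)"
  using assms(1,2)
proof (induction r)
  case (Suc r)
  have "quasi_comm ((\<Sum>i<r. l i * a i) + l r * a r) z (ordered_monomial F r x a \<otimes> x r [^] a r)"
    using Suc z om_Units[of r x a] by (intro quasi_comm_mult quasi_comm_pow Suc.IH) auto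
  then show ?case using Suc.prems by (simp add: om_Suc)
qed (use z in simp)

lemma quasi_comm_pow_left:
  assumes "quasi_comm l x y" "x \<in> Units F" "y \<in> carrier F"
  shows "quasi_comm (l * n) (x [^] (n::int)) y"
proof -
  have "quasi_comm (- l * n) y (x [^] n)"
    using assms by (intro quasi_comm_pow quasi_comm_sym) auto
  from quasi_comm_sym[OF this] show ?thesis using assms by simp
qed

text \<open>In the induction, the power of the last variable in the first monomial has to pass the
  rest of the second one; each such exchange contributes to the exponent.\<close>

lemma om_mult:
  assumes "\<And>i. i < r \<Longrightarrow> x i \<in> Units F"
    and "\<And>i j. i < r \<Longrightarrow> j < r \<Longrightarrow> quasi_comm (2 * L i j) (x i) (x j)"
  shows "ordered_monomial F r x a \<otimes> ordered_monomial F r x b =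
    hp (\<Sum>j<r. \<Sum>i<j. 2 * (a j * b i * L j i)) \<odot> ordered_monomial F r x (a + b)"
  using assms
proof (induction r)
  case (Suc r)
  define A B W where "A = ordered_monomial F r x a" and "B = ordered_monomial F r x b"
    and "W = ordered_monomial F r x (a + b)"
  define V Z where "V = x r [^] a r" and "Z = x r [^] b r"
  define k where "k = (\<Sum>i<r. 2 * (a r * b i * L r i))"
  define m where "m = (\<Sum>j<r. \<Sum>i<j. 2 * (a j * b i * L j i))"
  have c [simp]: "A \<in> carrier F" "B \<in> carrier F" "W \<in> carrier F" "V \<in> carrier F" "Z \<in> carrier F"
    using Suc.prems(1) om_Units[of r x] by (auto simp: A_def B_def W_def V_def Z_def)
  have IH: "A \<otimes> B = hp m \<odot> W"
    unfolding A_def B_def W_def m_def using Suc.prems by (intro Suc.IH) auto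
  have "quasi_comm (\<Sum>i<r. 2 * L r i * a r * b i) V B"
    unfolding V_def B_def using Suc.prems by (intro om_quasi_comm quasi_comm_pow_left) auto
  moreover have "(\<Sum>i<r. 2 * L r i * a r * b i) = k"
    unfolding k_def by (intro sum.cong refl) simp
  ultimately have XB: "V \<otimes> B = hp k \<odot> (B \<otimes> V)" by (simp add: quasi_comm_def)
  have XZ: "V \<otimes> Z = x r [^] ((a + b) r)"
    using Suc.prems(1)[of r] by (simp add: V_def Z_def ipow_add)
  have "A \<otimes> V \<otimes> (B \<otimes> Z) = A \<otimes> (V \<otimes> B) \<otimes> Z" by (simp add: m_assoc)
  also have "\<dots> = hp k \<odot> (A \<otimes> B \<otimes> (V \<otimes> Z))" unfolding XB by (simp add: m_assoc)
  also have "\<dots> = hp (k + m) \<odot> (W \<otimes> (V \<otimes> Z))" unfolding IH by (simp add: hp_add)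
  finally have *: "A \<otimes> V \<otimes> (B \<otimes> Z) = hp (k + m) \<odot> (W \<otimes> (V \<otimes> Z))" .
  have S: "ordered_monomial F (Suc r) x c = ordered_monomial F r x c \<otimes> x r [^] c r" for c
    by (rule om_Suc[OF Suc.prems(1)])
  show ?case
    unfolding S A_def[symmetric] B_def[symmetric] W_def[symmetric] V_def[symmetric] Z_def[symmetric]
      XZ[symmetric] * by (simp add: k_def m_def add.commute)
qed simp

lemma om_zero:
  assumes "\<And>i. i < r \<Longrightarrow> x i \<in> Units F" "\<And>i. i < r \<Longrightarrow> a i = 0"
  shows "ordered_monomial F r x a = \<one>"
  using assms by (induction r) (auto simp: om_Suc)

lemma om_uvec:
  assumes "\<And>i. i < r \<Longrightarrow> x i \<in> Units F" "k < r"
  shows "ordered_monomial F r x (uvec k) = x k"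
  using assms
proof (induction r)
  case (Suc r)
  show ?case
  proof (cases "k = r")
    case True
    have "ordered_monomial F r x (uvec k) = \<one>"
      using Suc.prems True by (intro om_zero) auto
    then show ?thesis using Suc.prems True by (simp add: om_Suc)
  next
    case False
    then have "ordered_monomial F r x (uvec k) = x k" using Suc by simp
    then show ?thesis using Suc.prems False by (simp add: om_Suc)
  qed
qed simp

end

text \<open>The conditions that one mutation passes on to the next seed, with the same
  \<open>d\<close>. Monomials are told apart by their degrees under conjugation, which
  \<open>compat\<close> and \<open>d > 0\<close> control.\<close>

locale preseed = Kskew F for F :: "(qfield, 'a) module" (structure) +
  fixes r :: nat and mut :: "nat set" and x :: "nat \<Rightarrow> 'a" and B L :: "nat \<Rightarrow> nat \<Rightarrow> int" and d :: int
  assumes x_Units: "i < r \<Longrightarrow> x i \<in> Units F"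
    and x_comm: "i < r \<Longrightarrow> j < r \<Longrightarrow> x i \<otimes> x j = qpow (L i j) \<odot> (x j \<otimes> x i)"
    and L_skew: "i < r \<Longrightarrow> j < r \<Longrightarrow> L i j = - L j i"
    and B_skew: "i < r \<Longrightarrow> j < r \<Longrightarrow> B i j = - B j i"
    and mut_less: "i \<in> mut \<Longrightarrow> i < r"
    and d_pos: "d > 0"
    and compat: "i \<in> mut \<Longrightarrow> j < r \<Longrightarrow> (\<Sum>k<r. B k i * L k j) = (if i = j then d else 0)"
begin

definition M :: "(nat \<Rightarrow> int) \<Rightarrow> 'a" where
  "M = normalised_monomial F r x L"

definition bv :: "nat \<Rightarrow> nat \<Rightarrow> int" where
  "bv i = (\<lambda>j. B j i)"

abbreviation \<Lambda> where "\<Lambda> \<equiv> lf r L"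

lemma bv_apply [simp]: "bv i j = B j i" by (simp add: bv_def)

lemma x_quasi_comm: "i < r \<Longrightarrow> j < r \<Longrightarrow> quasi_comm (2 * L i j) (x i) (x j)"
  unfolding quasi_comm_def qpow_def[symmetric] by (rule x_comm)

lemma M_Units [simp]: "M a \<in> Units F"
  unfolding M_def normalised_monomial_def using x_Units by (intro Units_sm om_Units) auto

lemma M_carrier [simp]: "M a \<in> carrier F" by simp

lemma M_nonzero [simp]: "M a \<noteq> \<zero>" using M_Units[of a] Units_iff by blast

lemma M_cong: "(\<And>i. i < r \<Longrightarrow> a i = b i) \<Longrightarrow> M a = M b"
  unfolding M_def normalised_monomial_def by (simp add: om_cong[of r x x a b])

text \<open>The exponent \<open>2 * (a j * b i * L j i)\<close> from \<open>om_mult\<close> splits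
  into a skew and a symmetric half; the symmetric half is \<open>Q (a + b) - Q a - Q b\<close> and
  disappears in the normalisation.\<close>

lemma M_mult: "M a \<otimes> M b = hp (\<Lambda> a b) \<odot> M (a + b)"
proof -
  define Q where "Q = (\<lambda>a. \<Sum>j<r. \<Sum>i<j. a i * a j * L j i)"
  have \<Lambda>_expand: "\<Lambda> a b = (\<Sum>j<r. \<Sum>i<j. (a j * b i - a i * b j) * L j i)"
    by (rule lf_expand) (rule L_skew)
  have om: "ordered_monomial F r x c \<in> carrier F" for c
    using om_Units[of r x c] x_Units by auto
  have M: "M c = hp (Q c) \<odot> ordered_monomial F r x c" for c
    by (simp add: M_def normalised_monomial_def Q_def)
  have "Q a + Q b + (\<Sum>j<r. \<Sum>i<j. 2 * (a j * b i * L j i)) = \<Lambda> a b + Q (a + b)"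
    unfolding \<Lambda>_expand Q_def sum.distrib[symmetric]
    by (intro sum.cong refl) (simp add: algebra_simps)
  moreover have "M a \<otimes> M b =
      hp (Q a + Q b + (\<Sum>j<r. \<Sum>i<j. 2 * (a j * b i * L j i))) \<odot> ordered_monomial F r x (a + b)"
    using om_mult[of r x L a b] x_Units x_quasi_comm om by (simp add: M hp_add ac_simps)
  ultimately show ?thesis using om by (simp add: M hp_add)
qed

lemma M_zero: "(\<And>i. i < r \<Longrightarrow> a i = 0) \<Longrightarrow> M a = \<one>"
  using om_zero[of r x a] x_Units by (simp add: M_def normalised_monomial_def)

lemma M_0 [simp]: "M 0 = \<one>" by (rule M_zero) simp

lemma M_uvec: "k < r \<Longrightarrow> M (uvec k) = x k"
proof -
  assume k: "k < r"
  have "(\<Sum>j<r. \<Sum>i<j. uvec k i * uvec k j * L j i) = 0"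
    by (intro sum.neutral ballI) (auto simp: uvec_def)
  then show ?thesis
    using om_uvec[of r x k] x_Units k by (simp add: M_def normalised_monomial_def)
qed

lemma \<Lambda>_skew: "\<Lambda> a b = - \<Lambda> b a"
  by (rule lf_skew) (rule L_skew)

lemma \<Lambda>_self [simp]: "\<Lambda> a a = 0"
  using \<Lambda>_skew[of a a] by simp

lemma M_quasi_comm: "quasi_comm (2 * \<Lambda> a b) (M a) (M b)"
  using \<Lambda>_skew[of b a] by (simp add: quasi_comm_def M_mult add.commute flip: hp_add)

lemma M_homog: "M b \<in> homog (M a) (2 * \<Lambda> a b)"
  by (simp add: homog_def M_quasi_comm)

lemma M_add: "M (a + b) = hp (- \<Lambda> a b) \<odot> (M a \<otimes> M b)"
  by (simp add: M_mult)

lemma M_inv: "inv (M a) = M (- a)"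
proof (rule inv_unique'[symmetric])
  show "M a \<otimes> M (- a) = \<one>" "M (- a) \<otimes> M a = \<one>"
    by (simp_all add: M_mult lf_uminus)
qed simp_all

text \<open>Compatibility as a statement on the form: pairing with column \<open>i\<close> of
  \<open>B\<close> extracts the coordinate at \<open>i\<close>. Conjugation by
  \<open>M (bv i)\<close> therefore grades by the exponent of \<open>x i\<close>.\<close>

lemma \<Lambda>_bv:
  assumes "i \<in> mut"
  shows "\<Lambda> (bv i) a = d * a i" "\<Lambda> a (bv i) = - (d * a i)"
proof -
  have i: "i < r" by (rule mut_less[OF assms])
  have "\<Lambda> (bv i) a = (\<Sum>j<r. \<Sum>k<r. B k i * a j * L k j)"
    unfolding lf_def by (subst sum.swap) simp
  also have "\<dots> = (\<Sum>j<r. a j * (\<Sum>k<r. B k i * L k j))"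
    by (simp add: sum_distrib_left ac_simps)
  also have "\<dots> = (\<Sum>j<r. if j = i then a j * d else 0)"
    using compat[OF assms] by (intro sum.cong) auto
  also have "\<dots> = d * a i" using i by simp
  finally show "\<Lambda> (bv i) a = d * a i" .
  then show "\<Lambda> a (bv i) = - (d * a i)" using \<Lambda>_skew[of a "bv i"] by simp
qed

lemma B_diag: "i < r \<Longrightarrow> B i i = 0"
  using B_skew[of i i] by simp

end

subsection \<open>Mutation of seeds\<close>

lemma lf_sum:
  "lf r L (\<lambda>s. \<Sum>i\<in>A. f i s) b = (\<Sum>i\<in>A. lf r L (f i) b)"
  "lf r L a (\<lambda>s. \<Sum>i\<in>A. f i s) = (\<Sum>i\<in>A. lf r L a (f i))"
proof -
  have "lf r L (\<lambda>s. \<Sum>i\<in>A. f i s) b = (\<Sum>s<r. \<Sum>i\<in>A. \<Sum>t<r. f i s * b t * L s t)"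
    unfolding lf_def sum_distrib_right by (intro sum.cong refl sum.swap)
  then show "lf r L (\<lambda>s. \<Sum>i\<in>A. f i s) b = (\<Sum>i\<in>A. lf r L (f i) b)"
    unfolding lf_def by (subst (asm) sum.swap)
  have "lf r L a (\<lambda>s. \<Sum>i\<in>A. f i s) = (\<Sum>s<r. \<Sum>i\<in>A. \<Sum>t<r. a s * f i t * L s t)"
    unfolding lf_def sum_distrib_right sum_distrib_left by (intro sum.cong refl sum.swap)
  then show "lf r L a (\<lambda>s. \<Sum>i\<in>A. f i s) = (\<Sum>i\<in>A. lf r L a (f i))"
    unfolding lf_def by (subst (asm) sum.swap)
qed

lemma lf_uvec:
  assumes "i < r" "j < r"
  shows "lf r L (uvec i) (uvec j) = L i j"
proof -
  have "lf r L (uvec i) (uvec j) = (\<Sum>s<r. \<Sum>t<r. if s = i then if t = j then L s t else 0 else 0)"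
    unfolding lf_def by (intro sum.cong refl) (simp add: uvec_def)
  also have "\<dots> = (\<Sum>s<r. if s = i then L s j else 0)"
    using assms by (intro sum.cong refl) simp
  also have "\<dots> = L i j" using assms by simp
  finally show ?thesis .
qed

lemma sum_uvec: "j < r \<Longrightarrow> (\<Sum>i<r. f i * uvec j i) = (f j :: int)"
  by (simp add: uvec_def if_distrib cong: if_cong)

lemma b_plus_minus: "b_plus B k = b_minus B k + (\<lambda>j. B j k)"
  by (auto simp: b_plus_def b_minus_def)

context preseed
begin

lemma bp_eq: "b_plus B k = b_minus B k + bv k"
  unfolding b_plus_minus bv_def ..

lemma b_self: "k \<in> mut \<Longrightarrow> b_plus B k k = -1" "k \<in> mut \<Longrightarrow> b_minus B k k = -1"
  using B_diag[OF mut_less] by (simp_all add: b_plus_def b_minus_def)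

lemma b_nonneg: "i \<noteq> k \<Longrightarrow> b_plus B k i \<ge> 0" "i \<noteq> k \<Longrightarrow> b_minus B k i \<ge> 0"
  by (simp_all add: b_plus_def b_minus_def)

definition xmut :: "nat \<Rightarrow> 'a" where
  "xmut i = M (b_plus B i) \<oplus> M (b_minus B i)"

lemma xmut_carrier [simp]: "xmut i \<in> carrier F"
  by (simp add: xmut_def)

text \<open>The two exchange vectors differ by \<open>bv i\<close>, which a vector without
  \<open>x i\<close> does not see. Hence such a monomial quasi-commutes with the whole of
  \<open>xmut i\<close>.\<close>

lemma \<Lambda>_bp: "i \<in> mut \<Longrightarrow> a i = 0 \<Longrightarrow> \<Lambda> a (b_plus B i) = \<Lambda> a (b_minus B i)"
  by (simp add: bp_eq lf_add \<Lambda>_bv)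

lemma xmut_quasi_comm: "i \<in> mut \<Longrightarrow> a i = 0 \<Longrightarrow> quasi_comm (2 * \<Lambda> a (b_minus B i)) (M a) (xmut i)"
  unfolding xmut_def using M_quasi_comm[of a "b_plus B i"] M_quasi_comm[of a "b_minus B i"]
  by (intro quasi_comm_add) (simp_all add: \<Lambda>_bp)

text \<open>Under conjugation by \<open>x i\<close> the degrees of the two monomials differ by
  \<open>2 * d\<close>, so they cannot cancel.\<close>

lemma xmut_nonzero:
  assumes i: "i \<in> mut"
  shows "xmut i \<noteq> \<zero>"
proof
  assume zero: "xmut i = \<zero>"
  define m where "m = (\<lambda>b. 2 * \<Lambda> (uvec i) b)"
  have ne: "m (b_plus B i) \<noteq> m (b_minus B i)"
    using d_pos \<Lambda>_bv(2)[OF i, of "uvec i"] by (simp add: m_def bp_eq lf_add)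
  define f where "f = (\<lambda>n. if n = m (b_plus B i) then M (b_plus B i) else M (b_minus B i))"
  have "(\<Oplus>n\<in>{m (b_plus B i), m (b_minus B i)}. f n) = \<zero>"
    using zero ne by (simp add: f_def xmut_def)
  then have "f (m (b_plus B i)) = \<zero>"
    by (rule homog_sum_zero[OF M_Units[of "uvec i"], rotated 2])
      (use M_homog[of _ "uvec i"] in \<open>auto simp: f_def m_def\<close>)
  then show False by (simp add: f_def)
qed

lemma xmut_Units: "i \<in> mut \<Longrightarrow> xmut i \<in> Units F"
  by (simp add: Units_iff xmut_nonzero)

text \<open>\<open>U\<close> is the upper cluster algebra of the seed; on account of the exchange relation, \<open>V i\<close>
  consists of the Laurent polynomials in the cluster that remain Laurent polynomials in the cluster
  mutated at \<open>i\<close>. That \<open>U\<close> is the same for all seeds is the Laurent phenomenon; one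
  inclusion suffices here.\<close>

definition T :: "'a set" where
  "T = lspan (range M)"

definition V :: "nat \<Rightarrow> 'a set" where
  "V i = Kgen ({M a |a. a i \<ge> 0} \<union> {xmut i})"

definition U :: "'a set" where
  "U = carrier F \<inter> (\<Inter>i\<in>mut. V i)"

lemma M_in_T: "M a \<in> T"
  unfolding T_def by (intro lspan_base) auto

lemma subalg_T: "subalg T"
  unfolding T_def
proof (rule subalgI)
  show sub: "subsp (lspan (range M))" by (intro subsp_lspan) auto
  show "\<one> \<in> lspan (range M)" using M_in_T[of 0] by (simp add: T_def)
  have "s \<otimes> s' \<in> lspan (range M)" if s: "s \<in> range M" "s' \<in> range M" for s s'
  proof -
    obtain a b where "s = M a" "s' = M b" using s by blast
    then show ?thesis
      using M_in_T[of "a + b"] by (simp only: M_mult T_def subsp_sm[OF sub])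
  qed
  note step = this
  have rM: "range M \<subseteq> carrier F" by auto
  show "f \<otimes> g \<in> lspan (range M)" if "f \<in> lspan (range M)" "g \<in> lspan (range M)" for f g
    by (rule lspan_mult[OF rM rM sub step that])
qed

lemma subalg_V: "subalg (V i)"
  unfolding V_def by (intro subalg_Kgen) auto

lemma M_in_V: "a i \<ge> 0 \<Longrightarrow> M a \<in> V i"
  unfolding V_def by (intro subsetD[OF Kgen_incl]) auto

lemma xmut_in_V: "xmut i \<in> V i"
  unfolding V_def by (intro subsetD[OF Kgen_incl]) auto

lemma xmut_in_V_other: "i \<noteq> k \<Longrightarrow> xmut k \<in> V i"
  unfolding xmut_def by (intro subsp_add[OF subalg_subsp[OF subalg_V]] M_in_V b_nonneg)

lemma V_subset_T: "V i \<subseteq> T"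
proof -
  have "xmut i \<in> T" unfolding xmut_def by (intro subsp_add[OF subalg_subsp[OF subalg_T]] M_in_T)
  then show ?thesis unfolding V_def by (intro Kgen_minimal subalg_T) (auto simp: M_in_T)
qed

lemma M_pow: "M (sc (int n) a) = M a [^] n"
proof (induction n)
  case (Suc n)
  have "M a [^] n \<otimes> M a = M (sc (int n) a + a)"
    unfolding Suc[symmetric] M_mult by (simp add: lf_sc)
  also have "sc (int n) a + a = sc (int (Suc n)) a" by (auto simp: algebra_simps)
  finally show ?case by simp
qed (simp add: M_zero)

end

locale mutation = preseed +
  fixes k assumes k: "k \<in> mut"
begin

abbreviation "bp \<equiv> b_plus B k"
abbreviation "bm \<equiv> b_minus B k"
abbreviation "x' \<equiv> mut_X F r k x B L"
abbreviation "B' \<equiv> mut_B r mut k B"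
abbreviation "L' \<equiv> mut_L r k B L"

text \<open>\<open>E b\<close> is the linear involution on exponent vectors sending \<open>uvec k\<close> to \<open>b\<close>; for \<open>b = bm\<close> it is
  the matrix \<open>mut_E\<close>, and \<open>b = bp\<close> gives the same mutated form \<open>L'\<close>.\<close>

definition E :: "(nat \<Rightarrow> int) \<Rightarrow> (nat \<Rightarrow> int) \<Rightarrow> nat \<Rightarrow> int" where
  "E b a = a + sc (a k) (b - uvec k)"

lemma k_less: "k < r" by (rule mut_less[OF k])

lemma x'_k: "x' k = xmut k"
  by (simp add: mut_X_def xmut_def M_def)

lemma x'_other: "j \<noteq> k \<Longrightarrow> x' j = x j"
  by (simp add: mut_X_def)

lemma mut_E_column: "(\<lambda>s. mut_E B k s i) = (if i = k then bm else uvec i)"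
  using B_diag[OF k_less] by (auto simp: mut_E_def b_minus_def uvec_def)

lemma L'_eq: "L' i j = \<Lambda> (if i = k then bm else uvec i) (if j = k then bm else uvec j)"
  unfolding mut_E_column[symmetric] mut_L_def lf_def by (simp add: ac_simps)

lemma E_bm_eq:
  assumes "s < r"
  shows "(\<Sum>i<r. a i * (if i = k then bm else uvec i) s) = E bm a s"
proof -
  have "(\<Sum>i<r. a i * (if i = k then bm else uvec i) s) =
      (\<Sum>i<r. a i * uvec s i + (a k * (bm s - uvec k s)) * uvec k i)"
    by (intro sum.cong refl) (auto simp: uvec_def algebra_simps)
  also have "\<dots> = a s + a k * (bm s - uvec k s)"
    using assms k_less by (simp only: sum.distrib sum_uvec)
  finally show ?thesis by (simp add: E_def)
qed

lemma E_k: "b k = -1 \<Longrightarrow> E b a k = - a k"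
  by (simp add: E_def)

lemma E_uvec: "E b (uvec k) = b"
  by (auto simp: E_def)

lemma E_E: "b k = -1 \<Longrightarrow> E b (E b a) = a"
  by (auto simp: E_def algebra_simps)

lemma lf_L'_bm: "lf r L' a b = \<Lambda> (E bm a) (E bm b)"
proof -
  define e where "e = (\<lambda>i. if i = k then bm else uvec i)"
  have "lf r L' a b = (\<Sum>i<r. \<Sum>j<r. a i * b j * \<Lambda> (e i) (e j))"
    by (simp add: lf_def[of r L'] L'_eq e_def)
  also have "\<dots> = \<Lambda> (\<lambda>s. \<Sum>i<r. sc (a i) (e i) s) (\<lambda>s. \<Sum>j<r. sc (b j) (e j) s)"
    by (simp add: lf_sum lf_sc sum_distrib_left ac_simps del: sc_apply)
  also have "\<dots> = \<Lambda> (E bm a) (E bm b)"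
    by (intro lf_cong) (simp_all add: e_def E_bm_eq)
  finally show ?thesis .
qed

text \<open>The two substitutions differ by a multiple of \<open>bv k\<close>. By compatibility each
  correction term only sees a coordinate at \<open>k\<close>, and the two have opposite signs.
  Either exchange vector may thus be used to compute with \<open>L'\<close>.\<close>

lemma lf_L': "b1 \<in> {bp, bm} \<Longrightarrow> lf r L' a b = \<Lambda> (E b1 a) (E b1 b)"
proof -
  have E: "E bp c = E bm c + sc (c k) (bv k)" for c
    by (auto simp: E_def bp_eq algebra_simps)
  have "\<Lambda> (E bp a) (E bp b) = \<Lambda> (E bm a) (E bm b)"
    unfolding E lf_add lf_sc \<Lambda>_bv[OF k] using E_k[of bm] b_self(2)[OF k] B_diag[OF k_less] by simp
  then show "b1 \<in> {bp, bm} \<Longrightarrow> lf r L' a b = \<Lambda> (E b1 a) (E b1 b)"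
    using lf_L'_bm[of a b] by auto
qed

lemma sum_mut_E:
  assumes "j < r"
  shows "(\<Sum>s<r. mut_E B k j s * w s) = (if j = k then 0 else w j) + mut_E B k j k * w k"
proof -
  have "(\<Sum>s<r. mut_E B k j s * w s) = (\<Sum>s<r. (if j = k then 0 else w s) * uvec j s + (mut_E B k j k * w s) * uvec k s)"
    by (intro sum.cong refl) (auto simp: mut_E_def uvec_def)
  also have "\<dots> = (if j = k then 0 else w j) + mut_E B k j k * w k"
    using assms k_less by (simp only: sum.distrib sum_uvec)
  finally show ?thesis .
qed

text \<open>Matrix mutation in its entrywise form: \<open>mut_E\<close> differs from the identity
  only in column \<open>k\<close>, and \<open>B k k = 0\<close>. For mutable \<open>i\<close> the
  entry is not among those reset to zero.\<close>

lemma B'_eq: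
  assumes "i \<in> mut" "j < r"
  shows "B' j i = (if i = k \<or> j = k then - B j i else B j i + mut_E B k i k * B j k + mut_E B k j k * B k i)"
proof -
  have i: "i < r" by (rule mut_less[OF assms(1)])
  have "B' j i = (\<Sum>s<r. mut_E B k j s * (\<Sum>t<r. mut_E B k i t * B s t))"
    using assms by (simp add: mut_B_def sum_distrib_left ac_simps)
  also have "\<dots> = (if j = k then 0 else \<Sum>t<r. mut_E B k i t * B j t) + mut_E B k j k * (\<Sum>t<r. mut_E B k i t * B k t)"
    by (rule sum_mut_E[OF assms(2)])
  also have "\<dots> = (if i = k \<or> j = k then - B j i else B j i + mut_E B k i k * B j k + mut_E B k j k * B k i)"
    unfolding sum_mut_E[OF i] using B_diag[OF k_less] by (simp add: mut_E_def)
  finally show ?thesis .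
qed

lemma B'_k: "j < r \<Longrightarrow> B' j k = - B j k"
  using B'_eq[OF k] by simp

text \<open>The exchange vector \<open>b1\<close> without \<open>x\<^sub>i\<close>; the other one \<open>b2\<close> may contain \<open>x\<^sub>i\<close>.\<close>

definition split_at :: "nat \<Rightarrow> (nat \<Rightarrow> int) \<Rightarrow> (nat \<Rightarrow> int) \<Rightarrow> bool" where
  "split_at i b1 b2 \<longleftrightarrow> (B i k \<le> 0 \<and> b1 = bp \<and> b2 = bm) \<or> (B i k \<ge> 0 \<and> b1 = bm \<and> b2 = bp)"

lemma split_at_ex: "\<exists>b1 b2. split_at i b1 b2"
  by (cases "B i k \<le> 0") (auto simp: split_at_def)

lemma split_at:
  assumes "split_at i b1 b2"
  shows "b1 \<in> {bp, bm}" "b1 k = -1" "xmut k = M b1 \<oplus> M b2" "i \<noteq> k \<Longrightarrow> b1 i = 0"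
    "i \<noteq> k \<Longrightarrow> b2 i = \<bar>B i k\<bar>" "b2 - b1 = bv k \<or> b2 - b1 = - bv k"
proof -
  from assms consider "B i k \<le> 0" "b1 = bp" "b2 = bm" | "B i k \<ge> 0" "b1 = bm" "b2 = bp"
    unfolding split_at_def by blast
  then have "b1 \<in> {bp, bm} \<and> b1 k = -1 \<and> xmut k = M b1 \<oplus> M b2 \<and> (i \<noteq> k \<longrightarrow> b1 i = 0) \<and>
    (i \<noteq> k \<longrightarrow> b2 i = \<bar>B i k\<bar>) \<and> (b2 - b1 = bv k \<or> b2 - b1 = - bv k)"
  proof cases
    case 1
    then show ?thesis
      using b_self[OF k] by (simp add: xmut_def bp_eq) (simp add: b_minus_def bv_def)
  next
    case 2
    have "xmut k = M bm \<oplus> M bp" by (simp add: xmut_def a_comm)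
    with 2 show ?thesis
      using b_self[OF k] by (simp add: bp_eq) (simp add: b_minus_def bv_def)
  qed
  then show "b1 \<in> {bp, bm}" "b1 k = -1" "xmut k = M b1 \<oplus> M b2" "i \<noteq> k \<Longrightarrow> b1 i = 0"
    "i \<noteq> k \<Longrightarrow> b2 i = \<bar>B i k\<bar>" "b2 - b1 = bv k \<or> b2 - b1 = - bv k"
    by simp_all
qed

text \<open>With the exchange vector chosen by the sign of \<open>B i k\<close>, the piecewise
  linear mutation of column \<open>i\<close> becomes a linear substitution, and one that is its own
  inverse.\<close>

lemma B'_column:
  assumes "i \<in> mut" "i \<noteq> k" "split_at i b1 b2" "j < r"
  shows "B' j i = E b1 (bv i) j"
proof -
  have i: "i < r" by (rule mut_less[OF assms(1)])
  have ki: "B k i = - B i k" by (rule B_skew[OF k_less i])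
  show ?thesis
  proof (cases "j = k")
    case True
    then show ?thesis
      using assms(2,3) B'_eq[OF assms(1,4)] b_self[OF k] by (auto simp: split_at_def E_def)
  next
    case False
    then have B': "B' j i = B j i + max 0 (- B i k) * B j k + max 0 (- B j k) * (- B i k)"
      using assms(2) B'_eq[OF assms(1,4)] ki by (simp add: mut_E_def)
    have E: "E b1 (bv i) j = B j i - B i k * b1 j"
      using False ki by (simp add: E_def)
    have max: "max 0 (B j k) = B j k + max 0 (- B j k)" by simp
    consider "B i k \<le> 0" "b1 j = max 0 (B j k)" | "B i k \<ge> 0" "b1 j = max 0 (- B j k)"
      using assms(3) False by (auto simp: split_at_def b_plus_def b_minus_def)
    then show ?thesis
    proof cases
      case 1
      then have "max 0 (- B i k) = - B i k" by simp
      then show ?thesis unfolding B' E 1(2) max by (simp only:) (simp add: distrib_left)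
    next
      case 2
      then have "max 0 (- B i k) = 0" by simp
      then show ?thesis unfolding B' E 2(2) by (simp only:) simp
    qed
  qed
qed

lemma preseed_mutated: "preseed F r mut x' B' L' d"
proof unfold_locales
  fix i j
  show "x' i \<in> Units F" if "i < r"
    using that x_Units xmut_Units[OF k] by (cases "i = k") (simp_all add: x'_k x'_other)
  have quasi_comm: "quasi_comm (2 * L' k j) (x' k) (x' j)" if "j < r" "j \<noteq> k" for j
  proof -
    have "quasi_comm (2 * \<Lambda> (uvec j) bm) (x j) (xmut k)"
      using xmut_quasi_comm[OF k, of "uvec j"] that by (simp add: M_uvec)
    from quasi_comm_sym[OF this] show ?thesis
      using that \<Lambda>_skew[of bm "uvec j"] x_Units by (simp add: x'_k x'_other L'_eq)
  qed
  have skew: "L' i j = - L' j i" for i j unfolding L'_eq by (rule \<Lambda>_skew)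
  then show "L' i j = - L' j i" .
  show "x' i \<otimes> x' j = qpow (L' i j) \<odot> (x' j \<otimes> x' i)" if "i < r" "j < r"
  proof -
    have "quasi_comm (2 * L' i j) (x' i) (x' j)"
    proof (cases "i = k \<or> j = k")
      case False
      then show ?thesis using that x_quasi_comm by (simp add: x'_other L'_eq lf_uvec)
    next
      case True
      then consider "i = k" "j = k" | "i = k" "j \<noteq> k" | "j = k" "i \<noteq> k" by blast
      then show ?thesis
      proof cases
        case 1
        then show ?thesis by (simp add: L'_eq quasi_comm_def x'_k)
      next
        case 2
        then show ?thesis using quasi_comm that by simp
      next
        case 3
        have "quasi_comm (- (2 * L' k i)) (x' i) (x' k)"
          by (rule quasi_comm_sym[OF quasi_comm[OF that(1) 3(2)]])
            (use that 3(2) x_Units in \<open>simp_all add: x'_k x'_other\<close>)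
        then show ?thesis unfolding 3(1) skew[of i k] by simp
      qed
    qed
    then show ?thesis by (simp add: quasi_comm_def qpow_def)
  qed
  show "B' i j = - B' j i" if "i < r" "j < r"
  proof (cases "i \<in> mut \<or> j \<in> mut")
    case True
    have "(\<Sum>s<r. \<Sum>t<r. mut_E B k i s * B s t * mut_E B k j t) =
        (\<Sum>t<r. \<Sum>s<r. mut_E B k i s * B s t * mut_E B k j t)" by (rule sum.swap)
    also have "\<dots> = (\<Sum>t<r. \<Sum>s<r. - (mut_E B k j t * B t s * mut_E B k i s))"
    proof (intro sum.cong refl)
      fix s t assume "t \<in> {..<r}" "s \<in> {..<r}"
      then have "B s t = - B t s" by (intro B_skew) simp_all
      then show "mut_E B k i s * B s t * mut_E B k j t = - (mut_E B k j t * B t s * mut_E B k i s)"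
        by simp
    qed
    finally show ?thesis using True by (auto simp: mut_B_def sum_negf)
  qed (simp add: mut_B_def)
  show "i < r" if "i \<in> mut" by (rule mut_less[OF that])
  show "d > 0" by (rule d_pos)
  show "(\<Sum>l<r. B' l i * L' l j) = (if i = j then d else 0)" if "i \<in> mut" "j < r"
  proof -
    have i: "i < r" by (rule mut_less[OF that(1)])
    obtain b1 b2 where b: "split_at i b1 b2" using split_at_ex by blast
    \<comment> \<open>The substitution carries column \<open>i\<close> of \<open>B'\<close> back to
      that of \<open>B\<close>, negated for \<open>i = k\<close>; compatibility is then inherited
      from the old form.\<close>
    have E_bv: "E b1 (\<lambda>l. if l < r then B' l i else 0) l = (if i = k then - bv k else bv i) l" if "l < r" for l
    proof (cases "i = k")
      case True
      then show ?thesis using that k_less B'_k B_diag[OF k_less] by (simp add: E_def)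
    next
      case False
      have "E b1 (\<lambda>l. if l < r then B' l i else 0) l = E b1 (E b1 (bv i)) l"
        using B'_column[OF \<open>i \<in> mut\<close> False b] that k_less by (simp add: E_def)
      then show ?thesis using False E_E[of b1, OF split_at(2)[OF b]] by simp
    qed
    have "(\<Sum>l<r. B' l i * L' l j) = (\<Sum>l<r. \<Sum>m<r. (if l < r then B' l i else 0) * uvec j m * L' l m)"
    proof (intro sum.cong refl)
      fix l assume "l \<in> {..<r}"
      then have "(\<Sum>m<r. (if l < r then B' l i else 0) * uvec j m * L' l m) =
          (\<Sum>m<r. if m = j then B' l i * L' l m else 0)"
        by (intro sum.cong refl) (simp add: uvec_def)
      then show "B' l i * L' l j = (\<Sum>m<r. (if l < r then B' l i else 0) * uvec j m * L' l m)"
        using that(2) by simp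
    qed
    also have "\<dots> = lf r L' (\<lambda>l. if l < r then B' l i else 0) (uvec j)"
      by (simp add: lf_def)
    also have "\<dots> = \<Lambda> (E b1 (\<lambda>l. if l < r then B' l i else 0)) (E b1 (uvec j))"
      by (rule lf_L'[OF split_at(1)[OF b]])
    also have "\<dots> = \<Lambda> (if i = k then - bv k else bv i) (E b1 (uvec j))"
      by (intro lf_cong E_bv) simp_all
    \<comment> \<open>For \<open>i \<noteq> k\<close> and \<open>j = k\<close> the value is
      \<open>d * b1 i\<close>, which vanishes because \<open>b1\<close> was chosen without
      \<open>x i\<close>.\<close>
    also have "\<dots> = (if i = j then d else 0)"
      using split_at(2,4)[OF b] that(1) k
      by (auto simp: lf_uminus \<Lambda>_bv E_k E_def uvec_def)
    finally show ?thesis .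
  qed
qed

end

subsection \<open>The quantum Laurent phenomenon\<close>

sublocale mutation \<subseteq> N: preseed F r mut "mut_X F r k x B L" "mut_B r mut k B" "mut_L r k B L" d
  by (rule preseed_mutated)

context mutation
begin

text \<open>Away from \<open>k\<close> neither the variables nor the entries of the form
  change.\<close>

lemma NM_eq:
  assumes "a k = 0"
  shows "N.M a = M a"
proof -
  have "ordered_monomial F r x' a = ordered_monomial F r x a"
    unfolding ordered_monomial_def
  proof (intro foldr_cong refl ext)
    fix i z
    show "x' i [^] a i \<otimes> z = x i [^] a i \<otimes> z"
      using assms by (cases "i = k") (simp_all add: x'_other)
  qed
  moreover have "(\<Sum>j<r. \<Sum>i<j. a i * a j * L' j i) = (\<Sum>j<r. \<Sum>i<j. a i * a j * L j i)"
  proof (intro sum.cong refl)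
    fix i j assume "j \<in> {..<r}" "i \<in> {..<j}"
    then show "a i * a j * L' j i = a i * a j * L j i"
      using assms by (cases "i = k \<or> j = k") (auto simp: L'_eq lf_uvec)
  qed
  ultimately show ?thesis
    by (simp add: N.M_def M_def normalised_monomial_def)
qed

lemma NM_uvec: "N.M (uvec k) = xmut k"
  using N.M_uvec[OF k_less] by (simp add: x'_k)

lemma NM_split: "a k = int n \<Longrightarrow> \<exists>e. N.M a = hp e \<odot> (M (a - sc (a k) (uvec k)) \<otimes> xmut k [^] n)"
proof -
  assume a: "a k = int n"
  have "(a - sc (a k) (uvec k)) + sc (int n) (uvec k) = a"
    using a by (auto simp: fun_eq_iff)
  then have "N.M a = hp (- lf r L' (a - sc (a k) (uvec k)) (sc (int n) (uvec k))) \<odot>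
      (N.M (a - sc (a k) (uvec k)) \<otimes> N.M (sc (int n) (uvec k)))"
    using N.M_add[of "a - sc (a k) (uvec k)" "sc (int n) (uvec k)"] by simp
  moreover have "N.M (a - sc (a k) (uvec k)) = M (a - sc (a k) (uvec k))"
    by (rule NM_eq) simp
  ultimately show ?thesis unfolding N.M_pow NM_uvec by metis
qed

text \<open>With a nonnegative exponent at \<open>k\<close>, the new variable enters as an honest
  power of \<open>xmut k\<close>, an element of \<open>V i\<close> for every
  \<open>i\<close>.\<close>

lemma NM_in_V:
  assumes "a i \<ge> 0" "a k \<ge> 0"
  shows "N.M a \<in> V i"
proof -
  obtain n where n: "a k = int n" using assms(2) nonneg_int_cases by blast
  have "xmut k \<in> V i" by (cases "i = k") (simp_all add: xmut_in_V xmut_in_V_other)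
  moreover have "(a - sc (a k) (uvec k)) i \<ge> 0"
    using assms(1) by (cases "i = k") simp_all
  ultimately have "M (a - sc (a k) (uvec k)) \<otimes> xmut k [^] n \<in> V i"
    by (intro subalg_mult[OF subalg_V] subalg_pow[OF subalg_V] M_in_V)
  then show ?thesis
    using NM_split[of a n] n subsp_sm[OF subalg_subsp[OF subalg_V]] by auto
qed

text \<open>Mutating twice restores \<open>x k\<close>. The substitution \<open>E b\<close>
  exchanges \<open>uvec k\<close> and \<open>b\<close>, which makes the exponents match after
  multiplication by \<open>xmut k\<close>; this factor is then cancelled.\<close>

lemma Nxmut_k: "N.xmut k = M (uvec k)"
proof -
  have prod: "xmut k \<otimes> N.M b = M b \<otimes> M (uvec k)" if b: "b \<in> {bp, bm}" for b
  proof -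
    have bk: "b k = -1" using b b_self[OF k] by auto
    have "N.M (uvec k) \<otimes> N.M b = hp (lf r L' (uvec k) b) \<odot> N.M (uvec k + b)"
      by (rule N.M_mult)
    also have "N.M (uvec k + b) = M (uvec k + b)"
      by (rule NM_eq) (simp add: bk)
    also have "lf r L' (uvec k) b = \<Lambda> b (uvec k)"
      using lf_L'[OF b] E_E[of b "uvec k"] bk by (simp add: E_uvec)
    finally show ?thesis unfolding NM_uvec M_mult add.commute[of b "uvec k"] .
  qed
  have "N.xmut k = N.M bm \<oplus> N.M bp"
  proof -
    have "N.M (b_plus B' k) = N.M bm" "N.M (b_minus B' k) = N.M bp"
      by (rule N.M_cong, simp add: B'_k b_plus_def b_minus_def)+
    then show ?thesis by (simp add: N.xmut_def)
  qed
  then have "xmut k \<otimes> N.xmut k = xmut k \<otimes> M (uvec k)"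
    using prod[of bm] prod[of bp] by (simp add: r_distr xmut_def[of k] l_distr a_comm)
  then show ?thesis
    by (rule left_cancel[rotated -1]) (simp_all add: xmut_nonzero[OF k])
qed

text \<open>In direction \<open>k\<close> the two seeds merely trade the old variable for the new
  one.\<close>

lemma NV_k: "N.V k \<subseteq> V k"
  unfolding N.V_def
  using NM_in_V[of _ k] M_in_V[of "uvec k" k] by (intro Kgen_minimal subalg_V) (auto simp: Nxmut_k)

text \<open>Each factor \<open>xmut k\<close> is \<open>M b1 \<oplus> M b2\<close>, where only
  \<open>M b2\<close> contains \<open>x i\<close>. The part of lowest degree in \<open>x i\<close>
  therefore comes from taking \<open>M b1\<close> every time. For \<open>n > 0\<close> the condition
  \<open>B i k \<noteq> 0\<close> guarantees that \<open>M b2\<close> does raise the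
  exponent.\<close>

lemma NM_expand:
  assumes i: "i \<noteq> k" and b: "split_at i b1 b2" and c: "c k = 0" and n: "n = 0 \<or> B i k \<noteq> 0"
  shows "\<exists>z \<in> lspan {M a |a. a i \<ge> c i + 1}. N.M (c + sc (int n) (uvec k)) = M (c + sc (int n) b1) \<oplus> z"
  using n
proof (induction n)
  case 0
  have "N.M c = M c" by (rule NM_eq[of c, OF c])
  then show ?case by (intro bexI[of _ \<zero>] lspan.zero) simp
next
  case (Suc n)
  define Z where "Z = lspan {M a |a. a i \<ge> c i + 1}"
  define P where "P = c + sc (int n) (uvec k)"
  define Q where "Q = c + sc (int n) b1"
  have gens: "{M a |a. a i \<ge> c i + 1} \<subseteq> carrier F" by auto
  have Z: "subsp Z" unfolding Z_def by (rule subsp_lspan[OF gens])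
  have M_Z: "M a \<in> Z" if "a i \<ge> c i + 1" for a
    unfolding Z_def using that by (intro lspan_base[OF gens]) auto
  have Z_M: "z \<otimes> M b \<in> Z" if z: "z \<in> Z" and b: "b i \<ge> 0" for z b
  proof -
    have "Z \<subseteq> {f \<in> carrier F. f \<otimes> M b \<in> Z}"
      unfolding Z_def
    proof (rule lspan_minimal)
      show "subsp {f \<in> carrier F. f \<otimes> M b \<in> lspan {M a |a. a i \<ge> c i + 1}}"
        using Z unfolding Z_def by (rule subsp_preimage_right) simp
      show "{M a |a. a i \<ge> c i + 1} \<subseteq> {f \<in> carrier F. f \<otimes> M b \<in> lspan {M a |a. a i \<ge> c i + 1}}"
      proof safe
        fix a assume a: "a i \<ge> c i + 1"
        have "hp (\<Lambda> a b) \<odot> M (a + b) \<in> Z"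
          using a b by (intro subsp_sm[OF Z] M_Z) simp
        then show "M a \<otimes> M b \<in> lspan {M a |a. a i \<ge> c i + 1}"
          unfolding M_mult Z_def .
      qed simp
    qed
    then show ?thesis using z by auto
  qed
  have Bik: "B i k \<noteq> 0" using Suc.prems by simp
  obtain z where z: "z \<in> Z" "N.M P = M Q \<oplus> z"
    using Suc.IH Bik unfolding Z_def P_def Q_def by blast
  have zc: "z \<in> carrier F" using z(1) Z subsp_carrier by blast
  have b1k: "b1 k = -1" by (rule split_at(2)[OF b])
  have EP: "E b1 P = Q"
    using c by (auto simp: E_def P_def Q_def fun_eq_iff algebra_simps)
  have e: "lf r L' P (uvec k) = \<Lambda> Q b1"
    unfolding lf_L'[OF split_at(1)[OF b]] EP E_uvec ..
  have S: "c + sc (int (Suc n)) v = (c + sc (int n) v) + v" for v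
    by (auto simp: fun_eq_iff algebra_simps)
  have b1i: "b1 i = 0" and b2i: "b2 i \<ge> 1"
    using split_at(4,5)[OF b] i Suc.prems by simp_all
  define w where "w = M Q \<otimes> M b2 \<oplus> (z \<otimes> M b1 \<oplus> z \<otimes> M b2)"
  have w: "w \<in> Z"
    unfolding w_def
  proof (rule subsp_add[OF Z _ subsp_add[OF Z]])
    show "M Q \<otimes> M b2 \<in> Z"
      unfolding M_mult by (rule subsp_sm[OF Z M_Z]) (use b1i b2i in \<open>simp add: Q_def\<close>)
    show "z \<otimes> M b1 \<in> Z" "z \<otimes> M b2 \<in> Z"
      using b1i b2i by (simp_all add: Z_M[OF z(1)])
  qed
  have "N.M P \<otimes> xmut k = M Q \<otimes> M b1 \<oplus> w"
    unfolding z(2) split_at(3)[OF b] w_def using zc by (simp add: r_distr l_distr a_ac)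
  then have "N.M (P + uvec k) = hp (- \<Lambda> Q b1) \<odot> (M Q \<otimes> M b1 \<oplus> w)"
    unfolding N.M_add e NM_uvec by simp
  also have "\<dots> = M (Q + b1) \<oplus> hp (- \<Lambda> Q b1) \<odot> w"
    using w Z subsp_carrier by (simp add: sm_add_right M_mult)
  finally have "N.M (P + uvec k) = M (Q + b1) \<oplus> hp (- \<Lambda> Q b1) \<odot> w" .
  then show ?case
    unfolding S P_def[symmetric] Q_def[symmetric] Z_def[symmetric]
    by (intro bexI[of _ "hp (- \<Lambda> Q b1) \<odot> w"] subsp_sm[OF Z] w)
qed

text \<open>Starting from exponent -1 at \<open>i\<close>, all terms but the leading one have
  nonnegative exponent there. This isolates the only part of the next exchange relation that is not
  visibly in \<open>V i\<close>.\<close>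

lemma NM_expand_V:
  assumes i: "i \<noteq> k" and b: "split_at i b1 b2" and c: "c i = -1" "c k \<ge> 0" "c k = 0 \<or> B i k \<noteq> 0"
  shows "\<exists>z \<in> V i. N.M c = M (E b1 c) \<oplus> z"
proof -
  obtain n where n: "c k = int n" using c(2) nonneg_int_cases by blast
  define c0 where "c0 = c - sc (c k) (uvec k)"
  have c0: "c0 k = 0" "c0 i = -1" "n = 0 \<or> B i k \<noteq> 0"
    using c n i by (simp_all add: c0_def)
  have eq: "c0 + sc (int n) (uvec k) = c" "c0 + sc (int n) b1 = E b1 c"
    using n by (auto simp: c0_def E_def fun_eq_iff algebra_simps)
  obtain z where z: "z \<in> lspan {M a |a. a i \<ge> c0 i + 1}" "N.M c = M (E b1 c) \<oplus> z"
    using NM_expand[of i b1 b2 c0 n, OF i b c0(1,3)] unfolding eq by blast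
  have "lspan {M a |a. a i \<ge> c0 i + 1} \<subseteq> V i"
    using c0(2) by (intro lspan_minimal subalg_subsp[OF subalg_V]) (auto intro: M_in_V)
  then show ?thesis using z by blast
qed

text \<open>The leading terms of the two new exchange monomials recombine to a monomial without
  \<open>x i\<close> times the old exchanged variable \<open>xmut i\<close>.\<close>

lemma Nxmut_in_V:
  assumes i: "i \<in> mut" "i \<noteq> k"
  shows "N.xmut i \<in> V i"
proof -
  have ir: "i < r" by (rule mut_less[OF i(1)])
  obtain b1 b2 where b: "split_at i b1 b2" using split_at_ex by blast
  have b1: "b1 k = -1" "b1 i = 0" using split_at(2,4)[OF b] i by simp_all
  define p m where "p = b_plus B' i" and "m = b_minus B' i"
  have Bki: "B' k i = B i k"
    using B'_eq[OF i(1) k_less] B_skew[OF k_less ir] by simp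
  have pm: "p i = -1" "m i = -1" "p k \<ge> 0" "m k \<ge> 0" "p k = 0 \<or> B i k \<noteq> 0" "m k = 0 \<or> B i k \<noteq> 0"
    using N.b_self[OF i(1)] N.b_nonneg[of k i] i(2) Bki
    by (auto simp: p_def m_def b_plus_def b_minus_def)
  obtain z1 where z1: "z1 \<in> V i" "N.M p = M (E b1 p) \<oplus> z1"
    using NM_expand_V[OF i(2) b pm(1,3,5)] by blast
  obtain z2 where z2: "z2 \<in> V i" "N.M m = M (E b1 m) \<oplus> z2"
    using NM_expand_V[OF i(2) b pm(2,4,6)] by blast
  \<comment> \<open>The discrepancy between transformed and old exchange vector. The same
    \<open>w\<close> serves for both vectors, since \<open>E b1\<close> carries their difference,
    column \<open>i\<close> of \<open>B'\<close>, back to column \<open>i\<close> of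
    \<open>B\<close>.\<close>
  define w where "w = E b1 m - b_minus B i"
  have wi: "w i = 0"
    using pm(2) b1 b_self[OF i(1)] i(2) by (simp add: w_def E_def)
  have m: "E b1 m = w + b_minus B i" by (simp add: w_def)
  have p: "M (E b1 p) = M (w + b_plus B i)"
  proof (rule M_cong)
    fix j assume j: "j < r"
    have "E b1 (bv i) k = B' k i" by (rule B'_column[OF i b k_less, symmetric])
    have "E b1 p j = E b1 m j + (B' j i + B' k i * (b1 j - uvec k j))"
      by (simp add: p_def m_def b_plus_minus E_def algebra_simps)
    also have "B' j i + B' k i * (b1 j - uvec k j) = E b1 (E b1 (bv i)) j"
      using B'_column[OF i b j] B'_column[OF i b k_less] by (simp add: E_def)
    also have "\<dots> = B j i" using E_E[of b1 "bv i", OF b1(1)] by simp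
    finally show "E b1 p j = (w + b_plus B i) j"
      by (simp add: m bp_eq)
  qed
  have e: "\<Lambda> w (b_plus B i) = \<Lambda> w (b_minus B i)"
    by (rule \<Lambda>_bp[of i w, OF i(1) wi])
  have "M (E b1 p) \<oplus> M (E b1 m) = hp (- \<Lambda> w (b_minus B i)) \<odot> (M w \<otimes> xmut i)"
    unfolding p m M_add e xmut_def by (simp add: r_distr sm_add_right)
  moreover have "\<dots> \<in> V i"
    using wi by (intro subsp_sm[OF subalg_subsp[OF subalg_V]] subalg_mult[OF subalg_V] M_in_V xmut_in_V) simp
  ultimately have mem: "M (E b1 p) \<oplus> M (E b1 m) \<in> V i" by simp
  have sub: "subsp (V i)" by (rule subalg_subsp[OF subalg_V])
  have zc: "z1 \<in> carrier F" "z2 \<in> carrier F" using z1(1) z2(1) subsp_carrier[OF sub] by blast+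
  have "N.xmut i = (M (E b1 p) \<oplus> z1) \<oplus> (M (E b1 m) \<oplus> z2)"
    unfolding N.xmut_def p_def[symmetric] m_def[symmetric] z1(2) z2(2) ..
  also have "\<dots> = (M (E b1 p) \<oplus> M (E b1 m)) \<oplus> (z1 \<oplus> z2)"
    using zc by (simp add: a_ac)
  also have "\<dots> \<in> V i"
    by (rule subsp_add[OF sub mem subsp_add[OF sub z1(1) z2(1)]])
  finally show ?thesis .
qed

text \<open>Up to a monomial without \<open>x\<^sub>i\<close>, the new variable is \<open>1 + Y\<close> with \<open>Y\<close> of nonzero degree
  with respect to \<open>x\<^sub>k\<close>, by the compatibility of \<open>B\<close> and \<open>L\<close>.\<close>

lemma xmut_k_cancel:
  assumes i: "i \<noteq> k" and f: "f \<in> T" and mem: "xmut k \<otimes> f \<in> V i"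
  shows "f \<in> V i"
proof -
  obtain b1 b2 where b: "split_at i b1 b2" using split_at_ex by blast
  have b1i: "b1 i = 0" and b2i: "b2 i \<ge> 0" using split_at(4,5)[OF b] i by simp_all
  have sub: "subsp (V i)" by (rule subalg_subsp[OF subalg_V])
  have fc: "f \<in> carrier F" using f subalg_carrier[OF subalg_T] by blast
  define Y where "Y = M (- b1) \<otimes> M b2"
  have Y: "Y = hp (\<Lambda> (- b1) b2) \<odot> M (b2 - b1)"
    unfolding Y_def M_mult by (simp add: add.commute)
  have Yc: "Y \<in> carrier F" by (simp add: Y_def)
  have Y_V: "Y \<in> V i"
    unfolding Y using b1i b2i by (intro subsp_sm[OF sub] M_in_V) simp
  have deg: "Y \<in> homog (M (uvec k)) (2 * \<Lambda> (uvec k) (b2 - b1))"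
    unfolding Y by (intro subsp_sm[OF subsp_homog] M_homog) simp
  have ne: "2 * \<Lambda> (uvec k) (b2 - b1) \<noteq> 0"
    using split_at(6)[OF b] d_pos \<Lambda>_bv(2)[OF k, of "uvec k"] by (auto simp: lf_uminus)
  have "M (- b1) \<otimes> xmut k = \<one> \<oplus> Y"
    unfolding split_at(3)[OF b] Y_def by (simp add: r_distr M_mult[of "- b1" b1] lf_uminus)
  then have "(\<one> \<oplus> Y) \<otimes> f = M (- b1) \<otimes> (xmut k \<otimes> f)"
    using fc by (simp flip: m_assoc)
  also have "\<dots> \<in> V i"
    by (rule subalg_mult[OF subalg_V M_in_V mem]) (simp add: b1i)
  finally have prod: "(\<one> \<oplus> Y) \<otimes> f \<in> V i" .
  \<comment> \<open>For \<open>i \<noteq> k\<close> both \<open>x k\<close> and its inverse are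
    among the generators of \<open>V i\<close>.\<close>
  have conj: "conj_stable (M (uvec k)) (V i)"
    unfolding conj_stable_def M_inv using i
    by (intro ballI subalg_mult[OF subalg_V] M_in_V) (simp_all add: uvec_def)
  obtain S fam where dec: "decomposes (M (uvec k)) S fam f"
    using lspan_decomposes[OF M_Units, of "range M" UNIV "uvec k" f] f M_homog unfolding T_def by blast
  show ?thesis
    by (rule one_plus_cancel[OF M_Units sub conj deg ne subalg_mult[OF subalg_V Y_V] dec prod])
qed

lemma xmut_pow_cancel:
  assumes "i \<noteq> k" "f \<in> T" "xmut k [^] (n::nat) \<otimes> f \<in> V i"
  shows "f \<in> V i"
  using assms(2,3)
proof (induction n arbitrary: f)
  case 0
  then show ?case using subalg_carrier[OF subalg_T] by simp
next
  case (Suc n)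
  have xT: "xmut k \<in> T" using V_subset_T xmut_in_V by blast
  have fc: "f \<in> carrier F" using Suc.prems subalg_carrier[OF subalg_T] by blast
  have "xmut k [^] n \<otimes> (xmut k \<otimes> f) = xmut k [^] Suc n \<otimes> f"
    using fc by (simp add: m_assoc)
  then have "xmut k [^] n \<otimes> (xmut k \<otimes> f) \<in> V i" using Suc.prems(2) by (simp only:)
  then have "xmut k \<otimes> f \<in> V i"
    by (rule Suc.IH[OF subalg_mult[OF subalg_T xT Suc.prems(1)]])
  then show ?case by (rule xmut_k_cancel[OF assms(1) Suc.prems(1)])
qed

text \<open>Negative powers of the new variable are what may keep a generator of
  \<open>N.V i\<close> out of \<open>V i\<close>. All generators quasi-commute with
  \<open>xmut k\<close>, so the powers that clear them can be collected on the left.\<close>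

lemma NV_other:
  assumes i: "i \<in> mut" "i \<noteq> k" and f: "f \<in> N.V i"
  shows "\<exists>n::nat. xmut k [^] n \<otimes> f \<in> V i"
proof -
  define W where "W = {f \<in> carrier F. \<exists>n::nat. xmut k [^] n \<otimes> f \<in> V i}"
  have sub: "subsp (V i)" by (rule subalg_subsp[OF subalg_V])
  have xV: "xmut k \<in> V i" by (rule xmut_in_V_other[OF i(2)])
  have mono: "xmut k [^] (n + m) \<otimes> f \<in> V i" if "f \<in> carrier F" "xmut k [^] m \<otimes> f \<in> V i" for f and m n :: nat
  proof -
    have "xmut k [^] n \<otimes> (xmut k [^] m \<otimes> f) \<in> V i"
      by (rule subalg_mult[OF subalg_V subalg_pow[OF subalg_V xV] that(2)])
    then show ?thesis using that(1) by (simp add: m_assoc flip: nat_pow_mult)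
  qed
  have W: "subsp W"
  proof (rule subspI)
    show "W \<subseteq> carrier F" by (auto simp: W_def)
    show "\<zero> \<in> W" using subsp_zero[OF sub] by (simp add: W_def)
    show "f \<oplus> g \<in> W" if "f \<in> W" "g \<in> W" for f g
    proof -
      obtain n m :: nat where n: "xmut k [^] n \<otimes> f \<in> V i" and m: "xmut k [^] m \<otimes> g \<in> V i"
        and c: "f \<in> carrier F" "g \<in> carrier F"
        using \<open>f \<in> W\<close> \<open>g \<in> W\<close> by (auto simp: W_def)
      have "xmut k [^] (n + m) \<otimes> f \<oplus> xmut k [^] (n + m) \<otimes> g \<in> V i"
        using mono[OF c(1) n, of m] mono[OF c(2) m, of n]
        by (intro subsp_add[OF sub]) (simp_all add: add.commute)
      then show ?thesis using c by (auto simp: W_def r_distr)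
    qed
    show "c \<odot> f \<in> W" if "f \<in> W" for c f
      using that subsp_sm[OF sub] by (auto simp: W_def)
  qed
  \<comment> \<open>A power of \<open>xmut k\<close> is moved past \<open>s\<close> at the cost of a
    scalar, so the exponents that clear \<open>s\<close> and \<open>f\<close> add up for the
    product.\<close>
  have step: "s \<otimes> f \<in> W"
    if s: "s \<in> carrier F" "\<exists>e. quasi_comm e (xmut k) s" "\<exists>m::nat. xmut k [^] m \<otimes> s \<in> V i" and f: "f \<in> W" for s f
  proof -
    obtain e m and n :: nat where e: "quasi_comm e (xmut k) s" and m: "xmut k [^] (m::nat) \<otimes> s \<in> V i"
      and n: "xmut k [^] n \<otimes> f \<in> V i" and fc: "f \<in> carrier F"
      using s f by (auto simp: W_def)
    have "quasi_comm (e * int n) (xmut k [^] int n) s"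
      by (rule quasi_comm_pow_left[OF e xmut_Units[OF k] s(1)])
    then have c: "xmut k [^] n \<otimes> s = hp (e * int n) \<odot> (s \<otimes> xmut k [^] n)"
      by (simp add: quasi_comm_def int_pow_int)
    have "xmut k [^] (m + n) \<otimes> (s \<otimes> f) = xmut k [^] m \<otimes> (xmut k [^] n \<otimes> s) \<otimes> f"
      using s(1) fc by (simp add: m_assoc flip: nat_pow_mult)
    also have "\<dots> = hp (e * int n) \<odot> ((xmut k [^] m \<otimes> s) \<otimes> (xmut k [^] n \<otimes> f))"
      unfolding c using s(1) fc by (simp add: m_assoc)
    also have "\<dots> \<in> V i"
      by (rule subsp_sm[OF sub subalg_mult[OF subalg_V m n]])
    finally show ?thesis using s(1) fc unfolding W_def by auto
  qed
  have "N.V i \<subseteq> W"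
    unfolding N.V_def
  proof (rule Kgen_left_module[OF W])
    show "\<one> \<in> W" using subalg_one[OF subalg_V] by (auto simp: W_def intro!: exI[of _ 0])
    show "{N.M a |a. 0 \<le> a i} \<union> {N.xmut i} \<subseteq> carrier F" by auto
    fix s f assume "s \<in> {N.M a |a. 0 \<le> a i} \<union> {N.xmut i}" and f: "f \<in> W"
    then consider a where "s = N.M a" "0 \<le> a i" | "s = N.xmut i" by blast
    then show "s \<otimes> f \<in> W"
    proof cases
      case 1
      \<comment> \<open>Just enough to make the exponent of the new variable nonnegative.\<close>
      define m where "m = nat (- a k)"
      have "xmut k [^] m \<otimes> N.M a = hp (lf r L' (sc (int m) (uvec k)) a) \<odot> N.M (sc (int m) (uvec k) + a)"
        unfolding N.M_mult[symmetric] N.M_pow NM_uvec ..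
      also have "\<dots> \<in> V i"
        using 1(2) i(2) by (intro subsp_sm[OF sub] NM_in_V) (simp_all add: m_def uvec_def)
      finally have "xmut k [^] m \<otimes> s \<in> V i" using 1 by simp
      moreover have "quasi_comm (2 * lf r L' (uvec k) a) (xmut k) s"
        using N.M_quasi_comm[of "uvec k" a] 1 by (simp add: NM_uvec)
      ultimately show ?thesis using 1 by (intro step[OF _ exI exI f]) simp_all
    next
      case 2
      have "quasi_comm (2 * lf r L' (uvec k) (b_minus B' i)) (xmut k) s"
        unfolding 2 by (rule N.xmut_quasi_comm[of i "uvec k", unfolded NM_uvec]) (use i in simp_all)
      moreover have "xmut k [^] (0::nat) \<otimes> s \<in> V i" using Nxmut_in_V[OF i] 2 by simp
      ultimately show ?thesis using 2 by (intro step[OF _ exI exI[of _ 0] f]) simp_all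
    qed
  qed
  then show ?thesis using f by (auto simp: W_def)
qed

text \<open>Direction \<open>k\<close> puts \<open>f\<close> into the old torus; only for elements
  of the torus may the clearing power of \<open>xmut k\<close> be cancelled in the other
  directions.\<close>

lemma NU_subset: "N.U \<subseteq> U"
proof
  fix f assume f: "f \<in> N.U"
  then have "f \<in> V k" using k NV_k by (auto simp: N.U_def)
  then have fT: "f \<in> T" using V_subset_T by blast
  have "f \<in> V i" if "i \<in> mut" for i
  proof (cases "i = k")
    case False
    then show ?thesis
      using NV_other[OF that] xmut_pow_cancel[OF False fT] f that by (auto simp: N.U_def)
  qed (use \<open>f \<in> V k\<close> in simp)
  then show "f \<in> U" using f by (auto simp: U_def N.U_def)
qed

end

section \<open>The cluster algebra inside the upper algebra of the initial seed\<close>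

context preseed
begin

lemma x_in_U: "j < r \<Longrightarrow> x j \<in> U"
proof -
  assume j: "j < r"
  have "M (uvec j) \<in> V i" for i by (rule M_in_V) (simp add: uvec_def)
  then show ?thesis using j by (auto simp: U_def M_uvec x_Units)
qed

text \<open>The upper algebra does not grow along a sequence of mutations. The variables of any
  seed, which lie in the upper algebra of that seed, thus lie in the initial one.\<close>

lemma mutation_class_U:
  assumes "(Y, C, N) \<in> mutation_class F r mut x B L"
  shows "preseed F r mut Y C N d \<and> preseed.U F r mut Y C N \<subseteq> U"
  using assms
proof (induction rule: mutation_class.induct)
  case initial
  then show ?case using preseed_axioms by simp
next
  case (mutate Y C N k)
  then interpret S: preseed F r mut Y C N d by simp
  interpret S: mutation F r mut Y C N d k by unfold_locales (rule mutate)
  show ?case using S.preseed_mutated S.NU_subset mutate.IH by blast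
qed

lemma cluster_algebra_subset_V:
  assumes "i \<in> mut"
  shows "carrier (quantum_cluster_algebra F r mut x B L) \<subseteq> V i"
proof -
  have "quantum_cluster_variables F r mut x B L \<subseteq> U"
    using mutation_class_U preseed.x_in_U unfolding quantum_cluster_variables_def by blast
  also have "U \<subseteq> V i" using assms by (auto simp: U_def)
  finally show ?thesis
    unfolding quantum_cluster_algebra_def carrier_K_subalgebra_gen by (rule Kgen_minimal[OF subalg_V])
qed

end

text \<open>Every element of \<open>V i\<close> has the form \<open>f + g (1 + Y)\<close> with \<open>f\<close> polynomial in \<open>x\<^sub>i\<close>, where \<open>Y\<close>
  is the ratio of the two monomials. Comparing the parts of degree \<open>-1\<close> in \<open>x\<^sub>i\<close>, membership of
  one of the monomials would make \<open>1 + Y\<close> invertible in the torus.\<close>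

lemma (in preseed) M_b_minus_notin_V:
  assumes i: "i \<in> mut"
  shows "M (b_minus B i) \<notin> V i"
proof
  assume mem: "M (b_minus B i) \<in> V i"
  define bm where "bm = b_minus B i"
  define Y where "Y = M (- bm) \<otimes> M (b_plus B i)"
  have bmi: "bm i = -1" using b_self[OF i] by (simp add: bm_def)
  have Y_eq: "Y = hp (\<Lambda> (- bm) (b_plus B i)) \<odot> M (bv i)"
    unfolding Y_def M_mult by (simp only: bp_eq bm_def[symmetric] add_diff_cancel_left' uminus_add_conv_diff)
  have Yc [simp]: "Y \<in> carrier F" by (simp add: Y_def)
  have xmut_eq: "xmut i = M bm \<otimes> (\<one> \<oplus> Y)"
  proof -
    have "M bm \<otimes> M (- bm) = \<one>" by (simp add: M_mult lf_uminus)
    then have "M bm \<otimes> Y = M (b_plus B i)"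
      by (simp add: Y_def flip: m_assoc)
    then show ?thesis by (simp add: xmut_def r_distr bm_def a_comm)
  qed
  define P0 where "P0 = lspan {M a |a. a i \<ge> 0}"
  have gens: "{M a |a. a i \<ge> 0} \<subseteq> carrier F" by auto
  have P0: "subsp P0" unfolding P0_def by (rule subsp_lspan[OF gens])
  have M_P0: "M a \<in> P0" if "a i \<ge> 0" for a
    unfolding P0_def by (rule lspan_base[OF gens]) (use that in blast)
  have T: "subsp T" by (rule subalg_subsp[OF subalg_T])
  have P0c: "f \<in> carrier F" if "f \<in> P0" for f using subsp_carrier[OF P0 that] .
  have Tc: "f \<in> carrier F" if "f \<in> T" for f using subsp_carrier[OF T that] .
  define W where "W = {f \<oplus> g \<otimes> (\<one> \<oplus> Y) |f g. f \<in> P0 \<and> g \<in> T}"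
  have WI: "f \<oplus> g \<otimes> (\<one> \<oplus> Y) \<in> W" if "f \<in> P0" "g \<in> T" for f g
    using that by (auto simp: W_def)
  have W: "subsp W"
  proof (rule subspI)
    show "W \<subseteq> carrier F" using P0c Tc by (auto simp: W_def)
    show "\<zero> \<in> W" using WI[OF subsp_zero[OF P0] subsp_zero[OF T]] by simp
    show "u \<oplus> v \<in> W" if uv: "u \<in> W" "v \<in> W" for u v
    proof -
      obtain f g f' g' where u: "u = f \<oplus> g \<otimes> (\<one> \<oplus> Y)" "v = f' \<oplus> g' \<otimes> (\<one> \<oplus> Y)"
        and c: "f \<in> P0" "g \<in> T" "f' \<in> P0" "g' \<in> T" using uv unfolding W_def by blast
      have "u \<oplus> v = (f \<oplus> f') \<oplus> (g \<oplus> g') \<otimes> (\<one> \<oplus> Y)"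
        unfolding u using P0c[OF c(1)] P0c[OF c(3)] Tc[OF c(2)] Tc[OF c(4)]
        by (simp add: l_distr a_ac)
      then show ?thesis
        using WI[OF subsp_add[OF P0 c(1,3)] subsp_add[OF T c(2,4)]] by simp
    qed
    show "c \<odot> u \<in> W" if u: "u \<in> W" for c u
    proof -
      obtain f g where u: "u = f \<oplus> g \<otimes> (\<one> \<oplus> Y)" and c: "f \<in> P0" "g \<in> T"
        using u unfolding W_def by blast
      have "c \<odot> u = c \<odot> f \<oplus> (c \<odot> g) \<otimes> (\<one> \<oplus> Y)"
        unfolding u using P0c[OF c(1)] Tc[OF c(2)] by (simp add: sm_add_right)
      then show ?thesis
        using WI[OF subsp_sm[OF P0 c(1)] subsp_sm[OF T c(2)]] by simp
    qed
  qed
  have P0_W: "f \<in> W" if "f \<in> P0" for f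
    using WI[OF that subsp_zero[OF T]] P0c[OF that] by simp
  have T_W: "g \<otimes> (\<one> \<oplus> Y) \<in> W" if "g \<in> T" for g
    using WI[OF subsp_zero[OF P0] that] Tc[OF that] by simp
  have left: "s \<otimes> w \<in> W" if sT: "s \<in> T" and sP: "\<And>f. f \<in> P0 \<Longrightarrow> s \<otimes> f \<in> W" and w: "w \<in> W" for s w
  proof -
    obtain f g where w: "w = f \<oplus> g \<otimes> (\<one> \<oplus> Y)" and c: "f \<in> P0" "g \<in> T"
      using w unfolding W_def by blast
    have "s \<otimes> w = s \<otimes> f \<oplus> (s \<otimes> g) \<otimes> (\<one> \<oplus> Y)"
      unfolding w using P0c[OF c(1)] Tc[OF c(2)] Tc[OF sT] by (simp add: r_distr m_assoc)
    then show ?thesis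
      using subsp_add[OF W sP[OF c(1)] T_W[OF subalg_mult[OF subalg_T sT c(2)]]] by simp
  qed
  have M_P0_mult: "M a \<otimes> M b \<in> P0" if "a i + b i \<ge> 0" for a b
    unfolding M_mult by (rule subsp_sm[OF P0 M_P0]) (use that in simp)
  have ind: "s \<otimes> f \<in> W" if "s \<in> carrier F" "\<And>a. a i \<ge> 0 \<Longrightarrow> s \<otimes> M a \<in> W" "f \<in> P0" for s f
  proof -
    have "P0 \<subseteq> {f \<in> carrier F. s \<otimes> f \<in> W}"
      unfolding P0_def by (rule lspan_minimal[OF subsp_preimage_left[OF W that(1)]]) (use that(2) in auto)
    then show ?thesis using that(3) by blast
  qed
  have "V i \<subseteq> W"
    unfolding V_def
  proof (rule Kgen_left_module[OF W])
    show "\<one> \<in> W" using P0_W[OF M_P0[of 0]] by simp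
    show "{M a |a. 0 \<le> a i} \<union> {xmut i} \<subseteq> carrier F" by auto
    fix s w assume "s \<in> {M a |a. 0 \<le> a i} \<union> {xmut i}" and w: "w \<in> W"
    then consider a where "s = M a" "0 \<le> a i" | "s = xmut i" by blast
    then show "s \<otimes> w \<in> W"
    proof cases
      case 1
      have "s \<otimes> f \<in> W" if "f \<in> P0" for f
        by (rule ind[OF _ _ that]) (use 1 in \<open>simp_all add: P0_W[OF M_P0_mult]\<close>)
      moreover have "s \<in> T" unfolding 1(1) by (rule M_in_T)
      ultimately show ?thesis by (intro left[OF _ _ w])
    next
      case 2
      \<comment> \<open>If \<open>x i\<close> does not occur in \<open>M a\<close>, then
        \<open>M a\<close> commutes with \<open>Y\<close> and the product is a left multiple of
        \<open>\<one> \<oplus> Y\<close>; otherwise the exponent -1 of the exchange monomials is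
        absorbed.\<close>
      have "s \<otimes> M a \<in> W" if a: "a i \<ge> 0" for a
      proof (cases "a i = 0")
        case True
        have "2 * \<Lambda> (bv i) a = 0" unfolding \<Lambda>_bv(1)[OF i] True by simp
        then have "M (bv i) \<otimes> M a = M a \<otimes> M (bv i)"
          using M_quasi_comm[of "bv i" a] unfolding quasi_comm_def
          by (simp only: power_int_0_right sm_one[OF m_closed[OF M_carrier M_carrier]])
        then have comm: "Y \<otimes> M a = M a \<otimes> Y"
          unfolding Y_eq sm_mult_left[OF M_carrier M_carrier] sm_mult_right[OF M_carrier M_carrier]
          by (simp only:)
        have "s \<otimes> M a = M bm \<otimes> M a \<oplus> M bm \<otimes> (Y \<otimes> M a)"
          unfolding 2 xmut_eq by (simp add: m_assoc l_distr r_distr)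
        also have "\<dots> = (M bm \<otimes> M a) \<otimes> (\<one> \<oplus> Y)"
          unfolding comm by (simp add: m_assoc r_distr)
        finally have "s \<otimes> M a = (M bm \<otimes> M a) \<otimes> (\<one> \<oplus> Y)" .
        moreover have "M bm \<otimes> M a \<in> T" by (rule subalg_mult[OF subalg_T M_in_T M_in_T])
        ultimately show ?thesis using T_W by simp
      next
        case False
        have "s \<otimes> M a = M (b_plus B i) \<otimes> M a \<oplus> M (b_minus B i) \<otimes> M a"
          unfolding 2 xmut_def by (simp add: l_distr)
        also have "\<dots> \<in> P0"
          by (rule subsp_add[OF P0 M_P0_mult M_P0_mult]) (use a False b_self[OF i] in simp_all)
        finally show ?thesis by (rule P0_W)
      qed
      note gen = this
      have "s \<otimes> f \<in> W" if "f \<in> P0" for f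
        by (rule ind[OF _ gen that]) (simp add: 2)
      moreover have "s \<in> T" unfolding 2 using V_subset_T xmut_in_V by blast
      ultimately show ?thesis by (intro left[OF _ _ w])
    qed
  qed
  with mem obtain f g where fg: "M bm = f \<oplus> g \<otimes> (\<one> \<oplus> Y)" "f \<in> P0" "g \<in> T"
    unfolding W_def bm_def by blast
  \<comment> \<open>This unit grades by the exponent of \<open>x i\<close>, and \<open>Y\<close> is
    homogeneous of degree 0 for it, so multiplication by \<open>\<one> \<oplus> Y\<close> respects
    the components.\<close>
  define u where "u = M (bv i)"
  have u: "u \<in> Units F" "u \<in> carrier F" by (simp_all add: u_def)
  have degM: "M a \<in> homog u (2 * (d * a i))" for a
    using M_homog[of a "bv i"] \<Lambda>_bv(1)[OF i] by (simp add: u_def)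
  have "\<exists>S fam. S \<subseteq> {0..} \<and> decomposes u S fam f"
  proof (rule lspan_decomposes[OF u(1) _ fg(2)[unfolded P0_def]])
    fix s assume "s \<in> {M a |a. 0 \<le> a i}"
    then obtain a where "s = M a" "0 \<le> a i" by blast
    then show "\<exists>m\<in>{0..}. s \<in> homog u m"
      using degM[of a] d_pos by (intro bexI[of _ "2 * (d * a i)"]) simp_all
  qed
  then obtain Sf ff where Sf: "Sf \<subseteq> {0..}" "decomposes u Sf ff f" by blast
  have "\<exists>S fam. S \<subseteq> UNIV \<and> decomposes u S fam g"
    by (rule lspan_decomposes[OF u(1) _ fg(3)[unfolded T_def]]) (use degM in blast)
  then obtain Sg gg where Sg: "decomposes u Sg gg g" by blast
  have "conj_stable u T"
    unfolding conj_stable_def u_def M_inv by (intro ballI subalg_mult[OF subalg_T] M_in_T)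
  then have ggT: "gg m \<in> T" for m
    by (rule decomposes_components[OF u(1) T _ Sg fg(3)])
  have "\<one> \<in> homog u 0" using u by (simp add: homog_def)
  moreover have "Y \<in> homog u 0"
    unfolding Y_eq u_def by (rule subsp_sm[OF subsp_homog]) (use M_homog[of "bv i" "bv i"] in simp_all)
  ultimately have "\<one> \<oplus> Y \<in> homog u 0"
    by (rule subsp_add[OF subsp_homog[OF u(2)]])
  from decomposes_mult(2)[OF u(2) Sg this]
  have dg: "decomposes u Sg (\<lambda>m. gg m \<otimes> (\<one> \<oplus> Y)) (g \<otimes> (\<one> \<oplus> Y))" by simp
  have fin: "finite (Sf \<union> Sg)" using Sf(2) Sg by (simp add: decomposes_def)
  have "decomposes u (Sf \<union> Sg) (\<lambda>m. ff m \<oplus> gg m \<otimes> (\<one> \<oplus> Y)) (M bm)"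
    unfolding fg(1)
    by (rule decomposes_add[OF u(2) decomposes_mono[OF Sf(2) _ fin] decomposes_mono[OF dg _ fin]]) simp_all
  from decomposes_unique[OF u(1) this decomposes_homog[OF u(2) degM], of "2 * (d * bm i)"]
  have "ff (2 * (d * bm i)) \<oplus> gg (2 * (d * bm i)) \<otimes> (\<one> \<oplus> Y) = M bm" by simp
  moreover have "2 * (d * bm i) \<notin> Sf" using Sf(1) bmi d_pos by auto
  then have "ff (2 * (d * bm i)) = \<zero>" using Sf(2) by (simp add: decomposes_def)
  ultimately have "gg (2 * (d * bm i)) \<otimes> (\<one> \<oplus> Y) = M bm"
    using Tc[OF ggT] by simp
  define t where "t = M (- bm) \<otimes> gg (2 * (d * bm i))"
  have tT: "t \<in> T" unfolding t_def by (rule subalg_mult[OF subalg_T M_in_T ggT])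
  have "t \<otimes> (\<one> \<oplus> Y) = M (- bm) \<otimes> M bm"
    unfolding t_def using Tc[OF ggT] \<open>gg (2 * (d * bm i)) \<otimes> (\<one> \<oplus> Y) = M bm\<close> by (simp add: m_assoc)
  also have "\<dots> = \<one>" by (simp add: M_mult lf_uminus)
  finally have t1: "t \<otimes> (\<one> \<oplus> Y) = \<one>" .
  \<comment> \<open>The grading is changed: under conjugation by \<open>x i\<close> itself,
    \<open>Y\<close> has the nonzero degree \<open>- 2 * d\<close>, which rules out a left inverse
    of \<open>\<one> \<oplus> Y\<close> in the torus.\<close>
  obtain S fam where dt: "decomposes (M (uvec i)) S fam t"
    using lspan_decomposes[OF M_Units, of "range M" UNIV "uvec i" t] tT M_homog unfolding T_def by blast
  have deg: "Y \<in> homog (M (uvec i)) (2 * \<Lambda> (uvec i) (bv i))"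
    unfolding Y_eq by (rule subsp_sm[OF subsp_homog M_homog]) simp
  have "2 * \<Lambda> (uvec i) (bv i) \<noteq> 0" using \<Lambda>_bv(2)[OF i, of "uvec i"] d_pos by simp
  moreover have "Y \<noteq> \<zero>" by (simp add: Y_eq)
  ultimately show False
    by (rule one_plus_not_left_invertible[OF M_Units deg _ _ dt t1])
qed

subsection \<open>Extension of an automorphism to fractions\<close>

locale fraction_auto = Kskew +
  fixes A :: "'a set" and \<sigma> :: "'a \<Rightarrow> 'a"
  assumes A: "subalg A"
    and denom: "f \<in> carrier F \<Longrightarrow> \<exists>b\<in>A. b \<noteq> \<zero> \<and> f \<otimes> b \<in> A"
    and \<sigma>_bij: "bij_betw \<sigma> A A"
    and \<sigma>_add: "a \<in> A \<Longrightarrow> b \<in> A \<Longrightarrow> \<sigma> (a \<oplus> b) = \<sigma> a \<oplus> \<sigma> b"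
    and \<sigma>_mult: "a \<in> A \<Longrightarrow> b \<in> A \<Longrightarrow> \<sigma> (a \<otimes> b) = \<sigma> a \<otimes> \<sigma> b"
    and \<sigma>_sm: "a \<in> A \<Longrightarrow> \<sigma> (c \<odot> a) = c \<odot> \<sigma> a"
    and \<sigma>_one: "\<sigma> \<one> = \<one>"
begin

lemma Ac: "a \<in> A \<Longrightarrow> a \<in> carrier F"
  using A subalg_carrier by blast

lemma \<sigma>A: "a \<in> A \<Longrightarrow> \<sigma> a \<in> A"
  using \<sigma>_bij bij_betwE by blast

lemma \<sigma>c: "a \<in> A \<Longrightarrow> \<sigma> a \<in> carrier F"
  using \<sigma>A Ac by blast

lemma \<sigma>_zero: "\<sigma> \<zero> = \<zero>"
  using \<sigma>_sm[OF subsp_zero[OF subalg_subsp[OF A]], of 0] \<sigma>c[OF subsp_zero[OF subalg_subsp[OF A]]] by simp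

lemma \<sigma>_nonzero: "a \<in> A \<Longrightarrow> a \<noteq> \<zero> \<Longrightarrow> \<sigma> a \<noteq> \<zero>"
  using \<sigma>_bij \<sigma>_zero subsp_zero[OF subalg_subsp[OF A]] by (metis bij_betw_imp_inj_on inj_onD)

text \<open>The Ore condition for \<open>A\<close> comes from \<open>F\<close>: a right denominator
  \<open>u\<close> of \<open>inv b \<otimes> a\<close> makes
  \<open>v = inv b \<otimes> a \<otimes> u\<close> an element of \<open>A\<close>.\<close>

lemma ore:
  assumes a: "a \<in> A" and b: "b \<in> A" "b \<noteq> \<zero>"
  shows "\<exists>u\<in>A. \<exists>v\<in>A. u \<noteq> \<zero> \<and> a \<otimes> u = b \<otimes> v"
proof -
  have c: "a \<in> carrier F" "b \<in> carrier F" using a b Ac by blast+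
  have bU: "b \<in> Units F" using c b by (simp add: Units_iff)
  have ib: "inv b \<in> carrier F" using bU by simp
  obtain u where u: "u \<in> A" "u \<noteq> \<zero>" "(inv b \<otimes> a) \<otimes> u \<in> A"
    using denom[OF m_closed[OF ib c(1)]] by blast
  have "b \<otimes> ((inv b \<otimes> a) \<otimes> u) = (b \<otimes> inv b) \<otimes> a \<otimes> u"
    using c ib Ac[OF u(1)] by (simp add: m_assoc)
  then have "b \<otimes> ((inv b \<otimes> a) \<otimes> u) = a \<otimes> u"
    using bU c by simp
  then show ?thesis using u by metis
qed

lemma common_denom:
  assumes f: "f \<in> carrier F" and g: "g \<in> carrier F"
  shows "\<exists>w\<in>A. w \<noteq> \<zero> \<and> f \<otimes> w \<in> A \<and> g \<otimes> w \<in> A"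
proof -
  obtain b where b: "b \<in> A" "b \<noteq> \<zero>" "f \<otimes> b \<in> A" using denom[OF f] by blast
  obtain c where c: "c \<in> A" "c \<noteq> \<zero>" "g \<otimes> c \<in> A" using denom[OF g] by blast
  obtain u v where u: "u \<in> A" "u \<noteq> \<zero>" "v \<in> A" "b \<otimes> u = c \<otimes> v"
    using ore[OF b(1) c(1,2)] by blast
  have "f \<otimes> (b \<otimes> u) = f \<otimes> b \<otimes> u" "g \<otimes> (b \<otimes> u) = g \<otimes> c \<otimes> v"
    unfolding u(4) using f g b c u Ac by (simp_all add: m_assoc u(4)[symmetric])
  then have "f \<otimes> (b \<otimes> u) \<in> A" "g \<otimes> (b \<otimes> u) \<in> A"
    using subalg_mult[OF A b(3) u(1)] subalg_mult[OF A c(3) u(3)] by simp_all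
  moreover have "b \<otimes> u \<in> A" "b \<otimes> u \<noteq> \<zero>"
    using subalg_mult[OF A b(1) u(1)] b(1,2) u(1,2) Ac by simp_all
  ultimately show ?thesis by blast
qed

text \<open>The value is \<open>\<sigma> (f \<otimes> b) \<otimes> inv (\<sigma> b)\<close> for some
  admissible denominator \<open>b\<close>.\<close>

definition hat :: "'a \<Rightarrow> 'a" where
  "hat f = (SOME v. v \<in> carrier F \<and> (\<exists>b\<in>A. b \<noteq> \<zero> \<and> f \<otimes> b \<in> A \<and> v \<otimes> \<sigma> b = \<sigma> (f \<otimes> b)))"

text \<open>The second part is the independence of the denominator: two denominators have a common
  right multiple in \<open>A\<close>, on which \<open>\<sigma>\<close> can be compared.\<close>

lemma hat:
  assumes f: "f \<in> carrier F"
  shows "hat f \<in> carrier F"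
    and "b \<in> A \<Longrightarrow> b \<noteq> \<zero> \<Longrightarrow> f \<otimes> b \<in> A \<Longrightarrow> hat f \<otimes> \<sigma> b = \<sigma> (f \<otimes> b)"
proof -
  obtain e where e: "e \<in> A" "e \<noteq> \<zero>" "f \<otimes> e \<in> A" using denom[OF f] by blast
  have "\<sigma> e \<in> Units F" using \<sigma>c[OF e(1)] \<sigma>_nonzero[OF e(1,2)] by (simp add: Units_iff)
  then have "(\<sigma> (f \<otimes> e) \<otimes> inv (\<sigma> e)) \<otimes> \<sigma> e = \<sigma> (f \<otimes> e)" "\<sigma> (f \<otimes> e) \<otimes> inv (\<sigma> e) \<in> carrier F"
    using \<sigma>c[OF e(3)] by (simp_all add: m_assoc)
  then have "\<exists>v. v \<in> carrier F \<and> (\<exists>b\<in>A. b \<noteq> \<zero> \<and> f \<otimes> b \<in> A \<and> v \<otimes> \<sigma> b = \<sigma> (f \<otimes> b))"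
    using e by blast
  then have h: "hat f \<in> carrier F \<and> (\<exists>b\<in>A. b \<noteq> \<zero> \<and> f \<otimes> b \<in> A \<and> hat f \<otimes> \<sigma> b = \<sigma> (f \<otimes> b))"
    unfolding hat_def by (rule someI_ex)
  then show hc: "hat f \<in> carrier F" by blast
  obtain b0 where b0: "b0 \<in> A" "b0 \<noteq> \<zero>" "f \<otimes> b0 \<in> A" "hat f \<otimes> \<sigma> b0 = \<sigma> (f \<otimes> b0)"
    using h by blast
  assume b: "b \<in> A" "b \<noteq> \<zero>" "f \<otimes> b \<in> A"
  obtain u v where u: "u \<in> A" "u \<noteq> \<zero>" "v \<in> A" "b \<otimes> u = b0 \<otimes> v"
    using ore[OF b(1) b0(1,2)] by blast
  have "f \<otimes> b \<otimes> u = f \<otimes> b0 \<otimes> v"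
    using f b b0 u Ac by (simp add: m_assoc)
  have "hat f \<otimes> \<sigma> b \<otimes> \<sigma> u = hat f \<otimes> \<sigma> (b \<otimes> u)"
    unfolding \<sigma>_mult[OF b(1) u(1)] using hc \<sigma>c[OF b(1)] \<sigma>c[OF u(1)] by (simp add: m_assoc)
  also have "\<dots> = hat f \<otimes> \<sigma> b0 \<otimes> \<sigma> v"
    unfolding u(4) \<sigma>_mult[OF b0(1) u(3)] using hc \<sigma>c[OF b0(1)] \<sigma>c[OF u(3)] by (simp add: m_assoc)
  also have "\<dots> = \<sigma> (f \<otimes> b0 \<otimes> v)"
    unfolding b0(4) \<sigma>_mult[OF b0(3) u(3)] ..
  also have "\<dots> = \<sigma> (f \<otimes> b) \<otimes> \<sigma> u"
    unfolding \<open>f \<otimes> b \<otimes> u = f \<otimes> b0 \<otimes> v\<close>[symmetric] \<sigma>_mult[OF b(3) u(1)] ..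
  finally show "hat f \<otimes> \<sigma> b = \<sigma> (f \<otimes> b)"
    by (rule right_cancel[rotated -1]) (use \<sigma>c[OF u(1)] \<sigma>_nonzero[OF u(1,2)] \<sigma>c[OF b(1)] \<sigma>c[OF b(3)] hc in simp_all)
qed

lemma hat_unique:
  assumes f: "f \<in> carrier F" and b: "b \<in> A" "b \<noteq> \<zero>" "f \<otimes> b \<in> A"
    and v: "v \<in> carrier F" "v \<otimes> \<sigma> b = \<sigma> (f \<otimes> b)"
  shows "hat f = v"
proof (rule right_cancel[of "\<sigma> b"])
  show "hat f \<otimes> \<sigma> b = v \<otimes> \<sigma> b"
    unfolding hat(2)[OF f b] v(2) ..
qed (rule \<sigma>c[OF b(1)] \<sigma>_nonzero[OF b(1,2)] hat(1)[OF f] v(1))+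

lemma hat_A: "a \<in> A \<Longrightarrow> hat a = \<sigma> a"
  by (rule hat_unique[of a \<one>]) (simp_all add: Ac \<sigma>c \<sigma>_one subalg_one[OF A])

lemma hat_one: "hat \<one> = \<one>"
  using hat_A[OF subalg_one[OF A]] \<sigma>_one by simp

lemma hat_add:
  assumes f: "f \<in> carrier F" and g: "g \<in> carrier F"
  shows "hat (f \<oplus> g) = hat f \<oplus> hat g"
proof -
  obtain w where w: "w \<in> A" "w \<noteq> \<zero>" "f \<otimes> w \<in> A" "g \<otimes> w \<in> A" using common_denom[OF f g] by blast
  have eq: "(f \<oplus> g) \<otimes> w = f \<otimes> w \<oplus> g \<otimes> w" using f g Ac[OF w(1)] by (simp add: l_distr)
  show ?thesis
  proof (rule hat_unique[of _ w])
    show "(f \<oplus> g) \<otimes> w \<in> A" unfolding eq by (rule subsp_add[OF subalg_subsp[OF A] w(3,4)])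
    show "(hat f \<oplus> hat g) \<otimes> \<sigma> w = \<sigma> ((f \<oplus> g) \<otimes> w)"
      unfolding eq \<sigma>_add[OF w(3,4)] hat(2)[OF f w(1-3), symmetric] hat(2)[OF g w(1,2,4), symmetric]
      using hat(1)[OF f] hat(1)[OF g] \<sigma>c[OF w(1)] by (simp add: l_distr)
  qed (use f g w hat(1) in simp_all)
qed

text \<open>The numerator of \<open>g\<close> and the denominator of \<open>f\<close> get a common
  right multiple, so that the inner denominator cancels in the product of the fractions.\<close>

lemma hat_mult:
  assumes f: "f \<in> carrier F" and g: "g \<in> carrier F"
  shows "hat (f \<otimes> g) = hat f \<otimes> hat g"
proof -
  obtain b where b: "b \<in> A" "b \<noteq> \<zero>" "g \<otimes> b \<in> A" using denom[OF g] by blast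
  obtain c where c: "c \<in> A" "c \<noteq> \<zero>" "f \<otimes> c \<in> A" using denom[OF f] by blast
  obtain u v where u: "u \<in> A" "u \<noteq> \<zero>" "v \<in> A" "g \<otimes> b \<otimes> u = c \<otimes> v"
    using ore[OF b(3) c(1,2)] by blast
  have eq: "f \<otimes> g \<otimes> (b \<otimes> u) = f \<otimes> c \<otimes> v"
    using f g b c u Ac by (simp add: m_assoc)
  show ?thesis
  proof (rule hat_unique[of _ "b \<otimes> u"])
    show "b \<otimes> u \<in> A" by (rule subalg_mult[OF A b(1) u(1)])
    show "b \<otimes> u \<noteq> \<zero>" using b(1,2) u(1,2) Ac by simp
    show "f \<otimes> g \<otimes> (b \<otimes> u) \<in> A" unfolding eq by (rule subalg_mult[OF A c(3) u(3)])
    have "\<sigma> (f \<otimes> g \<otimes> (b \<otimes> u)) = hat f \<otimes> \<sigma> c \<otimes> \<sigma> v"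
      unfolding eq \<sigma>_mult[OF c(3) u(3)] hat(2)[OF f c] ..
    also have "\<dots> = hat f \<otimes> \<sigma> (c \<otimes> v)"
      unfolding \<sigma>_mult[OF c(1) u(3)] using hat(1)[OF f] \<sigma>c[OF c(1)] \<sigma>c[OF u(3)] by (simp add: m_assoc)
    also have "\<dots> = hat f \<otimes> (hat g \<otimes> \<sigma> b \<otimes> \<sigma> u)"
      unfolding u(4)[symmetric] \<sigma>_mult[OF b(3) u(1)] hat(2)[OF g b] ..
    also have "\<dots> = hat f \<otimes> hat g \<otimes> \<sigma> (b \<otimes> u)"
      unfolding \<sigma>_mult[OF b(1) u(1)] using hat(1)[OF f] hat(1)[OF g] \<sigma>c[OF b(1)] \<sigma>c[OF u(1)]
      by (simp add: m_assoc)
    finally show "hat f \<otimes> hat g \<otimes> \<sigma> (b \<otimes> u) = \<sigma> (f \<otimes> g \<otimes> (b \<otimes> u))" ..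
  qed (use f g hat(1) in simp_all)
qed

lemma hat_sm:
  assumes f: "f \<in> carrier F"
  shows "hat (c \<odot> f) = c \<odot> hat f"
proof -
  obtain b where b: "b \<in> A" "b \<noteq> \<zero>" "f \<otimes> b \<in> A" using denom[OF f] by blast
  show ?thesis
  proof (rule hat_unique[of _ b])
    have eq: "(c \<odot> f) \<otimes> b = c \<odot> (f \<otimes> b)" using f Ac[OF b(1)] by simp
    show "(c \<odot> f) \<otimes> b \<in> A" unfolding eq by (rule subsp_sm[OF subalg_subsp[OF A] b(3)])
    show "(c \<odot> hat f) \<otimes> \<sigma> b = \<sigma> ((c \<odot> f) \<otimes> b)"
      unfolding eq \<sigma>_sm[OF b(3)] hat(2)[OF f b, symmetric] using hat(1)[OF f] \<sigma>c[OF b(1)] by simp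
  qed (use f b hat(1) in simp_all)
qed

lemma hat_bij: "bij_betw hat (carrier F) (carrier F)"
proof (rule bij_betwI')
  fix f g assume f: "f \<in> carrier F" and g: "g \<in> carrier F"
  show "hat f = hat g \<longleftrightarrow> f = g"
  proof
    assume eq: "hat f = hat g"
    obtain w where w: "w \<in> A" "w \<noteq> \<zero>" "f \<otimes> w \<in> A" "g \<otimes> w \<in> A" using common_denom[OF f g] by blast
    have "\<sigma> (f \<otimes> w) = \<sigma> (g \<otimes> w)"
      using hat(2)[OF f w(1-3)] hat(2)[OF g w(1,2,4)] eq by simp
    then have "f \<otimes> w = g \<otimes> w"
      using \<sigma>_bij w(3,4) by (meson bij_betw_imp_inj_on inj_onD)
    then show "f = g" by (rule right_cancel[rotated -1]) (use f g w Ac in simp_all)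
  qed simp
next
  show "hat f \<in> carrier F" if "f \<in> carrier F" for f by (rule hat(1)[OF that])
  fix v assume v: "v \<in> carrier F"
  \<comment> \<open>A preimage of \<open>v\<close> is the fraction of the preimages under
    \<open>\<sigma>\<close> of its numerator and its denominator.\<close>
  obtain e where e: "e \<in> A" "e \<noteq> \<zero>" "v \<otimes> e \<in> A" using denom[OF v] by blast
  obtain b where b: "b \<in> A" "\<sigma> b = e" using \<sigma>_bij e(1) by (metis bij_betw_iff_bijections)
  obtain a where a: "a \<in> A" "\<sigma> a = v \<otimes> e" using \<sigma>_bij e(3) by (metis bij_betw_iff_bijections)
  have b0: "b \<noteq> \<zero>" using b e \<sigma>_zero by auto
  then have bU: "b \<in> Units F" using Ac[OF b(1)] by (simp add: Units_iff)
  have fc: "a \<otimes> inv b \<in> carrier F" using bU Ac[OF a(1)] by simp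
  have eq: "(a \<otimes> inv b) \<otimes> b = a" using bU Ac[OF a(1)] by (simp add: m_assoc)
  have "hat (a \<otimes> inv b) = v"
    by (rule hat_unique[OF fc b(1) b0]) (simp_all only: eq a b v)
  then show "\<exists>f\<in>carrier F. v = hat f" using fc by blast
qed

end

subsection \<open>Weights of monomials\<close>

lemma (in Kskew) hom_ipow:
  assumes h: "\<And>f. f \<in> carrier F \<Longrightarrow> h f \<in> carrier F" "h \<one> = \<one>"
      "\<And>f g. f \<in> carrier F \<Longrightarrow> g \<in> carrier F \<Longrightarrow> h (f \<otimes> g) = h f \<otimes> h g"
    and x: "x \<in> Units F" and hx: "h x = hp e \<odot> x"
  shows "h (x [^] (n::int)) = hp (e * n) \<odot> x [^] n"
proof -
  have hinv: "h (inv x) = hp (- e) \<odot> inv x"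
  proof (rule left_cancel[of x])
    have "hp e \<odot> (x \<otimes> h (inv x)) = h (x \<otimes> inv x)"
      using h(1)[of "inv x"] h(3)[of x "inv x"] x hx by simp
    also have "\<dots> = \<one>" using x h(2) by simp
    finally show "x \<otimes> h (inv x) = x \<otimes> (hp (- e) \<odot> inv x)"
      using sm_move[of "x \<otimes> h (inv x)" e \<one>] x h(1)[of "inv x"] by simp
  qed (use x h(1) Units_iff in simp_all)
  show ?thesis
  proof (induction n rule: int_induct[of _ 0])
    case (step1 i)
    then show ?case using x hx by (simp add: ipow_add h(3) distrib_left hp_add mult.commute)
  next
    case (step2 i)
    then show ?case
      using x hinv ipow_add[OF x, of i "-1"] by (simp add: h(3) right_diff_distrib) (simp flip: hp_add)
  qed (use h(2) in simp)
qed

lemma (in Kskew) hom_om: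
  assumes h: "\<And>f. f \<in> carrier F \<Longrightarrow> h f \<in> carrier F" "h \<one> = \<one>"
      "\<And>f g. f \<in> carrier F \<Longrightarrow> g \<in> carrier F \<Longrightarrow> h (f \<otimes> g) = h f \<otimes> h g"
    and x: "\<And>i. i < r \<Longrightarrow> x i \<in> Units F" and hx: "\<And>i. i < r \<Longrightarrow> h (x i) = hp (e i) \<odot> x i"
  shows "h (ordered_monomial F r x a) = hp (\<Sum>i<r. e i * a i) \<odot> ordered_monomial F r x a"
  using x hx
proof (induction r)
  case (Suc r)
  have IH: "h (ordered_monomial F r x a) = hp (\<Sum>i<r. e i * a i) \<odot> ordered_monomial F r x a"
    by (rule Suc.IH) (use Suc.prems in simp_all)
  have c: "ordered_monomial F r x a \<in> carrier F" "x r [^] a r \<in> carrier F"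
    using om_Units[of r x a] Suc.prems(1) by simp_all
  have p: "h (x r [^] a r) = hp (e r * a r) \<odot> x r [^] a r"
    by (rule hom_ipow[OF h]) (use Suc.prems in simp_all)
  have S: "ordered_monomial F (Suc r) x a = ordered_monomial F r x a \<otimes> x r [^] a r"
    by (rule om_Suc[OF Suc.prems(1)])
  show ?case
    unfolding S h(3)[OF c] IH p using c by (simp add: hp_add mult.commute)
qed (use h(2) in simp)

section \<open>Denominators in the cluster algebra and weights of exchange monomials\<close>

context preseed
begin

lemma M_nonneg_in_subalg:
  assumes A: "subalg A" and x: "\<And>i. i < r \<Longrightarrow> x i \<in> A" and a: "\<And>i. i < r \<Longrightarrow> a i \<ge> 0"
  shows "M a \<in> A"
proof -
  have "n \<le> r \<Longrightarrow> ordered_monomial F n x a \<in> A" for n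
  proof (induction n)
    case (Suc n)
    have S: "ordered_monomial F (Suc n) x a = ordered_monomial F n x a \<otimes> x n [^] a n"
      by (rule om_Suc) (use Suc.prems x_Units in simp)
    obtain m where m: "a n = int m" using a[of n] Suc.prems nonneg_int_cases by auto
    have "x n [^] a n \<in> A" unfolding m int_pow_int by (rule subalg_pow[OF A x]) (use Suc.prems in simp)
    moreover have "ordered_monomial F n x a \<in> A" using Suc by simp
    ultimately show ?case unfolding S using subalg_mult[OF A] by blast
  qed (simp add: subalg_one[OF A])
  then show ?thesis
    unfolding M_def normalised_monomial_def by (intro subsp_sm[OF subalg_subsp[OF A]]) simp
qed

text \<open>A high power of the product of all variables makes every exponent nonnegative. The claim
  for all \<open>n \<ge> N\<close> allows two bounds to be merged by their maximum.\<close>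

lemma clear_denominator:
  assumes A: "subalg A" and x: "\<And>i. i < r \<Longrightarrow> x i \<in> A" and f: "f \<in> T"
  shows "\<exists>N::nat. \<forall>n\<ge>N. f \<otimes> M (\<lambda>_. int n) \<in> A"
  using f unfolding T_def
proof induction
  case zero
  then show ?case using subsp_zero[OF subalg_subsp[OF A]] by simp
next
  case (add f s c)
  obtain N where N: "\<And>n. n \<ge> N \<Longrightarrow> f \<otimes> M (\<lambda>_. int n) \<in> A" using add.IH by blast
  obtain a where s: "s = M a" using add.hyps by blast
  have rM: "range M \<subseteq> carrier F" by auto
  have fc: "f \<in> carrier F" using add.hyps(1) lspan_carrier[OF rM] by blast
  define K where "K = N + nat (\<Sum>i<r. \<bar>a i\<bar>)"
  have K: "a i + int n \<ge> 0" if "i < r" "n \<ge> K" for i n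
  proof -
    have "\<bar>a i\<bar> \<le> (\<Sum>i<r. \<bar>a i\<bar>)"
      by (rule member_le_sum) (use that in simp_all)
    then show ?thesis using that by (simp add: K_def)
  qed
  have "(f \<oplus> c \<odot> s) \<otimes> M (\<lambda>_. int n) \<in> A" if n: "n \<ge> K" for n
  proof -
    have "M (a + (\<lambda>_. int n)) \<in> A"
      by (rule M_nonneg_in_subalg[OF A x]) (use K[OF _ n] in simp_all)
    then have "c \<odot> (hp (\<Lambda> a (\<lambda>_. int n)) \<odot> M (a + (\<lambda>_. int n))) \<in> A"
      by (intro subsp_sm[OF subalg_subsp[OF A]])
    then have "c \<odot> (M a \<otimes> M (\<lambda>_. int n)) \<in> A" unfolding M_mult .
    moreover have "f \<otimes> M (\<lambda>_. int n) \<in> A" using N[of n] n by (simp add: K_def)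
    ultimately have "f \<otimes> M (\<lambda>_. int n) \<oplus> c \<odot> (M a \<otimes> M (\<lambda>_. int n)) \<in> A"
      using subsp_add[OF subalg_subsp[OF A]] by blast
    then show ?thesis using fc by (simp add: s l_distr)
  qed
  then show ?case by blast
qed

lemma torus_subset_T:
  assumes "I \<subseteq> {..<r}"
  shows "Kgen (x ` I \<union> (\<lambda>i. inv (x i)) ` I) \<subseteq> T"
proof (rule Kgen_minimal[OF subalg_T])
  have "x i \<in> T" "inv (x i) \<in> T" if "i \<in> I" for i
    using that assms M_in_T[of "uvec i"] M_in_T[of "- uvec i"] M_uvec[of i] M_inv[of "uvec i"] by auto
  then show "x ` I \<union> (\<lambda>i. inv (x i)) ` I \<subseteq> T" by auto
qed

text \<open>For \<open>f = s \<otimes> inv t\<close> in fractions of the torus, one monomial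
  \<open>m\<close> clears both \<open>s\<close> and \<open>t\<close>, and
  \<open>t \<otimes> m\<close> is the denominator.\<close>

lemma denominator_exists:
  assumes A: "subalg A" and x: "\<And>i. i < r \<Longrightarrow> x i \<in> A" and I: "I \<subseteq> {..<r}"
    and frac: "\<exists>s\<in>Kgen (x ` I \<union> (\<lambda>i. inv (x i)) ` I). \<exists>t\<in>Kgen (x ` I \<union> (\<lambda>i. inv (x i)) ` I).
      t \<noteq> \<zero> \<and> f = s \<otimes> inv t"
  shows "\<exists>b\<in>A. b \<noteq> \<zero> \<and> f \<otimes> b \<in> A"
proof -
  obtain s t where st: "s \<in> T" "t \<in> T" "t \<noteq> \<zero>" "f = s \<otimes> inv t"
    using frac torus_subset_T[OF I] by blast
  have c: "s \<in> carrier F" "t \<in> carrier F" using st subalg_carrier[OF subalg_T] by blast+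
  have tU: "t \<in> Units F" using c st by (simp add: Units_iff)
  obtain N1 where N1: "\<And>n. n \<ge> N1 \<Longrightarrow> s \<otimes> M (\<lambda>_. int n) \<in> A"
    using clear_denominator[OF A x st(1)] by blast
  obtain N2 where N2: "\<And>n. n \<ge> N2 \<Longrightarrow> t \<otimes> M (\<lambda>_. int n) \<in> A"
    using clear_denominator[OF A x st(2)] by blast
  define m where "m = M (\<lambda>_. int (max N1 N2))"
  have m: "m \<in> carrier F" "m \<noteq> \<zero>" by (simp_all add: m_def)
  have "f \<otimes> (t \<otimes> m) = s \<otimes> (inv t \<otimes> t) \<otimes> m"
    unfolding st(4) using c m Units_inv_closed[OF tU] by (simp add: m_assoc)
  then have "f \<otimes> (t \<otimes> m) = s \<otimes> m" using tU c by simp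
  moreover have "s \<otimes> m \<in> A" "t \<otimes> m \<in> A"
    using N1[of "max N1 N2"] N2[of "max N1 N2"] by (simp_all add: m_def)
  moreover have "t \<otimes> m \<noteq> \<zero>" using c m st(3) by simp
  ultimately show ?thesis by metis
qed

lemma hom_M:
  assumes h: "\<And>f. f \<in> carrier F \<Longrightarrow> h f \<in> carrier F" "h \<one> = \<one>"
      "\<And>f g. f \<in> carrier F \<Longrightarrow> g \<in> carrier F \<Longrightarrow> h (f \<otimes> g) = h f \<otimes> h g"
      "\<And>c f. f \<in> carrier F \<Longrightarrow> h (c \<odot> f) = c \<odot> h f"
    and hx: "\<And>i. i < r \<Longrightarrow> h (x i) = hp (e i) \<odot> x i"
  shows "h (M a) = hp (\<Sum>i<r. e i * a i) \<odot> M a"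
proof -
  have "ordered_monomial F r x a \<in> carrier F"
    using om_Units[of r x a] x_Units by simp
  then show ?thesis
    unfolding M_def normalised_monomial_def using hom_om[OF h(1-3) x_Units hx]
    by (simp add: h(4) mult.commute)
qed

lemma subalg_cluster_algebra:
  "subalg (carrier (quantum_cluster_algebra F r mut x B L))"
proof -
  have "quantum_cluster_variables F r mut x B L \<subseteq> carrier F"
    using mutation_class_U preseed.x_in_U unfolding quantum_cluster_variables_def U_def by blast
  then show ?thesis
    unfolding quantum_cluster_algebra_def carrier_K_subalgebra_gen by (rule subalg_Kgen)
qed

lemma cluster_variable_in_algebra:
  "(Y, C, N) \<in> mutation_class F r mut x B L \<Longrightarrow> i < r \<Longrightarrow>
   Y i \<in> carrier (quantum_cluster_algebra F r mut x B L)"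
  unfolding quantum_cluster_algebra_def carrier_K_subalgebra_gen
  by (rule subsetD[OF Kgen_incl]) (auto simp: quantum_cluster_variables_def)

text \<open>If the two monomials of an exchange relation had different weights, then each of them
  would lie in the cluster algebra, contradicting the Laurent phenomenon.\<close>

lemma weight_balanced:
  assumes h: "\<And>f. f \<in> carrier F \<Longrightarrow> h f \<in> carrier F" "h \<one> = \<one>"
      "\<And>f g. f \<in> carrier F \<Longrightarrow> g \<in> carrier F \<Longrightarrow> h (f \<otimes> g) = h f \<otimes> h g"
      "\<And>c f. f \<in> carrier F \<Longrightarrow> h (c \<odot> f) = c \<odot> h f"
      "\<And>f g. f \<in> carrier F \<Longrightarrow> g \<in> carrier F \<Longrightarrow> h (f \<oplus> g) = h f \<oplus> h g"
    and hx: "\<And>i. i < r \<Longrightarrow> h (x i) = hp (2 * c i) \<odot> x i"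
    and hA: "\<And>f. f \<in> carrier (quantum_cluster_algebra F r mut x B L) \<Longrightarrow>
      h f \<in> carrier (quantum_cluster_algebra F r mut x B L)"
    and i: "i \<in> mut"
  shows "(\<Sum>j<r. B j i * c j) = 0"
proof (rule ccontr)
  assume ne: "(\<Sum>j<r. B j i * c j) \<noteq> 0"
  define w where "w = (\<lambda>a. \<Sum>j<r. 2 * c j * a j)"
  have w: "w (b_plus B i) = w (b_minus B i) + 2 * (\<Sum>j<r. B j i * c j)"
    unfolding w_def b_plus_minus by (simp add: distrib_left sum.distrib sum_distrib_left ac_simps)
  define p m where "p = b_plus B i" and "m = b_minus B i"
  have sub: "subsp (V i)" by (rule subalg_subsp[OF subalg_V])
  have "(mut_X F r i x B L, mut_B r mut i B, mut_L r i B L) \<in> mutation_class F r mut x B L"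
    by (rule mutation_class.mutate[OF mutation_class.initial i])
  from cluster_variable_in_algebra[OF this mut_less[OF i]]
  have "xmut i \<in> carrier (quantum_cluster_algebra F r mut x B L)"
    by (simp add: mut_X_def xmut_def M_def)
  then have "h (xmut i) \<in> V i" using hA cluster_algebra_subset_V[OF i] by blast
  \<comment> \<open>Subtracting the multiple with the weight of \<open>M p\<close> removes that
    monomial and leaves a nonzero multiple of \<open>M m\<close>.\<close>
  then have "h (xmut i) \<oplus> (- hp (w p)) \<odot> xmut i \<in> V i"
    by (rule subsp_add[OF sub _ subsp_sm[OF sub xmut_in_V]])
  moreover have hM: "h (M a) = hp (w a) \<odot> M a" for a
    unfolding w_def by (rule hom_M[OF h(1-4) hx])
  have "h (xmut i) = hp (w p) \<odot> M p \<oplus> hp (w m) \<odot> M m"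
    unfolding xmut_def h(5)[OF M_carrier M_carrier] hM p_def m_def ..
  then have "h (xmut i) \<oplus> (- hp (w p)) \<odot> xmut i =
      (hp (w p) \<odot> M p \<oplus> (- hp (w p)) \<odot> M p) \<oplus> (hp (w m) \<odot> M m \<oplus> (- hp (w p)) \<odot> M m)"
    unfolding xmut_def p_def[symmetric] m_def[symmetric] by (simp add: sm_add_right a_ac)
  also have "\<dots> = (hp (w m) - hp (w p)) \<odot> M m"
    by (simp flip: sm_add_left)
  ultimately have "(hp (w m) - hp (w p)) \<odot> M m \<in> V i" by simp
  moreover have "hp (w m) - hp (w p) \<noteq> 0" using w ne by (simp add: p_def m_def)
  ultimately have "M m \<in> V i" using subsp_sm_iff[OF sub] by simp
  then show False using M_b_minus_notin_V[OF i] by (simp add: m_def)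
qed

end

subsection \<open>Skew Laurent series\<close>

text \<open>Serves to carve a smaller skew-field out of the series, with inverses computed in the
  larger one.\<close>

lemma (in Kskew) Kskew_subalg:
  assumes V: "subalg V" and inv: "\<And>f. f \<in> V \<Longrightarrow> f \<noteq> \<zero> \<Longrightarrow> inv f \<in> V"
  shows "Kskew (F\<lparr>carrier := V\<rparr>)"
    and "f \<in> V \<Longrightarrow> f \<noteq> \<zero> \<Longrightarrow> inv\<^bsub>F\<lparr>carrier := V\<rparr>\<^esub> f = inv f"
proof -
  let ?G = "F\<lparr>carrier := V\<rparr>"
  interpret G: Kalg ?G by unfold_locales (rule K_algebra_subalg[OF V])
  have Vc: "f \<in> carrier F" if "f \<in> V" for f using subalg_carrier[OF V that] .
  have inv2: "f \<otimes> inv f = \<one>" "inv f \<otimes> f = \<one>" if "f \<in> V" "f \<noteq> \<zero>" for f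
    using Vc[OF that(1)] that(2) by (simp_all add: Units_iff)
  show "Kskew ?G"
  proof unfold_locales
    show "Units ?G = carrier ?G - {\<zero>\<^bsub>?G\<^esub>}"
    proof
      show "carrier ?G - {\<zero>\<^bsub>?G\<^esub>} \<subseteq> Units ?G"
      proof
        fix f assume "f \<in> carrier ?G - {\<zero>\<^bsub>?G\<^esub>}"
        then have f: "f \<in> V" "f \<noteq> \<zero>" by simp_all
        show "f \<in> Units ?G"
          unfolding Units_def using f inv[OF f] inv2[OF f] by (intro CollectI conjI bexI[of _ "inv f"]) simp_all
      qed
      show "Units ?G \<subseteq> carrier ?G - {\<zero>\<^bsub>?G\<^esub>}"
      proof
        fix f assume "f \<in> Units ?G"
        then obtain g where f: "f \<in> V" and g: "g \<in> V" "g \<otimes> f = \<one>"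
          unfolding Units_def by auto
        have "f \<noteq> \<zero>"
        proof
          assume "f = \<zero>"
          then show False using g(2) Vc[OF g(1)] by simp
        qed
        then show "f \<in> carrier ?G - {\<zero>\<^bsub>?G\<^esub>}" using f by simp
      qed
    qed
  qed
  show "inv\<^bsub>?G\<^esub> f = inv f" if f: "f \<in> V" "f \<noteq> \<zero>"
    by (rule G.inv_unique'[symmetric]) (use f inv[OF f] inv2[OF f] in simp_all)
qed

lemma (in abelian_monoid) finsum_swap:
  assumes "finite S" "finite T" "\<And>i j. i \<in> S \<Longrightarrow> j \<in> T \<Longrightarrow> f i j \<in> carrier G"
  shows "(\<Oplus>i\<in>S. \<Oplus>j\<in>T. f i j) = (\<Oplus>j\<in>T. \<Oplus>i\<in>S. f i j)"
  using assms(1,3)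
proof (induction S rule: finite_induct)
  case (insert i S)
  have c: "(\<Oplus>j\<in>T. f i j) \<in> carrier G" for i' using insert.prems by (intro finsum_closed) auto
  have c2: "(\<lambda>i. \<Oplus>j\<in>T. f i j) \<in> S \<rightarrow> carrier G"
    using insert.prems by (intro Pi_I finsum_closed) auto
  have c3: "(\<lambda>j. \<Oplus>i\<in>S. f i j) \<in> T \<rightarrow> carrier G"
    using insert.prems by (intro Pi_I finsum_closed) auto
  have "(\<Oplus>i\<in>insert i S. \<Oplus>j\<in>T. f i j) = (\<Oplus>j\<in>T. f i j) \<oplus> (\<Oplus>j\<in>T. \<Oplus>i\<in>S. f i j)"
    using insert c2 c by (subst finsum_insert) auto
  also have "\<dots> = (\<Oplus>j\<in>T. f i j \<oplus> (\<Oplus>i\<in>S. f i j))"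
    using insert.prems c3 by (subst finsum_addf) auto
  also have "\<dots> = (\<Oplus>j\<in>T. \<Oplus>i\<in>insert i S. f i j)"
    using insert by (intro finsum_cong' refl) (auto intro!: finsum_insert[symmetric] finsum_closed a_closed)
  finally show ?case .
qed (simp add: finsum_zero)

text \<open>An action of the integers by algebra automorphisms; \<open>s n\<close> is the
  conjugation by the \<open>n\<close>-th power of the adjoined variable \<open>y\<close>.\<close>

locale skew_series = Kskew F for F :: "(qfield, 'a) module" (structure) +
  fixes s :: "int \<Rightarrow> 'a \<Rightarrow> 'a"
  assumes s_closed [simp]: "f \<in> carrier F \<Longrightarrow> s n f \<in> carrier F"
    and s_add: "f \<in> carrier F \<Longrightarrow> g \<in> carrier F \<Longrightarrow> s n (f \<oplus> g) = s n f \<oplus> s n g"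
    and s_mult: "f \<in> carrier F \<Longrightarrow> g \<in> carrier F \<Longrightarrow> s n (f \<otimes> g) = s n f \<otimes> s n g"
    and s_sm: "f \<in> carrier F \<Longrightarrow> s n (c \<odot> f) = c \<odot> s n f"
    and s_one [simp]: "s n \<one> = \<one>"
    and s_0 [simp]: "f \<in> carrier F \<Longrightarrow> s 0 f = f"
    and s_comp [simp]: "f \<in> carrier F \<Longrightarrow> s m (s n f) = s (m + n) f"
begin

lemma s_zero [simp]: "s n \<zero> = \<zero>"
  using s_sm[of \<zero> n 0] by simp

lemma s_eq_zero_iff [simp]: "f \<in> carrier F \<Longrightarrow> s n f = \<zero> \<longleftrightarrow> f = \<zero>"
  using s_comp[of f "- n" n] by (auto simp del: s_comp)

lemma s_finsum: "f \<in> S \<rightarrow> carrier F \<Longrightarrow> s n (\<Oplus>i\<in>S. f i) = (\<Oplus>i\<in>S. s n (f i))"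
  by (induction S rule: infinite_finite_induct) (auto simp: s_add Pi_def)

text \<open>Series vanish in all sufficiently negative degrees, so that the sums in the product are
  finite.\<close>

definition LS :: "(qfield, int \<Rightarrow> 'a) module" where
  "LS = \<lparr>carrier = {f. (\<forall>n. f n \<in> carrier F) \<and> (\<exists>N. \<forall>n<N. f n = \<zero>)},
      monoid.mult = (\<lambda>f g n. \<Oplus>m\<in>{m. f m \<noteq> \<zero> \<and> g (n - m) \<noteq> \<zero>}. f m \<otimes> s m (g (n - m))),
      one = (\<lambda>n. if n = 0 then \<one> else \<zero>),
      ring.zero = (\<lambda>n. \<zero>),
      ring.add = (\<lambda>f g n. f n \<oplus> g n),
      module.smult = (\<lambda>c f n. c \<odot> f n)\<rparr>"

lemma LS_simps:
  "f \<in> carrier LS \<longleftrightarrow> (\<forall>n. f n \<in> carrier F) \<and> (\<exists>N. \<forall>n<N. f n = \<zero>)"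
  "\<one>\<^bsub>LS\<^esub> = (\<lambda>n. if n = 0 then \<one> else \<zero>)"
  "\<zero>\<^bsub>LS\<^esub> = (\<lambda>n. \<zero>)"
  "f \<oplus>\<^bsub>LS\<^esub> g = (\<lambda>n. f n \<oplus> g n)"
  "c \<odot>\<^bsub>LS\<^esub> f = (\<lambda>n. c \<odot> f n)"
  by (simp_all add: LS_def)

lemma LS_coeff: "f \<in> carrier LS \<Longrightarrow> f n \<in> carrier F"
  by (simp add: LS_simps)

lemma LS_bound: "f \<in> carrier LS \<Longrightarrow> \<exists>N. \<forall>n<N. f n = \<zero>"
  by (simp add: LS_simps)

lemma LS_mult:
  assumes f: "f \<in> carrier LS" and g: "g \<in> carrier LS" and S: "finite S"
    and "\<And>m. m \<notin> S \<Longrightarrow> f m = \<zero> \<or> g (n - m) = \<zero>"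
  shows "(f \<otimes>\<^bsub>LS\<^esub> g) n = (\<Oplus>m\<in>S. f m \<otimes> s m (g (n - m)))"
proof -
  have "(\<Oplus>m\<in>{m. f m \<noteq> \<zero> \<and> g (n - m) \<noteq> \<zero>}. f m \<otimes> s m (g (n - m))) = (\<Oplus>m\<in>S. f m \<otimes> s m (g (n - m)))"
  proof (rule add.finprod_mono_neutral_cong_left[OF S])
    show "{m. f m \<noteq> \<zero> \<and> g (n - m) \<noteq> \<zero>} \<subseteq> S" using assms(4) by blast
    show "(\<lambda>m. f m \<otimes> s m (g (n - m))) \<in> S \<rightarrow> carrier F"
      using LS_coeff[OF f] LS_coeff[OF g] by simp
    show "f m \<otimes> s m (g (n - m)) = \<zero>" if "m \<in> S - {m. f m \<noteq> \<zero> \<and> g (n - m) \<noteq> \<zero>}" for m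
      using that LS_coeff[OF f] LS_coeff[OF g] by auto
  qed simp
  then show ?thesis by (simp add: LS_def)
qed

text \<open>The upper end \<open>c\<close> may be larger than required, so that several products can
  be summed over one common range.\<close>

lemma LS_mult_window:
  assumes "f \<in> carrier LS" "g \<in> carrier LS" "\<forall>m<a. f m = \<zero>" "\<forall>m<b. g m = \<zero>" "n - b \<le> c"
  shows "(f \<otimes>\<^bsub>LS\<^esub> g) n = (\<Oplus>m\<in>{a..c}. f m \<otimes> s m (g (n - m)))"
proof (rule LS_mult[OF assms(1,2)])
  fix m assume "m \<notin> {a..c}"
  then have "m < a \<or> n - m < b" using assms(5) by auto
  then show "f m = \<zero> \<or> g (n - m) = \<zero>" using assms(3,4) by blast
qed simp

lemma LS_mult_closed:
  assumes f: "f \<in> carrier LS" and g: "g \<in> carrier LS"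
  shows "f \<otimes>\<^bsub>LS\<^esub> g \<in> carrier LS"
proof -
  obtain a where a: "\<forall>m<a. f m = \<zero>" using LS_bound[OF f] by blast
  obtain b where b: "\<forall>m<b. g m = \<zero>" using LS_bound[OF g] by blast
  note c = LS_coeff[OF f] LS_coeff[OF g]
  have eq: "(f \<otimes>\<^bsub>LS\<^esub> g) n = (\<Oplus>m\<in>{a..n - b}. f m \<otimes> s m (g (n - m)))" for n
    by (rule LS_mult_window[OF f g a b]) simp_all
  have "(f \<otimes>\<^bsub>LS\<^esub> g) n \<in> carrier F" for n
    unfolding eq using c by (intro finsum_closed Pi_I m_closed s_closed)
  moreover have "(f \<otimes>\<^bsub>LS\<^esub> g) n = \<zero>" if "n < a + b" for n
    unfolding eq using that by simp
  ultimately show ?thesis unfolding LS_simps by blast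
qed

lemma LS_mult_below:
  assumes f: "f \<in> carrier LS" and g: "g \<in> carrier LS"
    and a: "\<forall>m<a. f m = \<zero>" and b: "\<forall>m<b. g m = \<zero>"
  shows "\<forall>n<a + b. (f \<otimes>\<^bsub>LS\<^esub> g) n = \<zero>"
proof (intro allI impI)
  fix n assume "n < a + b"
  then show "(f \<otimes>\<^bsub>LS\<^esub> g) n = \<zero>" using LS_mult_window[OF f g a b, of n "n - b"] by simp
qed

lemma LS_add_closed: "f \<in> carrier LS \<Longrightarrow> g \<in> carrier LS \<Longrightarrow> f \<oplus>\<^bsub>LS\<^esub> g \<in> carrier LS"
proof -
  assume f: "f \<in> carrier LS" and g: "g \<in> carrier LS"
  obtain a where a: "\<forall>m<a. f m = \<zero>" using LS_bound[OF f] by blast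
  obtain b where b: "\<forall>m<b. g m = \<zero>" using LS_bound[OF g] by blast
  have "\<forall>n<min a b. f n \<oplus> g n = \<zero>" using a b by simp
  then show ?thesis using LS_coeff[OF f] LS_coeff[OF g] unfolding LS_simps by blast
qed

lemma LS_mult_assoc:
  assumes f: "f \<in> carrier LS" and g: "g \<in> carrier LS" and h: "h \<in> carrier LS"
  shows "f \<otimes>\<^bsub>LS\<^esub> g \<otimes>\<^bsub>LS\<^esub> h = f \<otimes>\<^bsub>LS\<^esub> (g \<otimes>\<^bsub>LS\<^esub> h)"
proof
  fix n
  obtain a where a: "\<forall>m<a. f m = \<zero>" using LS_bound[OF f] by blast
  obtain b where b: "\<forall>m<b. g m = \<zero>" using LS_bound[OF g] by blast
  obtain c where c: "\<forall>m<c. h m = \<zero>" using LS_bound[OF h] by blast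
  note fc = LS_coeff[OF f] and gc = LS_coeff[OF g] and hc = LS_coeff[OF h]
  \<comment> \<open>\<open>I\<close> bounds the degree reached after \<open>f\<close> and
    \<open>g\<close>, \<open>K\<close> the degree in \<open>f\<close>; over these ranges both
    bracketings are sums of the same terms \<open>t m k\<close>.\<close>
  define I where "I = {a + b..n - c}"
  define K where "K = {a..n - c - b}"
  define t where "t = (\<lambda>m k. f k \<otimes> s k (g (m - k)) \<otimes> s m (h (n - m)))"
  have tc: "t m k \<in> carrier F" for m k using fc gc hc by (simp add: t_def)
  have "(f \<otimes>\<^bsub>LS\<^esub> g \<otimes>\<^bsub>LS\<^esub> h) n = (\<Oplus>m\<in>I. (f \<otimes>\<^bsub>LS\<^esub> g) m \<otimes> s m (h (n - m)))"
    unfolding I_def by (rule LS_mult_window[OF LS_mult_closed[OF f g] h LS_mult_below[OF f g a b] c]) simp_all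
  also have "\<dots> = (\<Oplus>m\<in>I. \<Oplus>k\<in>K. t m k)"
  proof (rule finsum_cong')
    fix m assume m: "m \<in> I"
    have "(f \<otimes>\<^bsub>LS\<^esub> g) m = (\<Oplus>k\<in>K. f k \<otimes> s k (g (m - k)))"
      unfolding K_def by (rule LS_mult_window[OF f g a b]) (use m in \<open>simp_all add: I_def\<close>)
    then show "(f \<otimes>\<^bsub>LS\<^esub> g) m \<otimes> s m (h (n - m)) = (\<Oplus>k\<in>K. t m k)"
      unfolding t_def using fc gc hc by (simp add: finsum_ldistr K_def)
  qed (use tc in auto)
  also have "\<dots> = (\<Oplus>k\<in>K. \<Oplus>m\<in>I. t m k)"
    by (rule finsum_swap) (use tc in \<open>simp_all add: I_def K_def\<close>)
  also have "\<dots> = (\<Oplus>k\<in>K. f k \<otimes> s k ((g \<otimes>\<^bsub>LS\<^esub> h) (n - k)))"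
  proof (rule finsum_cong')
    fix k assume k: "k \<in> K"
    have inj: "inj_on (\<lambda>m. m - k) I" by (simp add: inj_on_def)
    have "(g \<otimes>\<^bsub>LS\<^esub> h) (n - k) = (\<Oplus>l\<in>(\<lambda>m. m - k) ` I. g l \<otimes> s l (h (n - k - l)))"
    proof (rule LS_mult[OF g h])
      fix l assume l: "l \<notin> (\<lambda>m. m - k) ` I"
      have "l + k \<notin> I"
      proof
        assume "l + k \<in> I"
        then have "l + k - k \<in> (\<lambda>m. m - k) ` I" by (rule imageI)
        with l show False by simp
      qed
      then have "l < b \<or> n - k - l < c" using k by (auto simp: I_def K_def)
      then show "g l = \<zero> \<or> h (n - k - l) = \<zero>" using b c by blast
    qed (simp add: I_def)
    also have "\<dots> = (\<Oplus>m\<in>I. g (m - k) \<otimes> s (m - k) (h (n - m)))"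
      by (subst finsum_reindex[OF _ inj]) (use gc hc in \<open>simp_all\<close>)
    finally have "f k \<otimes> s k ((g \<otimes>\<^bsub>LS\<^esub> h) (n - k)) =
        f k \<otimes> (\<Oplus>m\<in>I. s k (g (m - k) \<otimes> s (m - k) (h (n - m))))"
      using gc hc by (simp add: s_finsum)
    also have "\<dots> = (\<Oplus>m\<in>I. t m k)"
      unfolding t_def using fc gc hc by (simp add: finsum_rdistr I_def s_mult m_assoc)
    finally show "(\<Oplus>m\<in>I. t m k) = f k \<otimes> s k ((g \<otimes>\<^bsub>LS\<^esub> h) (n - k))" ..
  qed (use fc LS_coeff[OF LS_mult_closed[OF g h]] in auto)
  also have "\<dots> = (f \<otimes>\<^bsub>LS\<^esub> (g \<otimes>\<^bsub>LS\<^esub> h)) n"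
    unfolding K_def
    by (rule LS_mult_window[OF f LS_mult_closed[OF g h] a LS_mult_below[OF g h b c], symmetric]) simp_all
  finally show "(f \<otimes>\<^bsub>LS\<^esub> g \<otimes>\<^bsub>LS\<^esub> h) n = (f \<otimes>\<^bsub>LS\<^esub> (g \<otimes>\<^bsub>LS\<^esub> h)) n" .
qed

text \<open>The term \<open>a y^m\<close>; on coefficients from the cluster algebra it is the same
  function as \<open>laurent_term\<close>.\<close>

definition tm :: "'a \<Rightarrow> int \<Rightarrow> int \<Rightarrow> 'a" where
  "tm a m = (\<lambda>n. if n = m then a else \<zero>)"

lemma tm_closed [simp]: "a \<in> carrier F \<Longrightarrow> tm a m \<in> carrier LS"
  unfolding LS_simps tm_def by (auto intro!: exI[of _ m])

lemma mult_tm: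
  assumes f: "f \<in> carrier LS" and a: "a \<in> carrier F"
  shows "(f \<otimes>\<^bsub>LS\<^esub> tm a k) n = f (n - k) \<otimes> s (n - k) a"
    and "(tm a k \<otimes>\<^bsub>LS\<^esub> f) n = a \<otimes> s k (f (n - k))"
proof -
  have "(f \<otimes>\<^bsub>LS\<^esub> tm a k) n = (\<Oplus>m\<in>{n - k}. f m \<otimes> s m (tm a k (n - m)))"
    by (rule LS_mult[OF f tm_closed[OF a]]) (auto simp: tm_def)
  then show "(f \<otimes>\<^bsub>LS\<^esub> tm a k) n = f (n - k) \<otimes> s (n - k) a"
    using LS_coeff[OF f] a by (simp add: tm_def)
  have "(tm a k \<otimes>\<^bsub>LS\<^esub> f) n = (\<Oplus>m\<in>{k}. tm a k m \<otimes> s m (f (n - m)))"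
    by (rule LS_mult[OF tm_closed[OF a] f]) (auto simp: tm_def)
  then show "(tm a k \<otimes>\<^bsub>LS\<^esub> f) n = a \<otimes> s k (f (n - k))"
    using LS_coeff[OF f] a by (simp add: tm_def)
qed

lemma one_LS: "\<one>\<^bsub>LS\<^esub> = tm \<one> 0"
  by (simp add: LS_simps tm_def)

lemma tm_mult: "a \<in> carrier F \<Longrightarrow> b \<in> carrier F \<Longrightarrow> tm a m \<otimes>\<^bsub>LS\<^esub> tm b n = tm (a \<otimes> s m b) (m + n)"
  by (rule ext) (simp add: mult_tm(1)[OF tm_closed], auto simp: tm_def)

lemma LS_distrib:
  assumes f: "f \<in> carrier LS" and g: "g \<in> carrier LS" and h: "h \<in> carrier LS"
  shows "(f \<oplus>\<^bsub>LS\<^esub> g) \<otimes>\<^bsub>LS\<^esub> h = f \<otimes>\<^bsub>LS\<^esub> h \<oplus>\<^bsub>LS\<^esub> g \<otimes>\<^bsub>LS\<^esub> h"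
    and "h \<otimes>\<^bsub>LS\<^esub> (f \<oplus>\<^bsub>LS\<^esub> g) = h \<otimes>\<^bsub>LS\<^esub> f \<oplus>\<^bsub>LS\<^esub> h \<otimes>\<^bsub>LS\<^esub> g"
proof -
  obtain a0 where a0: "\<forall>m<a0. f m = \<zero>" using LS_bound[OF f] by blast
  obtain b0 where b0: "\<forall>m<b0. g m = \<zero>" using LS_bound[OF g] by blast
  obtain c where c: "\<forall>m<c. h m = \<zero>" using LS_bound[OF h] by blast
  define a where "a = min a0 b0"
  have a: "\<forall>m<a. f m = \<zero>" "\<forall>m<a. g m = \<zero>" "\<forall>m<a. (f \<oplus>\<^bsub>LS\<^esub> g) m = \<zero>"
    using a0 b0 by (simp_all add: a_def LS_simps(4))
  note cc = LS_coeff[OF f] LS_coeff[OF g] LS_coeff[OF h]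
  note fg = LS_add_closed[OF f g]
  show "(f \<oplus>\<^bsub>LS\<^esub> g) \<otimes>\<^bsub>LS\<^esub> h = f \<otimes>\<^bsub>LS\<^esub> h \<oplus>\<^bsub>LS\<^esub> g \<otimes>\<^bsub>LS\<^esub> h"
  proof
    fix n
    have "((f \<oplus>\<^bsub>LS\<^esub> g) \<otimes>\<^bsub>LS\<^esub> h) n = (\<Oplus>m\<in>{a..n - c}. (f \<oplus>\<^bsub>LS\<^esub> g) m \<otimes> s m (h (n - m)))"
      by (rule LS_mult_window[OF fg h a(3) c]) simp_all
    also have "\<dots> = (\<Oplus>m\<in>{a..n - c}. f m \<otimes> s m (h (n - m)) \<oplus> g m \<otimes> s m (h (n - m)))"
      using cc by (simp add: LS_simps(4) l_distr)
    also have "\<dots> = (\<Oplus>m\<in>{a..n - c}. f m \<otimes> s m (h (n - m))) \<oplus> (\<Oplus>m\<in>{a..n - c}. g m \<otimes> s m (h (n - m)))"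
      using cc by (intro finsum_addf) auto
    also have "\<dots> = (f \<otimes>\<^bsub>LS\<^esub> h) n \<oplus> (g \<otimes>\<^bsub>LS\<^esub> h) n"
      using LS_mult_window[OF f h a(1) c, of n "n - c"] LS_mult_window[OF g h a(2) c, of n "n - c"] by simp
    finally show "((f \<oplus>\<^bsub>LS\<^esub> g) \<otimes>\<^bsub>LS\<^esub> h) n = (f \<otimes>\<^bsub>LS\<^esub> h \<oplus>\<^bsub>LS\<^esub> g \<otimes>\<^bsub>LS\<^esub> h) n"
      by (simp add: LS_simps(4))
  qed
  show "h \<otimes>\<^bsub>LS\<^esub> (f \<oplus>\<^bsub>LS\<^esub> g) = h \<otimes>\<^bsub>LS\<^esub> f \<oplus>\<^bsub>LS\<^esub> h \<otimes>\<^bsub>LS\<^esub> g"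
  proof
    fix n
    have "(h \<otimes>\<^bsub>LS\<^esub> (f \<oplus>\<^bsub>LS\<^esub> g)) n = (\<Oplus>m\<in>{c..n - a}. h m \<otimes> s m ((f \<oplus>\<^bsub>LS\<^esub> g) (n - m)))"
      by (rule LS_mult_window[OF h fg c a(3)]) simp_all
    also have "\<dots> = (\<Oplus>m\<in>{c..n - a}. h m \<otimes> s m (f (n - m)) \<oplus> h m \<otimes> s m (g (n - m)))"
      using cc by (simp add: LS_simps(4) r_distr s_add)
    also have "\<dots> = (\<Oplus>m\<in>{c..n - a}. h m \<otimes> s m (f (n - m))) \<oplus> (\<Oplus>m\<in>{c..n - a}. h m \<otimes> s m (g (n - m)))"
      using cc by (intro finsum_addf) auto
    also have "\<dots> = (h \<otimes>\<^bsub>LS\<^esub> f) n \<oplus> (h \<otimes>\<^bsub>LS\<^esub> g) n"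
      using LS_mult_window[OF h f c a(1), of n "n - a"] LS_mult_window[OF h g c a(2), of n "n - a"] by simp
    finally show "(h \<otimes>\<^bsub>LS\<^esub> (f \<oplus>\<^bsub>LS\<^esub> g)) n = (h \<otimes>\<^bsub>LS\<^esub> f \<oplus>\<^bsub>LS\<^esub> h \<otimes>\<^bsub>LS\<^esub> g) n"
      by (simp add: LS_simps(4))
  qed
qed

lemma LS_sm_closed: "f \<in> carrier LS \<Longrightarrow> c \<odot>\<^bsub>LS\<^esub> f \<in> carrier LS"
  unfolding LS_simps by auto

lemma K_algebra_LS: "K_algebra LS"
proof -
  have "abelian_group LS"
  proof (rule abelian_groupI)
    fix f assume f: "f \<in> carrier LS"
    have "(-1) \<odot>\<^bsub>LS\<^esub> f \<oplus>\<^bsub>LS\<^esub> f = \<zero>\<^bsub>LS\<^esub>"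
      using LS_coeff[OF f] by (simp add: LS_simps(3-5) sm_minus_one l_neg)
    then show "\<exists>g\<in>carrier LS. g \<oplus>\<^bsub>LS\<^esub> f = \<zero>\<^bsub>LS\<^esub>" using LS_sm_closed[OF f] by blast
  qed (auto simp: LS_add_closed, auto simp: LS_simps a_ac)
  moreover have "monoid LS"
  proof (rule monoidI)
    fix f assume f: "f \<in> carrier LS"
    show "\<one>\<^bsub>LS\<^esub> \<otimes>\<^bsub>LS\<^esub> f = f" "f \<otimes>\<^bsub>LS\<^esub> \<one>\<^bsub>LS\<^esub> = f"
      unfolding one_LS using LS_coeff[OF f] by (auto simp: mult_tm[OF f])
  qed (auto simp: LS_mult_closed LS_mult_assoc one_LS)
  ultimately have ring: "ring LS"
    by (intro ringI) (auto simp: LS_distrib)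
  have "module (ring_of_type_algebra :: qfield ring) LS"
    using cring_from_type_algebra[where 'a = qfield] \<open>abelian_group LS\<close>
  proof (intro module.intro module_axioms.intro)
  qed (auto simp: LS_sm_closed ring_of_type_algebra_def, auto simp: LS_simps sm_add_left sm_add_right)
  moreover have "(c \<odot>\<^bsub>LS\<^esub> f) \<otimes>\<^bsub>LS\<^esub> g = c \<odot>\<^bsub>LS\<^esub> (f \<otimes>\<^bsub>LS\<^esub> g) \<and> f \<otimes>\<^bsub>LS\<^esub> (c \<odot>\<^bsub>LS\<^esub> g) = c \<odot>\<^bsub>LS\<^esub> (f \<otimes>\<^bsub>LS\<^esub> g)"
    if f: "f \<in> carrier LS" and g: "g \<in> carrier LS" for c f g
  proof -
    have "((c \<odot>\<^bsub>LS\<^esub> f) \<otimes>\<^bsub>LS\<^esub> g) n = c \<odot> (f \<otimes>\<^bsub>LS\<^esub> g) n \<and> (f \<otimes>\<^bsub>LS\<^esub> (c \<odot>\<^bsub>LS\<^esub> g)) n = c \<odot> (f \<otimes>\<^bsub>LS\<^esub> g) n" for n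
    proof -
      obtain a where a: "\<forall>m<a. f m = \<zero>" using LS_bound[OF f] by blast
      obtain b where b: "\<forall>m<b. g m = \<zero>" using LS_bound[OF g] by blast
      have a': "\<forall>m<a. (c \<odot>\<^bsub>LS\<^esub> f) m = \<zero>" using a by (simp add: LS_simps(5))
      have b': "\<forall>m<b. (c \<odot>\<^bsub>LS\<^esub> g) m = \<zero>" using b by (simp add: LS_simps(5))
      have fc: "f m \<in> carrier F" "g m \<in> carrier F" for m using LS_coeff f g by blast+
      show ?thesis
        using LS_mult_window[OF f g a b, of n "n - b"] LS_mult_window[OF LS_sm_closed[OF f] g a' b, of n "n - b"]
          LS_mult_window[OF f LS_sm_closed[OF g] a b', of n "n - b"] fc
        by (simp add: LS_simps(5) s_sm sm_finsum)
    qed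
    then show ?thesis by (auto simp: LS_simps(5))
  qed
  ultimately show ?thesis using ring by (simp add: K_algebra_def)
qed

text \<open>Long division: the lowest nonzero coefficient \<open>f N\<close> is invertible, and the
  coefficients of the inverse, which starts in degree \<open>- N\<close>, are determined one after
  the other.\<close>

lemma LS_right_inverse:
  assumes f: "f \<in> carrier LS" "f \<noteq> \<zero>\<^bsub>LS\<^esub>"
  shows "\<exists>g\<in>carrier LS. f \<otimes>\<^bsub>LS\<^esub> g = \<one>\<^bsub>LS\<^esub>"
proof -
  obtain a where a: "\<forall>m<a. f m = \<zero>" using LS_bound[OF f(1)] by blast
  obtain b where b: "f b \<noteq> \<zero>" using f(2) by (auto simp: LS_simps(3))
  then have "a \<le> b" using a by (meson not_le)
  define j where "j = (LEAST j. f (a + int j) \<noteq> \<zero>)"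
  have "f (a + int (nat (b - a))) \<noteq> \<zero>" using b \<open>a \<le> b\<close> by simp
  then have "f (a + int j) \<noteq> \<zero>" unfolding j_def by (rule LeastI)
  define N where "N = a + int j"
  have N: "f N \<noteq> \<zero>" using \<open>f (a + int j) \<noteq> \<zero>\<close> by (simp add: N_def)
  have below: "\<forall>m<N. f m = \<zero>"
  proof (intro allI impI)
    fix m assume m: "m < N"
    show "f m = \<zero>"
    proof (cases "m < a")
      case False
      then have "nat (m - a) < j" using m by (simp add: N_def)
      from not_less_Least[OF this[unfolded j_def]] False show ?thesis by simp
    qed (use a in blast)
  qed
  note fc = LS_coeff[OF f(1)]
  have NU: "f N \<in> Units F" using fc N by (simp add: Units_iff)
  \<comment> \<open>The equation in degree \<open>k\<close> of the product, solved for the newest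
    coefficient; \<open>s (- N)\<close> undoes the twist that this coefficient suffers in passing
    \<open>y^N\<close>.\<close>
  define val where "val = (\<lambda>H k. s (- N) (inv (f N) \<otimes>
    ((if k = 0 then \<one> else \<zero>) \<ominus> (\<Oplus>i\<in>{1..k::nat}. f (N + int i) \<otimes> s (N + int i) (H (k - i))))))"
  \<comment> \<open>Each coefficient depends on all earlier ones, so the recursion carries the whole
    initial segment: \<open>G k\<close> is correct below \<open>k\<close>.\<close>
  define G where "G = rec_nat (\<lambda>_. \<zero>) (\<lambda>k H. H(k := val H k))"
  define h where "h = (\<lambda>k. G (Suc k) k)"
  have G_Suc: "G (Suc k) = (G k)(k := val (G k) k)" for k by (simp add: G_def)
  have G_h: "i < k \<Longrightarrow> G k i = h i" for i k
  proof (induction k)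
    case (Suc k)
    then show ?case by (cases "i = k") (simp_all add: G_Suc h_def)
  qed simp
  have val_closed: "val H k \<in> carrier F" if "\<And>i. H i \<in> carrier F" for H k
    using that fc NU unfolding val_def by (intro s_closed m_closed minus_closed finsum_closed) auto
  have Gc: "G k i \<in> carrier F" for k i
  proof (induction k arbitrary: i)
    case (Suc k)
    then show ?case using val_closed[of "G k"] by (simp add: G_Suc)
  qed (simp add: G_def)
  have hc: "h k \<in> carrier F" for k unfolding h_def by (rule Gc)
  have h_eq: "h k = val h k" for k
  proof -
    have "h k = val (G k) k" by (simp add: h_def G_Suc)
    moreover have "(\<Oplus>i\<in>{1..k}. f (N + int i) \<otimes> s (N + int i) (G k (k - i))) =
        (\<Oplus>i\<in>{1..k}. f (N + int i) \<otimes> s (N + int i) (h (k - i)))"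
      by (rule finsum_cong') (use fc hc G_h in auto)
    ultimately show ?thesis by (simp add: val_def)
  qed
  define g where "g = (\<lambda>n. if n < - N then \<zero> else h (nat (n + N)))"
  have gb: "\<forall>m < - N. g m = \<zero>" by (simp add: g_def)
  have "\<forall>n. g n \<in> carrier F" using hc by (simp add: g_def)
  then have g: "g \<in> carrier LS"
    unfolding LS_simps using gb by blast
  have "(f \<otimes>\<^bsub>LS\<^esub> g) n = \<one>\<^bsub>LS\<^esub> n" for n
  proof (cases "n < 0")
    case True
    then show ?thesis using LS_mult_below[OF f(1) g below gb] by (simp add: LS_simps(2))
  next
    case False
    define k where "k = nat n"
    have n: "n = int k" using False by (simp add: k_def)
    define t where "t = (\<lambda>i. f (N + int i) \<otimes> s (N + int i) (h (k - i)))"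
    have tc: "t i \<in> carrier F" for i using fc hc by (simp add: t_def)
    have "(f \<otimes>\<^bsub>LS\<^esub> g) n = (\<Oplus>m\<in>{N..N + int k}. f m \<otimes> s m (g (n - m)))"
      by (rule LS_mult_window[OF f(1) g below gb]) (simp_all add: n)
    also have "{N..N + int k} = (\<lambda>i. N + int i) ` {0..k}"
    proof
      show "{N..N + int k} \<subseteq> (\<lambda>i. N + int i) ` {0..k}"
      proof
        fix m assume "m \<in> {N..N + int k}"
        then show "m \<in> (\<lambda>i. N + int i) ` {0..k}" by (intro image_eqI[of _ _ "nat (m - N)"]) auto
      qed
    qed auto
    also have "(\<Oplus>m\<in>(\<lambda>i. N + int i) ` {0..k}. f m \<otimes> s m (g (n - m))) =
        (\<Oplus>i\<in>{0..k}. f (N + int i) \<otimes> s (N + int i) (g (n - (N + int i))))"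
      by (rule finsum_reindex) (use fc LS_coeff[OF g] in \<open>auto simp: inj_on_def\<close>)
    also have "\<dots> = (\<Oplus>i\<in>{0..k}. t i)"
    proof (rule finsum_cong')
      fix i assume "i \<in> {0..k}"
      then have "\<not> n - (N + int i) < - N" "nat (n - (N + int i) + N) = k - i" using n by auto
      then show "f (N + int i) \<otimes> s (N + int i) (g (n - (N + int i))) = t i"
        by (simp add: g_def t_def)
    qed (use tc in auto)
    also have "{0..k} = insert 0 {1..k}" by auto
    also have "(\<Oplus>i\<in>insert 0 {1..k}. t i) = t 0 \<oplus> (\<Oplus>i\<in>{1..k}. t i)"
      by (rule finsum_insert) (use tc in auto)
    also have "t 0 = (if k = 0 then \<one> else \<zero>) \<ominus> (\<Oplus>i\<in>{1..k}. t i)"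
    proof -
      have c: "(if k = 0 then \<one> else \<zero>) \<ominus> (\<Oplus>i\<in>{1..k}. t i) \<in> carrier F"
        using tc by (intro minus_closed finsum_closed) auto
      have "h k = s (- N) (inv (f N) \<otimes> ((if k = 0 then \<one> else \<zero>) \<ominus> (\<Oplus>i\<in>{1..k}. t i)))"
        by (subst h_eq) (simp add: val_def t_def)
      then have "s N (h k) = inv (f N) \<otimes> ((if k = 0 then \<one> else \<zero>) \<ominus> (\<Oplus>i\<in>{1..k}. t i))"
        using c NU by simp
      then have "t 0 = f N \<otimes> (inv (f N) \<otimes> ((if k = 0 then \<one> else \<zero>) \<ominus> (\<Oplus>i\<in>{1..k}. t i)))"
        by (simp add: t_def)
      also have "\<dots> = (if k = 0 then \<one> else \<zero>) \<ominus> (\<Oplus>i\<in>{1..k}. t i)"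
        using c NU by (simp flip: m_assoc)
      finally show ?thesis .
    qed
    also have "(if k = 0 then \<one> else \<zero>) \<ominus> (\<Oplus>i\<in>{1..k}. t i) \<oplus> (\<Oplus>i\<in>{1..k}. t i) = (if k = 0 then \<one> else \<zero>)"
    proof -
      have "(\<Oplus>i\<in>{1..k}. t i) \<in> carrier F" using tc by (intro finsum_closed) auto
      then show ?thesis by (simp add: a_minus_def a_assoc l_neg)
    qed
    finally show ?thesis by (simp add: LS_simps(2) n)
  qed
  then show ?thesis using g by blast
qed

text \<open>Right inverses suffice: if \<open>g\<close> is a right inverse of \<open>f\<close> and
  \<open>h\<close> one of \<open>g\<close>, then \<open>f\<close> equals \<open>h\<close>.\<close>

lemma Kskew_LS: "Kskew LS"
proof -
  interpret L: Kalg LS by unfold_locales (rule K_algebra_LS)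
  have one0: "\<one>\<^bsub>LS\<^esub> \<noteq> \<zero>\<^bsub>LS\<^esub>"
  proof
    assume "\<one>\<^bsub>LS\<^esub> = \<zero>\<^bsub>LS\<^esub>"
    then have "\<one>\<^bsub>LS\<^esub> 0 = \<zero>\<^bsub>LS\<^esub> 0" by simp
    then show False by (simp add: LS_simps)
  qed
  have "f \<in> Units LS" if f: "f \<in> carrier LS" "f \<noteq> \<zero>\<^bsub>LS\<^esub>" for f
  proof -
    obtain g where g: "g \<in> carrier LS" "f \<otimes>\<^bsub>LS\<^esub> g = \<one>\<^bsub>LS\<^esub>" using LS_right_inverse[OF f] by blast
    have "g \<noteq> \<zero>\<^bsub>LS\<^esub>" using g f one0 by auto
    then obtain h where h: "h \<in> carrier LS" "g \<otimes>\<^bsub>LS\<^esub> h = \<one>\<^bsub>LS\<^esub>" using LS_right_inverse[OF g(1)] by blast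
    have "f = f \<otimes>\<^bsub>LS\<^esub> (g \<otimes>\<^bsub>LS\<^esub> h)" using f h by simp
    also have "\<dots> = f \<otimes>\<^bsub>LS\<^esub> g \<otimes>\<^bsub>LS\<^esub> h" by (rule L.m_assoc[symmetric]) (rule f(1) g(1) h(1))+
    also have "\<dots> = h" unfolding g(2) using h(1) by simp
    finally show ?thesis using f g h by (auto simp: Units_def)
  qed
  moreover have "\<zero>\<^bsub>LS\<^esub> \<notin> Units LS" using one0 by (auto simp: Units_def)
  ultimately show ?thesis
    by unfold_locales (auto simp: Units_def)
qed

end

sublocale skew_series \<subseteq> L: Kskew LS
  by (rule Kskew_LS)

subsection \<open>Skew Laurent polynomials and their fractions\<close>

context skew_series
begin

definition LP :: "'a set \<Rightarrow> (int \<Rightarrow> 'a) set" where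
  "LP S = {f. (\<forall>n. f n \<in> S) \<and> finite {n. f n \<noteq> \<zero>}}"

lemma finite_bound:
  assumes "finite {n::int. f n \<noteq> \<zero>}"
  shows "\<exists>a b. \<forall>n. f n \<noteq> \<zero> \<longrightarrow> a \<le> n \<and> n < b"
proof -
  define S where "S = {n. f n \<noteq> \<zero>}"
  have S: "finite S" using assms by (simp add: S_def)
  have "Min (insert 0 S) \<le> n \<and> n < Max (insert 0 S) + 1" if "f n \<noteq> \<zero>" for n
  proof -
    have "n \<in> insert 0 S" using that by (simp add: S_def)
    then have "Min (insert 0 S) \<le> n" "n \<le> Max (insert 0 S)" using S by simp_all
    then show ?thesis by simp
  qed
  then show ?thesis by blast
qed

lemma LP_carrier:
  assumes "S \<subseteq> carrier F"
  shows "LP S \<subseteq> carrier LS"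
proof
  fix f assume f: "f \<in> LP S"
  obtain a b where "\<forall>n. f n \<noteq> \<zero> \<longrightarrow> a \<le> n \<and> n < b" using finite_bound[of f] f unfolding LP_def by blast
  then have "\<forall>n<a. f n = \<zero>" by (meson not_less)
  then show "f \<in> carrier LS" using f assms unfolding LS_simps LP_def by blast
qed

lemma tm_zero [simp]: "tm \<zero> n = \<zero>\<^bsub>LS\<^esub>"
  by (simp add: LS_simps tm_def)

lemma tm_eq_zero_iff [simp]: "tm a n = \<zero>\<^bsub>LS\<^esub> \<longleftrightarrow> a = \<zero>"
  by (auto simp: LS_simps tm_def fun_eq_iff)

lemma tm_LP: "a \<in> S \<Longrightarrow> \<zero> \<in> S \<Longrightarrow> tm a n \<in> LP S"
proof -
  assume "a \<in> S" "\<zero> \<in> S"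
  moreover have "{k. tm a n k \<noteq> \<zero>} \<subseteq> {n}" by (auto simp: tm_def)
  then have "finite {k. tm a n k \<noteq> \<zero>}" by (rule finite_subset) simp
  ultimately show ?thesis by (simp add: LP_def tm_def)
qed

lemma subalg_LP:
  assumes S: "subalg S" and st: "\<And>n a. a \<in> S \<Longrightarrow> s n a \<in> S"
  shows "L.subalg (LP S)"
proof (rule L.subalgI)
  note sub = subalg_subsp[OF S]
  have Sc: "S \<subseteq> carrier F" using subsp_carrier[OF sub] by blast
  show "L.subsp (LP S)"
  proof (rule L.subspI)
    show "LP S \<subseteq> carrier LS" by (rule LP_carrier[OF Sc])
    show "\<zero>\<^bsub>LS\<^esub> \<in> LP S" using subsp_zero[OF sub] by (simp add: LP_def LS_simps)
    fix f assume f: "f \<in> LP S"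
    show "f \<oplus>\<^bsub>LS\<^esub> g \<in> LP S" if g: "g \<in> LP S" for g
    proof -
      have "{n. f n \<oplus> g n \<noteq> \<zero>} \<subseteq> {n. f n \<noteq> \<zero>} \<union> {n. g n \<noteq> \<zero>}" by auto
      then have "finite {n. f n \<oplus> g n \<noteq> \<zero>}"
        by (rule finite_subset) (use f g in \<open>simp add: LP_def\<close>)
      then show ?thesis using f g subsp_add[OF sub] by (simp add: LP_def LS_simps(4))
    qed
    show "c \<odot>\<^bsub>LS\<^esub> f \<in> LP S" for c
    proof -
      have "{n. c \<odot> f n \<noteq> \<zero>} \<subseteq> {n. f n \<noteq> \<zero>}" by auto
      then have "finite {n. c \<odot> f n \<noteq> \<zero>}"
        by (rule finite_subset) (use f in \<open>simp add: LP_def\<close>)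
      then show ?thesis using f subsp_sm[OF sub] by (simp add: LP_def LS_simps(5))
    qed
  qed
  show "\<one>\<^bsub>LS\<^esub> \<in> LP S"
    unfolding one_LS by (rule tm_LP[OF subalg_one[OF S] subsp_zero[OF sub]])
  fix f g assume f: "f \<in> LP S" and g: "g \<in> LP S"
  have fc: "f \<in> carrier LS" and gc: "g \<in> carrier LS" using f g LP_carrier[OF Sc] by blast+
  have fin: "finite {n. f n \<noteq> \<zero>}" "finite {n. g n \<noteq> \<zero>}" using f g by (simp_all add: LP_def)
  have fS: "f n \<in> S" "g n \<in> S" for n using f g by (simp_all add: LP_def)
  have eq: "(f \<otimes>\<^bsub>LS\<^esub> g) n = (\<Oplus>m\<in>{m. f m \<noteq> \<zero>}. f m \<otimes> s m (g (n - m)))" for n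
    by (rule LS_mult[OF fc gc fin(1)]) simp
  have "(f \<otimes>\<^bsub>LS\<^esub> g) n \<in> S" for n
    unfolding eq by (rule subsp_finsum[OF sub subalg_mult[OF S fS(1) st[OF fS(2)]]])
  moreover have "{n. (f \<otimes>\<^bsub>LS\<^esub> g) n \<noteq> \<zero>} \<subseteq> (\<lambda>(m, l). m + l) ` ({n. f n \<noteq> \<zero>} \<times> {n. g n \<noteq> \<zero>})"
  proof
    fix n assume n: "n \<in> {n. (f \<otimes>\<^bsub>LS\<^esub> g) n \<noteq> \<zero>}"
    have "\<exists>m. f m \<noteq> \<zero> \<and> g (n - m) \<noteq> \<zero>"
    proof (rule ccontr)
      assume "\<nexists>m. f m \<noteq> \<zero> \<and> g (n - m) \<noteq> \<zero>"
      then have "(f \<otimes>\<^bsub>LS\<^esub> g) n = (\<Oplus>m\<in>{}. f m \<otimes> s m (g (n - m)))"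
        by (intro LS_mult[OF fc gc]) auto
      then show False using n by simp
    qed
    then obtain m where "f m \<noteq> \<zero>" "g (n - m) \<noteq> \<zero>" by blast
    then show "n \<in> (\<lambda>(m, l). m + l) ` ({n. f n \<noteq> \<zero>} \<times> {n. g n \<noteq> \<zero>})"
      by (intro image_eqI[of _ _ "(m, n - m)"]) simp_all
  qed
  then have "finite {n. (f \<otimes>\<^bsub>LS\<^esub> g) n \<noteq> \<zero>}"
    by (rule finite_subset) (use fin in simp)
  ultimately show "f \<otimes>\<^bsub>LS\<^esub> g \<in> LP S" by (simp add: LP_def)
qed

lemma sum_of_terms:
  assumes W: "L.subsp W" and "finite S" and "\<And>n. f n \<in> carrier F" "\<And>n. n \<notin> S \<Longrightarrow> f n = \<zero>"
    "\<And>n. n \<in> S \<Longrightarrow> tm (f n) n \<in> W"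
  shows "f \<in> W"
  using assms(2-)
proof (induction S arbitrary: f rule: finite_induct)
  case empty
  then have "f = \<zero>\<^bsub>LS\<^esub>" by (auto simp: LS_simps)
  then show ?case using L.subsp_zero[OF W] by simp
next
  case (insert k S)
  have "f(k := \<zero>) \<in> W"
  proof (rule insert.IH)
    show "tm ((f(k := \<zero>)) n) n \<in> W" if "n \<in> S" for n
      using that insert.hyps insert.prems(3)[of n] by auto
  qed (use insert.prems(1,2) in auto)
  moreover have "tm (f k) k \<in> W" using insert.prems(3)[of k] by simp
  ultimately have "f(k := \<zero>) \<oplus>\<^bsub>LS\<^esub> tm (f k) k \<in> W" by (rule L.subsp_add[OF W])
  moreover have "f(k := \<zero>) \<oplus>\<^bsub>LS\<^esub> tm (f k) k = f"
    using insert.prems(1) by (auto simp: LS_simps tm_def)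
  ultimately show ?case by simp
qed

text \<open>Stability under \<open>s\<close> keeps the coefficients of products in
  \<open>Kgen S\<close>; conversely every term is a coefficient times a power of \<open>y\<close>.
  It applies both to the cluster variables and to the generators of the torus.\<close>

lemma LP_generated:
  assumes S: "S \<subseteq> carrier F" and st: "\<And>n a. a \<in> Kgen S \<Longrightarrow> s n a \<in> Kgen S"
  shows "L.Kgen ((\<lambda>a. tm a 0) ` S \<union> {tm \<one> 1, tm \<one> (-1)}) = LP (Kgen S)"
proof
  let ?G = "(\<lambda>a. tm a 0) ` S \<union> {tm \<one> 1, tm \<one> (-1)}"
  define K where "K = L.Kgen ?G"
  have A: "subalg (Kgen S)" by (rule subalg_Kgen[OF S])
  have zero: "\<zero> \<in> Kgen S" by (rule subsp_zero[OF subalg_subsp[OF A]])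
  show "L.Kgen ?G \<subseteq> LP (Kgen S)"
    using Kgen_incl[of S] subalg_one[OF A] zero
    by (intro L.Kgen_minimal subalg_LP[OF A st]) (auto intro!: tm_LP)
  have "?G \<subseteq> carrier LS" using S by auto
  then have K: "L.subalg K" unfolding K_def by (rule L.subalg_Kgen)
  note KI = subsetD[OF L.Kgen_incl[of ?G], folded K_def]
  have "subalg {a \<in> carrier F. tm a 0 \<in> K}"
  proof (rule subalgI[OF subspI])
    have add: "tm (a \<oplus> b) 0 = tm a 0 \<oplus>\<^bsub>LS\<^esub> tm b 0"
      if "a \<in> carrier F" "b \<in> carrier F" for a b using that by (auto simp: tm_def LS_simps)
    have sm: "tm (c \<odot> a) 0 = c \<odot>\<^bsub>LS\<^esub> tm a 0" for a c by (auto simp: tm_def LS_simps)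
    have mult: "tm (a \<otimes> b) 0 = tm a 0 \<otimes>\<^bsub>LS\<^esub> tm b 0" if "a \<in> carrier F" "b \<in> carrier F" for a b
      using tm_mult[OF that, of 0 0] that by simp
    show "\<zero> \<in> {a \<in> carrier F. tm a 0 \<in> K}"
      using L.subsp_zero[OF L.subalg_subsp[OF K]] by simp
    show "\<one> \<in> {a \<in> carrier F. tm a 0 \<in> K}"
      using L.subalg_one[OF K] by (simp add: one_LS)
    show "c \<odot> a \<in> {a \<in> carrier F. tm a 0 \<in> K}" if "a \<in> {a \<in> carrier F. tm a 0 \<in> K}" for c a
      using that L.subsp_sm[OF L.subalg_subsp[OF K]] by (simp add: sm)
    show "a \<oplus> b \<in> {a \<in> carrier F. tm a 0 \<in> K}"
      if "a \<in> {a \<in> carrier F. tm a 0 \<in> K}" "b \<in> {a \<in> carrier F. tm a 0 \<in> K}" for a b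
      using that L.subsp_add[OF L.subalg_subsp[OF K]] by (simp add: add)
    show "a \<otimes> b \<in> {a \<in> carrier F. tm a 0 \<in> K}"
      if "a \<in> {a \<in> carrier F. tm a 0 \<in> K}" "b \<in> {a \<in> carrier F. tm a 0 \<in> K}" for a b
      using that L.subalg_mult[OF K] by (simp add: mult)
  qed auto
  moreover have "S \<subseteq> {a \<in> carrier F. tm a 0 \<in> K}" using S KI by auto
  ultimately have tm0: "Kgen S \<subseteq> {a \<in> carrier F. tm a 0 \<in> K}" by (rule Kgen_minimal)
  have y: "tm \<one> n \<in> K" for n
  proof (induction n rule: int_induct[of _ 0])
    case base
    then show ?case using L.subalg_one[OF K] by (simp add: one_LS)
  next
    case (step1 i)
    have "tm \<one> 1 \<in> K" by (rule KI) simp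
    from L.subalg_mult[OF K step1(2) this] show ?case by (simp add: tm_mult)
  next
    case (step2 i)
    have "tm \<one> (-1) \<in> K" by (rule KI) simp
    from L.subalg_mult[OF K step2(2) this] show ?case by (simp add: tm_mult)
  qed
  show "LP (Kgen S) \<subseteq> L.Kgen ?G"
  proof
    fix f assume f: "f \<in> LP (Kgen S)"
    have "f \<in> K"
    proof (rule sum_of_terms[OF L.subalg_subsp[OF K], of "{n. f n \<noteq> \<zero>}"])
      fix n
      have fn: "f n \<in> Kgen S" using f by (simp add: LP_def)
      then show "f n \<in> carrier F" by (rule subalg_carrier[OF A])
      have "tm (f n) 0 \<otimes>\<^bsub>LS\<^esub> tm \<one> n \<in> K"
        using fn tm0 by (intro L.subalg_mult[OF K _ y]) auto
      then show "tm (f n) n \<in> K" using subalg_carrier[OF A fn] by (simp add: tm_mult)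
    qed (use f in \<open>simp_all add: LP_def\<close>)
    then show "f \<in> L.Kgen ?G" by (simp add: K_def)
  qed
qed

section \<open>The Ore condition for skew Laurent polynomials and their right fractions\<close>

abbreviation "P \<equiv> LP (carrier F)"

lemma subalg_P: "L.subalg P"
proof -
  have "subalg (carrier F)" by (auto intro!: subalgI subspI)
  then show ?thesis by (rule subalg_LP) simp
qed

lemma P_carrier: "f \<in> P \<Longrightarrow> f \<in> carrier LS"
  using LP_carrier[of "carrier F"] by blast

lemma tm_P: "a \<in> carrier F \<Longrightarrow> tm a n \<in> P"
  by (rule tm_LP) auto

text \<open>The right Ore condition, by the Euclidean algorithm: the longer of the two Laurent
  polynomials is shortened by a right multiple of the other.\<close>

lemma cancel_top:
  assumes f: "f \<in> P" and g: "g \<in> P"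
    and fa: "\<forall>n. f n \<noteq> \<zero> \<longrightarrow> a \<le> n \<and> n < a + int (Suc m)"
    and gb: "\<forall>n. g n \<noteq> \<zero> \<longrightarrow> b \<le> n \<and> n < b + int (Suc l)"
    and top: "g (b + int l) \<noteq> \<zero>" and le: "l \<le> m"
  shows "\<exists>h\<in>P. \<forall>n. (f \<ominus>\<^bsub>LS\<^esub> g \<otimes>\<^bsub>LS\<^esub> h) n \<noteq> \<zero> \<longrightarrow> a \<le> n \<and> n < a + int m"
proof -
  define t where "t = b + int l"
  \<comment> \<open>The shift that moves the top degree \<open>t\<close> of \<open>g\<close> to the
    top degree of \<open>f\<close>; \<open>c\<close> then makes the leading coefficients agree. The
    assumption \<open>l \<le> m\<close> keeps the lower end inside the window of
    \<open>f\<close>.\<close>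
  define k where "k = a + int m - t"
  have fc: "f n \<in> carrier F" "g n \<in> carrier F" for n using f g by (simp_all add: LP_def)
  have tU: "g t \<in> Units F" using fc top by (simp add: Units_iff t_def)
  define c where "c = s (- t) (inv (g t) \<otimes> f (a + int m))"
  have cc: "c \<in> carrier F" using fc tU by (simp add: c_def)
  have gh: "(g \<otimes>\<^bsub>LS\<^esub> tm c k) n = g (n - k) \<otimes> s (n - k) c" for n
    by (rule mult_tm(1)[OF P_carrier[OF g] cc])
  have ghP: "g \<otimes>\<^bsub>LS\<^esub> tm c k \<in> carrier LS"
    by (rule L.m_closed[OF P_carrier[OF g] tm_closed[OF cc]])
  have diff: "(f \<ominus>\<^bsub>LS\<^esub> g \<otimes>\<^bsub>LS\<^esub> tm c k) n = f n \<ominus> g (n - k) \<otimes> s (n - k) c" for n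
  proof -
    have "f \<ominus>\<^bsub>LS\<^esub> g \<otimes>\<^bsub>LS\<^esub> tm c k = f \<oplus>\<^bsub>LS\<^esub> (- 1) \<odot>\<^bsub>LS\<^esub> (g \<otimes>\<^bsub>LS\<^esub> tm c k)"
      unfolding a_minus_def L.sm_minus_one[OF ghP] ..
    then show ?thesis
      using fc cc by (simp add: LS_simps(4,5) gh sm_minus_one a_minus_def)
  qed
  have "s t c = inv (g t) \<otimes> f (a + int m)"
    using fc tU by (simp add: c_def)
  then have topeq: "g t \<otimes> s t c = f (a + int m)"
    using fc tU by (simp flip: m_assoc)
  have "a \<le> n \<and> n < a + int m" if n: "(f \<ominus>\<^bsub>LS\<^esub> g \<otimes>\<^bsub>LS\<^esub> tm c k) n \<noteq> \<zero>" for n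
  proof -
    have "f n \<noteq> \<zero> \<or> g (n - k) \<noteq> \<zero>" using n[unfolded diff] fc cc by (auto simp: a_minus_def)
    then have "a \<le> n \<and> n < a + int (Suc m)"
    proof
      assume "g (n - k) \<noteq> \<zero>"
      then have "b \<le> n - k \<and> n - k < b + int (Suc l)" using gb by blast
      then show ?thesis using le by (simp add: k_def t_def)
    qed (use fa in blast)
    moreover have "n \<noteq> a + int m"
    proof
      assume eq: "n = a + int m"
      then have "n - k = t" by (simp add: k_def)
      then show False using n[unfolded diff] fc eq by (simp add: topeq a_minus_def r_neg)
    qed
    ultimately show ?thesis by simp
  qed
  then show ?thesis using tm_P[OF cc] by blast
qed

lemma ore_P:
  assumes "f \<in> P" "g \<in> P" "g \<noteq> \<zero>\<^bsub>LS\<^esub>"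
  shows "\<exists>u\<in>P. \<exists>v\<in>P. u \<noteq> \<zero>\<^bsub>LS\<^esub> \<and> f \<otimes>\<^bsub>LS\<^esub> u = g \<otimes>\<^bsub>LS\<^esub> v"
proof -
  \<comment> \<open>The induction is on the total width of two half-open windows that contain the
    supports; they need not be tight, so a vanishing top coefficient simply shortens a
    window.\<close>
  have main: "\<exists>u\<in>P. \<exists>v\<in>P. u \<noteq> \<zero>\<^bsub>LS\<^esub> \<and> f \<otimes>\<^bsub>LS\<^esub> u = g \<otimes>\<^bsub>LS\<^esub> v"
    if "m + l = N" "f \<in> P" "g \<in> P" "g \<noteq> \<zero>\<^bsub>LS\<^esub>"
      "\<forall>n. f n \<noteq> \<zero> \<longrightarrow> a \<le> n \<and> n < a + int m" "\<forall>n. g n \<noteq> \<zero> \<longrightarrow> b \<le> n \<and> n < b + int l"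
    for N m l :: nat and a b :: int and f g
    using that
  proof (induction N arbitrary: m l f g)
    case 0
    then have "g = \<zero>\<^bsub>LS\<^esub>" by (force simp: LS_simps)
    then show ?case using 0 by simp
  next
    case (Suc N)
    have fc: "f \<in> carrier LS" and gc: "g \<in> carrier LS" using Suc.prems P_carrier by blast+
    have one: "\<one>\<^bsub>LS\<^esub> \<in> P" and zero: "\<zero>\<^bsub>LS\<^esub> \<in> P"
      using L.subalg_one[OF subalg_P] L.subsp_zero[OF L.subalg_subsp[OF subalg_P]] by blast+
    show ?case
    proof (cases m)
      case 0
      then have "f = \<zero>\<^bsub>LS\<^esub>" using Suc.prems(5) by (force simp: LS_simps)
      then have "f \<otimes>\<^bsub>LS\<^esub> \<one>\<^bsub>LS\<^esub> = g \<otimes>\<^bsub>LS\<^esub> \<zero>\<^bsub>LS\<^esub>" using gc by simp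
      then show ?thesis using one zero L.one_not_zero by blast
    next
      case m: (Suc m')
      show ?thesis
      proof (cases l)
        case 0
        then have "g = \<zero>\<^bsub>LS\<^esub>" using Suc.prems(6) by (force simp: LS_simps)
        then show ?thesis using Suc.prems(4) by simp
      next
        case l: (Suc l')
        consider "f (a + int m') = \<zero>" | "g (b + int l') = \<zero>"
          | "f (a + int m') \<noteq> \<zero>" "g (b + int l') \<noteq> \<zero>" "l' \<le> m'"
          | "f (a + int m') \<noteq> \<zero>" "g (b + int l') \<noteq> \<zero>" "m' \<le> l'"
          by linarith
        then show ?thesis
        proof cases
          case 1
          have w: "\<forall>n. f n \<noteq> \<zero> \<longrightarrow> a \<le> n \<and> n < a + int m'"
          proof (intro allI impI)
            fix n assume n: "f n \<noteq> \<zero>"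
            then have "a \<le> n \<and> n < a + int m" "n \<noteq> a + int m'" using Suc.prems(5) 1 by auto
            then show "a \<le> n \<and> n < a + int m'" by (simp add: m)
          qed
          show ?thesis by (rule Suc.IH[OF _ Suc.prems(2,3,4) w Suc.prems(6)]) (use Suc.prems(1) m in simp)
        next
          case 2
          have w: "\<forall>n. g n \<noteq> \<zero> \<longrightarrow> b \<le> n \<and> n < b + int l'"
          proof (intro allI impI)
            fix n assume n: "g n \<noteq> \<zero>"
            then have "b \<le> n \<and> n < b + int l" "n \<noteq> b + int l'" using Suc.prems(6) 2 by auto
            then show "b \<le> n \<and> n < b + int l'" by (simp add: l)
          qed
          show ?thesis by (rule Suc.IH[OF _ Suc.prems(2,3,4,5) w]) (use Suc.prems(1) l in simp)
        next
          case 3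
          obtain h where h: "h \<in> P"
            "\<forall>n. (f \<ominus>\<^bsub>LS\<^esub> g \<otimes>\<^bsub>LS\<^esub> h) n \<noteq> \<zero> \<longrightarrow> a \<le> n \<and> n < a + int m'"
            using cancel_top[OF Suc.prems(2,3) Suc.prems(5)[unfolded m] Suc.prems(6)[unfolded l] 3(2,3)] by blast
          have hc: "h \<in> carrier LS" by (rule P_carrier[OF h(1)])
          have f1: "f \<ominus>\<^bsub>LS\<^esub> g \<otimes>\<^bsub>LS\<^esub> h \<in> P"
            by (rule L.subsp_minus[OF L.subalg_subsp[OF subalg_P] Suc.prems(2) L.subalg_mult[OF subalg_P Suc.prems(3) h(1)]])
          obtain u v where uv: "u \<in> P" "v \<in> P" "u \<noteq> \<zero>\<^bsub>LS\<^esub>"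
            "(f \<ominus>\<^bsub>LS\<^esub> g \<otimes>\<^bsub>LS\<^esub> h) \<otimes>\<^bsub>LS\<^esub> u = g \<otimes>\<^bsub>LS\<^esub> v"
            using Suc.IH[OF _ f1 Suc.prems(3,4) h(2) Suc.prems(6)] Suc.prems(1) m by auto
          have uc: "u \<in> carrier LS" "v \<in> carrier LS" using uv P_carrier by blast+
          have "f = (f \<ominus>\<^bsub>LS\<^esub> g \<otimes>\<^bsub>LS\<^esub> h) \<oplus>\<^bsub>LS\<^esub> g \<otimes>\<^bsub>LS\<^esub> h"
            using fc gc hc by (simp add: a_minus_def L.a_assoc L.l_neg)
          then have "f \<otimes>\<^bsub>LS\<^esub> u = (f \<ominus>\<^bsub>LS\<^esub> g \<otimes>\<^bsub>LS\<^esub> h) \<otimes>\<^bsub>LS\<^esub> u \<oplus>\<^bsub>LS\<^esub> g \<otimes>\<^bsub>LS\<^esub> h \<otimes>\<^bsub>LS\<^esub> u"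
            using L.l_distr[OF L.minus_closed[OF fc L.m_closed[OF gc hc]] L.m_closed[OF gc hc] uc(1)] by simp
          also have "\<dots> = g \<otimes>\<^bsub>LS\<^esub> (v \<oplus>\<^bsub>LS\<^esub> h \<otimes>\<^bsub>LS\<^esub> u)"
            unfolding uv(4) using gc hc uc by (simp add: L.r_distr L.m_assoc)
          finally have "f \<otimes>\<^bsub>LS\<^esub> u = g \<otimes>\<^bsub>LS\<^esub> (v \<oplus>\<^bsub>LS\<^esub> h \<otimes>\<^bsub>LS\<^esub> u)" .
          moreover have "v \<oplus>\<^bsub>LS\<^esub> h \<otimes>\<^bsub>LS\<^esub> u \<in> P"
            by (rule L.subsp_add[OF L.subalg_subsp[OF subalg_P] uv(2) L.subalg_mult[OF subalg_P h(1) uv(1)]])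
          ultimately show ?thesis using uv(1,3) by blast
        next
          case 4
          obtain h where h: "h \<in> P"
            "\<forall>n. (g \<ominus>\<^bsub>LS\<^esub> f \<otimes>\<^bsub>LS\<^esub> h) n \<noteq> \<zero> \<longrightarrow> b \<le> n \<and> n < b + int l'"
            using cancel_top[OF Suc.prems(3,2) Suc.prems(6)[unfolded l] Suc.prems(5)[unfolded m] 4(1,3)] by blast
          have hc: "h \<in> carrier LS" by (rule P_carrier[OF h(1)])
          have g1: "g \<ominus>\<^bsub>LS\<^esub> f \<otimes>\<^bsub>LS\<^esub> h \<in> P"
            by (rule L.subsp_minus[OF L.subalg_subsp[OF subalg_P] Suc.prems(3) L.subalg_mult[OF subalg_P Suc.prems(2) h(1)]])
          have g_eq: "g = (g \<ominus>\<^bsub>LS\<^esub> f \<otimes>\<^bsub>LS\<^esub> h) \<oplus>\<^bsub>LS\<^esub> f \<otimes>\<^bsub>LS\<^esub> h"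
            using fc gc hc by (simp add: a_minus_def L.a_assoc L.l_neg)
          show ?thesis
          \<comment> \<open>The induction hypothesis requires a nonzero second polynomial; if the
            remainder vanishes, \<open>g\<close> is already a right multiple of
            \<open>f\<close>.\<close>
          proof (cases "g \<ominus>\<^bsub>LS\<^esub> f \<otimes>\<^bsub>LS\<^esub> h = \<zero>\<^bsub>LS\<^esub>")
            case True
            then have "f \<otimes>\<^bsub>LS\<^esub> h = g \<otimes>\<^bsub>LS\<^esub> \<one>\<^bsub>LS\<^esub>" using g_eq fc gc hc by simp
            moreover have "h \<noteq> \<zero>\<^bsub>LS\<^esub>" using calculation fc gc Suc.prems(4) by auto
            ultimately show ?thesis using h(1) one by blast
          next
            case False
            obtain u v where uv: "u \<in> P" "v \<in> P" "u \<noteq> \<zero>\<^bsub>LS\<^esub>"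
              "f \<otimes>\<^bsub>LS\<^esub> u = (g \<ominus>\<^bsub>LS\<^esub> f \<otimes>\<^bsub>LS\<^esub> h) \<otimes>\<^bsub>LS\<^esub> v"
              using Suc.IH[OF _ Suc.prems(2) g1 False Suc.prems(5) h(2)] Suc.prems(1) l by auto
            have uc: "u \<in> carrier LS" "v \<in> carrier LS" using uv P_carrier by blast+
            \<comment> \<open>Undoing the division changes the multiplier of \<open>f\<close>, whose
              being nonzero must be shown again.\<close>
            define w where "w = u \<oplus>\<^bsub>LS\<^esub> h \<otimes>\<^bsub>LS\<^esub> v"
            have wP: "w \<in> P"
              unfolding w_def
              by (rule L.subsp_add[OF L.subalg_subsp[OF subalg_P] uv(1) L.subalg_mult[OF subalg_P h(1) uv(2)]])
            have "f \<otimes>\<^bsub>LS\<^esub> w = (g \<ominus>\<^bsub>LS\<^esub> f \<otimes>\<^bsub>LS\<^esub> h) \<otimes>\<^bsub>LS\<^esub> v \<oplus>\<^bsub>LS\<^esub> f \<otimes>\<^bsub>LS\<^esub> h \<otimes>\<^bsub>LS\<^esub> v"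
              unfolding w_def uv(4)[symmetric] using fc hc uc by (simp add: L.r_distr L.m_assoc)
            also have "\<dots> = g \<otimes>\<^bsub>LS\<^esub> v"
              using L.l_distr[OF L.minus_closed[OF gc L.m_closed[OF fc hc]] L.m_closed[OF fc hc] uc(2)]
                g_eq[symmetric] by simp
            finally have eq: "f \<otimes>\<^bsub>LS\<^esub> w = g \<otimes>\<^bsub>LS\<^esub> v" .
            have "w \<noteq> \<zero>\<^bsub>LS\<^esub>"
            proof
              assume "w = \<zero>\<^bsub>LS\<^esub>"
              then have "g \<otimes>\<^bsub>LS\<^esub> v = \<zero>\<^bsub>LS\<^esub>" using eq fc by simp
              then have "v = \<zero>\<^bsub>LS\<^esub>" using L.mult_eq_zero_iff[OF gc uc(2)] Suc.prems(4) by blast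
              then have "w = u" using uc hc by (simp add: w_def)
              then show False using \<open>w = \<zero>\<^bsub>LS\<^esub>\<close> uv(3) by simp
            qed
            then show ?thesis using eq wP uv(2) by blast
          qed
        qed
      qed
    qed
  qed
  obtain a a' where a: "\<forall>n. f n \<noteq> \<zero> \<longrightarrow> a \<le> n \<and> n < a'" using finite_bound[of f] assms(1) by (auto simp: LP_def)
  obtain b b' where b: "\<forall>n. g n \<noteq> \<zero> \<longrightarrow> b \<le> n \<and> n < b'" using finite_bound[of g] assms(2) by (auto simp: LP_def)
  have "\<forall>n. f n \<noteq> \<zero> \<longrightarrow> a \<le> n \<and> n < a + int (nat (a' - a))"
    "\<forall>n. g n \<noteq> \<zero> \<longrightarrow> b \<le> n \<and> n < b + int (nat (b' - b))" using a b by fastforce+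
  from main[OF refl assms this] show ?thesis .
qed

text \<open>Right fractions of Laurent polynomials inside the series. The full series field would
  not do in general: in a seed every element of the ambient field has to be a fraction of elements
  of the torus.\<close>

definition Fr :: "(int \<Rightarrow> 'a) set" where
  "Fr = {f \<in> carrier LS. \<exists>t\<in>P. t \<noteq> \<zero>\<^bsub>LS\<^esub> \<and> f \<otimes>\<^bsub>LS\<^esub> t \<in> P}"

lemma P_subset_Fr: "P \<subseteq> Fr"
proof
  fix f assume f: "f \<in> P"
  then have "f \<otimes>\<^bsub>LS\<^esub> \<one>\<^bsub>LS\<^esub> \<in> P" using P_carrier by simp
  then show "f \<in> Fr"
    using P_carrier[OF f] L.subalg_one[OF subalg_P] L.one_not_zero unfolding Fr_def by blast
qed

text \<open>For sums the denominators get a common right multiple; for products the Ore condition is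
  applied to the numerator of the second factor and the denominator of the first.\<close>

lemma subalg_Fr: "L.subalg Fr"
proof (rule L.subalgI)
  note sub = L.subalg_subsp[OF subalg_P]
  show "\<one>\<^bsub>LS\<^esub> \<in> Fr" using P_subset_Fr L.subalg_one[OF subalg_P] by blast
  show "L.subsp Fr"
  proof (rule L.subspI)
    show "Fr \<subseteq> carrier LS" by (auto simp: Fr_def)
    show "\<zero>\<^bsub>LS\<^esub> \<in> Fr" using P_subset_Fr L.subsp_zero[OF sub] by blast
    fix f assume "f \<in> Fr"
    then obtain t where f: "f \<in> carrier LS" "t \<in> P" "t \<noteq> \<zero>\<^bsub>LS\<^esub>" "f \<otimes>\<^bsub>LS\<^esub> t \<in> P" by (auto simp: Fr_def)
    note tc = P_carrier[OF f(2)]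
    show "c \<odot>\<^bsub>LS\<^esub> f \<in> Fr" for c
    proof -
      have "(c \<odot>\<^bsub>LS\<^esub> f) \<otimes>\<^bsub>LS\<^esub> t \<in> P" using f tc L.subsp_sm[OF sub f(4)] by simp
      then show ?thesis using f unfolding Fr_def by blast
    qed
    show "f \<oplus>\<^bsub>LS\<^esub> g \<in> Fr" if "g \<in> Fr" for g
    proof -
      obtain w where g: "g \<in> carrier LS" "w \<in> P" "w \<noteq> \<zero>\<^bsub>LS\<^esub>" "g \<otimes>\<^bsub>LS\<^esub> w \<in> P"
        using \<open>g \<in> Fr\<close> by (auto simp: Fr_def)
      note wc = P_carrier[OF g(2)]
      obtain u v where uv: "u \<in> P" "v \<in> P" "u \<noteq> \<zero>\<^bsub>LS\<^esub>" "t \<otimes>\<^bsub>LS\<^esub> u = w \<otimes>\<^bsub>LS\<^esub> v"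
        using ore_P[OF f(2) g(2,3)] by blast
      have uc: "u \<in> carrier LS" "v \<in> carrier LS" using uv P_carrier by blast+
      have "(f \<oplus>\<^bsub>LS\<^esub> g) \<otimes>\<^bsub>LS\<^esub> (t \<otimes>\<^bsub>LS\<^esub> u) = f \<otimes>\<^bsub>LS\<^esub> (t \<otimes>\<^bsub>LS\<^esub> u) \<oplus>\<^bsub>LS\<^esub> g \<otimes>\<^bsub>LS\<^esub> (t \<otimes>\<^bsub>LS\<^esub> u)"
        using f(1) g(1) tc uc by (simp add: L.l_distr)
      also have "\<dots> = (f \<otimes>\<^bsub>LS\<^esub> t) \<otimes>\<^bsub>LS\<^esub> u \<oplus>\<^bsub>LS\<^esub> (g \<otimes>\<^bsub>LS\<^esub> w) \<otimes>\<^bsub>LS\<^esub> v"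
        using L.m_assoc[OF f(1) tc uc(1)] L.m_assoc[OF g(1) wc uc(2)] uv(4) by simp
      also have "\<dots> \<in> P"
        by (rule L.subsp_add[OF sub L.subalg_mult[OF subalg_P f(4) uv(1)] L.subalg_mult[OF subalg_P g(4) uv(2)]])
      finally have "(f \<oplus>\<^bsub>LS\<^esub> g) \<otimes>\<^bsub>LS\<^esub> (t \<otimes>\<^bsub>LS\<^esub> u) \<in> P" .
      moreover have "t \<otimes>\<^bsub>LS\<^esub> u \<in> P" by (rule L.subalg_mult[OF subalg_P f(2) uv(1)])
      moreover have "t \<otimes>\<^bsub>LS\<^esub> u \<noteq> \<zero>\<^bsub>LS\<^esub>" using L.mult_eq_zero_iff[OF tc uc(1)] f(3) uv(3) by blast
      ultimately show ?thesis using L.a_closed[OF f(1) g(1)] unfolding Fr_def by blast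
    qed
  qed
  fix f g assume "f \<in> Fr" "g \<in> Fr"
  then obtain t w where f: "f \<in> carrier LS" "t \<in> P" "t \<noteq> \<zero>\<^bsub>LS\<^esub>" "f \<otimes>\<^bsub>LS\<^esub> t \<in> P"
    and g: "g \<in> carrier LS" "w \<in> P" "w \<noteq> \<zero>\<^bsub>LS\<^esub>" "g \<otimes>\<^bsub>LS\<^esub> w \<in> P" by (auto simp: Fr_def)
  obtain u v where uv: "u \<in> P" "v \<in> P" "u \<noteq> \<zero>\<^bsub>LS\<^esub>" "g \<otimes>\<^bsub>LS\<^esub> w \<otimes>\<^bsub>LS\<^esub> u = t \<otimes>\<^bsub>LS\<^esub> v"
    using ore_P[OF g(4) f(2,3)] by blast
  have c: "t \<in> carrier LS" "w \<in> carrier LS" "u \<in> carrier LS" "v \<in> carrier LS"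
    using f g uv P_carrier by blast+
  have "f \<otimes>\<^bsub>LS\<^esub> g \<otimes>\<^bsub>LS\<^esub> (w \<otimes>\<^bsub>LS\<^esub> u) = f \<otimes>\<^bsub>LS\<^esub> (g \<otimes>\<^bsub>LS\<^esub> w \<otimes>\<^bsub>LS\<^esub> u)"
    using f(1) g(1) c by (simp add: L.m_assoc)
  also have "\<dots> = (f \<otimes>\<^bsub>LS\<^esub> t) \<otimes>\<^bsub>LS\<^esub> v"
    unfolding uv(4) using f(1) c by (simp add: L.m_assoc)
  also have "\<dots> \<in> P" by (rule L.subalg_mult[OF subalg_P f(4) uv(2)])
  finally have "f \<otimes>\<^bsub>LS\<^esub> g \<otimes>\<^bsub>LS\<^esub> (w \<otimes>\<^bsub>LS\<^esub> u) \<in> P" .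
  moreover have "w \<otimes>\<^bsub>LS\<^esub> u \<in> P" by (rule L.subalg_mult[OF subalg_P g(2) uv(1)])
  moreover have "w \<otimes>\<^bsub>LS\<^esub> u \<noteq> \<zero>\<^bsub>LS\<^esub>" using L.mult_eq_zero_iff[OF c(2,3)] g(3) uv(3) by blast
  ultimately show "f \<otimes>\<^bsub>LS\<^esub> g \<in> Fr" using L.m_closed[OF f(1) g(1)] unfolding Fr_def by blast
qed

lemma inv_Fr:
  assumes "f \<in> Fr" "f \<noteq> \<zero>\<^bsub>LS\<^esub>"
  shows "inv\<^bsub>LS\<^esub> f \<in> Fr"
proof -
  obtain t where f: "f \<in> carrier LS" "t \<in> P" "t \<noteq> \<zero>\<^bsub>LS\<^esub>" "f \<otimes>\<^bsub>LS\<^esub> t \<in> P" using assms by (auto simp: Fr_def)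
  note tc = P_carrier[OF f(2)]
  have fU: "f \<in> Units LS" using f(1) assms(2) by (simp add: L.Units_iff)
  have "inv\<^bsub>LS\<^esub> f \<otimes>\<^bsub>LS\<^esub> (f \<otimes>\<^bsub>LS\<^esub> t) = (inv\<^bsub>LS\<^esub> f \<otimes>\<^bsub>LS\<^esub> f) \<otimes>\<^bsub>LS\<^esub> t"
    using fU f(1) tc by (simp only: L.m_assoc L.Units_inv_closed)
  also have "\<dots> = t" using fU tc by simp
  finally have "inv\<^bsub>LS\<^esub> f \<otimes>\<^bsub>LS\<^esub> (f \<otimes>\<^bsub>LS\<^esub> t) \<in> P" using f(2) by simp
  moreover have "f \<otimes>\<^bsub>LS\<^esub> t \<noteq> \<zero>\<^bsub>LS\<^esub>" using L.mult_eq_zero_iff[OF f(1) tc] f(3) assms(2) by blast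
  ultimately show ?thesis using f(4) L.Units_inv_closed[OF fU] unfolding Fr_def by blast
qed

text \<open>Multiplying \<open>f y^n\<close> by \<open>d\<close> from the right turns the
  coefficient into \<open>f \<otimes> s n d\<close>, hence the twist in the condition.\<close>

lemma common_right_denominator:
  assumes S: "subalg S" and st: "\<And>n a. a \<in> S \<Longrightarrow> s n a \<in> S"
    and den: "\<And>f. f \<in> carrier F \<Longrightarrow> \<exists>b\<in>S. b \<noteq> \<zero> \<and> f \<otimes> b \<in> S"
    and "finite D" "\<And>n f. (n, f) \<in> D \<Longrightarrow> f \<in> carrier F"
  shows "\<exists>d\<in>S. d \<noteq> \<zero> \<and> (\<forall>(n, f)\<in>D. f \<otimes> s n d \<in> S)"
  using assms(4,5)
proof (induction D rule: finite_induct)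
  case empty
  then show ?case using subalg_one[OF S] by (intro bexI[of _ \<one>]) simp_all
next
  case (insert nf D)
  obtain n f where nf: "nf = (n, f)" by (cases nf)
  obtain d where d: "d \<in> S" "d \<noteq> \<zero>" "\<And>n f. (n, f) \<in> D \<Longrightarrow> f \<otimes> s n d \<in> S"
    using insert.IH insert.prems by blast
  have Sc: "a \<in> carrier F" if "a \<in> S" for a using subalg_carrier[OF S that] .
  have fc: "f \<in> carrier F" using insert.prems nf by blast
  have fdc: "f \<otimes> s n d \<in> carrier F" using fc Sc[OF d(1)] by simp
  obtain b where b: "b \<in> S" "b \<noteq> \<zero>" "f \<otimes> s n d \<otimes> b \<in> S" using den[OF fdc] by blast
  \<comment> \<open>Chosen so that \<open>s n e = s n d \<otimes> b\<close>; the conditions met so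
    far persist because \<open>S\<close> is stable under \<open>s\<close>.\<close>
  define e where "e = d \<otimes> s (- n) b"
  have e: "e \<in> S" unfolding e_def by (rule subalg_mult[OF S d(1) st[OF b(1)]])
  have e0: "e \<noteq> \<zero>" using d b Sc by (simp add: e_def)
  have eq: "g \<otimes> s k e = g \<otimes> s k d \<otimes> s (k - n) b" if "g \<in> carrier F" for g k
    using that Sc[OF d(1)] Sc[OF b(1)] by (simp add: e_def s_mult m_assoc)
  have "f \<otimes> s n e \<in> S" using b(3) Sc[OF b(1)] by (simp add: eq[OF fc])
  moreover have "g \<otimes> s k e \<in> S" if "(k, g) \<in> D" for k g
  proof -
    have "g \<in> carrier F" using that insert.prems by blast
    then show ?thesis using subalg_mult[OF S d(3)[OF that] st[OF b(1)]] by (simp add: eq)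
  qed
  ultimately have "\<forall>(n, f)\<in>insert nf D. f \<otimes> s n e \<in> S" by (auto simp: nf)
  then show ?case using e e0 by blast
qed

text \<open>Numerator and denominator have finitely many coefficients in total; a common right
  denominator in \<open>S\<close> brings them all into \<open>S\<close> without changing the
  fraction.\<close>

lemma Fr_fraction:
  assumes S: "subalg S" and st: "\<And>n a. a \<in> S \<Longrightarrow> s n a \<in> S"
    and den: "\<And>f. f \<in> carrier F \<Longrightarrow> \<exists>b\<in>S. b \<noteq> \<zero> \<and> f \<otimes> b \<in> S"
    and "f \<in> Fr"
  shows "\<exists>p\<in>LP S. \<exists>t\<in>LP S. t \<noteq> \<zero>\<^bsub>LS\<^esub> \<and> f = p \<otimes>\<^bsub>LS\<^esub> inv\<^bsub>LS\<^esub> t"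
proof -
  obtain t where f: "f \<in> carrier LS" "t \<in> P" "t \<noteq> \<zero>\<^bsub>LS\<^esub>" "f \<otimes>\<^bsub>LS\<^esub> t \<in> P" using assms(4) by (auto simp: Fr_def)
  define p where "p = f \<otimes>\<^bsub>LS\<^esub> t"
  have p: "p \<in> P" using f by (simp add: p_def)
  have tc: "t \<in> carrier LS" and pc: "p \<in> carrier LS" using f p P_carrier by blast+
  define D where "D = (\<lambda>n. (n, t n)) ` {n. t n \<noteq> \<zero>} \<union> (\<lambda>n. (n, p n)) ` {n. p n \<noteq> \<zero>}"
  have "finite D" using f(2) p by (simp add: D_def LP_def)
  moreover have "g \<in> carrier F" if "(n, g) \<in> D" for n g
    using that LS_coeff[OF tc] LS_coeff[OF pc] by (auto simp: D_def)
  ultimately obtain d where d: "d \<in> S" "d \<noteq> \<zero>" "\<forall>(n, f)\<in>D. f \<otimes> s n d \<in> S"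
    using common_right_denominator[OF S st den] by blast
  have dc: "d \<in> carrier F" by (rule subalg_carrier[OF S d(1)])
  have zero: "\<zero> \<in> S" by (rule subsp_zero[OF subalg_subsp[OF S]])
  have LPm: "g \<otimes>\<^bsub>LS\<^esub> tm d 0 \<in> LP S" if g: "g \<in> P" and gD: "\<And>n. g n \<noteq> \<zero> \<Longrightarrow> (n, g n) \<in> D" for g
  proof -
    have eq: "(g \<otimes>\<^bsub>LS\<^esub> tm d 0) n = g n \<otimes> s n d" for n
      using mult_tm(1)[OF P_carrier[OF g] dc, of 0 n] by simp
    have "g n \<otimes> s n d \<in> S" for n
    proof (cases "g n = \<zero>")
      case True
      then show ?thesis using zero dc by simp
    next
      case False
      then show ?thesis using d(3) gD by blast
    qed
    moreover have "g \<otimes>\<^bsub>LS\<^esub> tm d 0 \<in> P" by (rule L.subalg_mult[OF subalg_P g tm_P[OF dc]])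
    ultimately show ?thesis by (simp add: LP_def eq)
  qed
  have tmc: "tm d 0 \<in> carrier LS" "tm d 0 \<noteq> \<zero>\<^bsub>LS\<^esub>" using dc d(2) by simp_all
  define t' where "t' = t \<otimes>\<^bsub>LS\<^esub> tm d 0"
  have t': "t' \<in> carrier LS" "t' \<noteq> \<zero>\<^bsub>LS\<^esub>"
    unfolding t'_def using tc tmc L.mult_eq_zero_iff[OF tc tmc(1)] f(3) by simp_all
  have "p \<otimes>\<^bsub>LS\<^esub> tm d 0 = f \<otimes>\<^bsub>LS\<^esub> t'"
    using f(1) tc tmc by (simp add: p_def t'_def L.m_assoc)
  then have "(p \<otimes>\<^bsub>LS\<^esub> tm d 0) \<otimes>\<^bsub>LS\<^esub> inv\<^bsub>LS\<^esub> t' = f"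
    using f(1) t' by (simp add: L.m_assoc L.Units_iff)
  moreover have "p \<otimes>\<^bsub>LS\<^esub> tm d 0 \<in> LP S" by (rule LPm[OF p]) (simp add: D_def)
  moreover have "t' \<in> LP S" unfolding t'_def by (rule LPm[OF f(2)]) (simp add: D_def)
  ultimately show ?thesis using t'(2) by metis
qed

end

subsection \<open>Powers of an automorphism\<close>

text \<open>\<open>auto_pow\<close> is defined by cases on the sign of the exponent. The rules
  \<open>up\<close> and \<open>down\<close> turn it into a recursion over all integers, and the laws
  follow by induction in both directions.\<close>

lemma (in Kskew) skew_series_auto_pow:
  assumes bij: "bij_betw h (carrier F) (carrier F)"
    and add: "\<And>f g. f \<in> carrier F \<Longrightarrow> g \<in> carrier F \<Longrightarrow> h (f \<oplus> g) = h f \<oplus> h g"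
    and mult: "\<And>f g. f \<in> carrier F \<Longrightarrow> g \<in> carrier F \<Longrightarrow> h (f \<otimes> g) = h f \<otimes> h g"
    and sm: "\<And>c f. f \<in> carrier F \<Longrightarrow> h (c \<odot> f) = c \<odot> h f"
    and one: "h \<one> = \<one>"
  shows "skew_series F (auto_pow F h)"
    and "f \<in> carrier F \<Longrightarrow> auto_pow F h 1 f = h f"
proof -
  define g where "g = inv_into (carrier F) h"
  have hc: "h f \<in> carrier F" if "f \<in> carrier F" for f using bij that bij_betwE by blast
  have gc: "g f \<in> carrier F" if "f \<in> carrier F" for f
    using bij_betw_inv_into[OF bij] that bij_betwE unfolding g_def by blast
  have hg: "h (g f) = f" if "f \<in> carrier F" for f
    unfolding g_def by (rule bij_betw_inv_into_right[OF bij that])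
  have gh: "g (h f) = f" if "f \<in> carrier F" for f
    unfolding g_def by (rule bij_betw_inv_into_left[OF bij that])
  define s where "s = auto_pow F h"
  have s: "s n = (if n \<ge> 0 then h ^^ nat n else g ^^ nat (- n))" for n
    by (simp add: s_def auto_pow_def g_def)
  have pc: "(h ^^ k) f \<in> carrier F" "(g ^^ k) f \<in> carrier F" if "f \<in> carrier F" for k f
    using that by (induction k) (simp_all add: hc gc)
  have sc: "s n f \<in> carrier F" if "f \<in> carrier F" for n f
    using pc[OF that] by (simp add: s)
  have up: "s (n + 1) f = h (s n f)" if f: "f \<in> carrier F" for n f
  proof (cases "n \<ge> 0")
    case True
    then have "nat (n + 1) = Suc (nat n)" by simp
    then show ?thesis using True by (simp add: s)
  next
    case False
    define k where "k = nat (- n) - 1"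
    have k: "nat (- n) = Suc k" "n + 1 = - int k" using False by (simp_all add: k_def)
    have "s n f = g ((g ^^ k) f)" using False k(1) by (simp add: s)
    then have "h (s n f) = (g ^^ k) f" using hg[OF pc(2)[OF f]] by simp
    moreover have "s (n + 1) f = (g ^^ k) f" unfolding k(2) by (cases "k = 0") (simp_all add: s)
    ultimately show ?thesis by simp
  qed
  have down: "s (n - 1) f = g (s n f)" if f: "f \<in> carrier F" for n f
    using up[OF f, of "n - 1"] gh[OF sc[OF f, of "n - 1"]] by simp
  have s0: "s 0 f = f" for f by (simp add: s)
  have ind: "Q n" if "Q 0" "\<And>n. Q n \<Longrightarrow> Q (n + 1)" "\<And>n. Q n \<Longrightarrow> Q (n - 1)" for Q :: "int \<Rightarrow> bool" and n
    by (rule int_induct[of Q 0]) (use that in blast)+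
  have g_hom: "g (f \<oplus> f') = g f \<oplus> g f'" "g (f \<otimes> f') = g f \<otimes> g f'"
    if "f \<in> carrier F" "f' \<in> carrier F" for f f'
  proof -
    have "f \<oplus> f' = h (g f \<oplus> g f')" "f \<otimes> f' = h (g f \<otimes> g f')"
      using that by (simp_all add: add mult gc hg)
    then show "g (f \<oplus> f') = g f \<oplus> g f'" "g (f \<otimes> f') = g f \<otimes> g f'"
      using that by (simp_all add: gh gc)
  qed
  have g_sm: "g (c \<odot> f) = c \<odot> g f" if "f \<in> carrier F" for c f
  proof -
    have "c \<odot> f = h (c \<odot> g f)" using that by (simp add: sm gc hg)
    then show ?thesis using that by (simp add: gh gc)
  qed
  have g_one: "g \<one> = \<one>" using gh[of \<one>] one by simp
  have "skew_series F s"
  proof unfold_locales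
    fix f m n assume f: "f \<in> carrier F"
    show "s n f \<in> carrier F" by (rule sc[OF f])
    show "s 0 f = f" by (rule s0)
    show "s n (c \<odot> f) = c \<odot> s n f" for c
    proof (induction n rule: ind)
      case 1 show ?case by (simp add: s0)
    next
      case (2 n) then show ?case using f by (simp add: up sm sc)
    next
      case (3 n) then show ?case using f by (simp add: down g_sm sc)
    qed
    show "s m (s n f) = s (m + n) f"
    proof (induction m rule: ind)
      case 1 show ?case by (simp add: s0)
    next
      case (2 m)
      have eq: "m + 1 + n = (m + n) + 1" by simp
      show ?case unfolding eq up[OF sc[OF f]] up[OF f] 2 ..
    next
      case (3 m)
      have eq: "m - 1 + n = (m + n) - 1" by simp
      show ?case unfolding eq down[OF sc[OF f]] down[OF f] 3 ..
    qed
    fix f' assume f': "f' \<in> carrier F"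
    show "s n (f \<oplus> f') = s n f \<oplus> s n f'"
    proof (induction n rule: ind)
      case 1 show ?case by (simp add: s0)
    next
      case (2 n) then show ?case using f f' by (simp add: up add sc)
    next
      case (3 n) then show ?case using f f' by (simp add: down g_hom sc)
    qed
    show "s n (f \<otimes> f') = s n f \<otimes> s n f'"
    proof (induction n rule: ind)
      case 1 show ?case by (simp add: s0)
    next
      case (2 n) then show ?case using f f' by (simp add: up mult sc)
    next
      case (3 n) then show ?case using f f' by (simp add: down g_hom sc)
    qed
  next
    fix n
    show "s n \<one> = \<one>"
    proof (induction n rule: ind)
      case 1 show ?case by (simp add: s0)
    next
      case (2 n) then show ?case by (simp add: up one)
    next
      case (3 n) then show ?case by (simp add: down g_one)
    qed
  qed
  then show "skew_series F (auto_pow F h)" by (simp add: s_def)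
  show "auto_pow F h 1 f = h f" if "f \<in> carrier F" using up[OF that, of 0] s0[of f] by (simp add: s_def)
qed

context fraction_auto
begin

text \<open>Negative powers invert relative to different carriers; the two inverses agree on
  \<open>A\<close> because \<open>hat\<close> extends \<open>\<sigma>\<close> and is injective on
  \<open>carrier F\<close>.\<close>

lemma auto_pow_restrict:
  assumes carr: "carrier A' = A" and a: "a \<in> A"
  shows "auto_pow A' \<sigma> n a = auto_pow F hat n a" and "auto_pow F hat n a \<in> A"
proof -
  define g where "g = inv_into (carrier F) hat"
  define g' where "g' = inv_into A \<sigma>"
  have g'A: "g' b \<in> A" "\<sigma> (g' b) = b" if "b \<in> A" for b
    using bij_betw_inv_into[OF \<sigma>_bij] bij_betwE bij_betw_inv_into_right[OF \<sigma>_bij that] that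
    unfolding g'_def by blast+
  have g: "g b = g' b" if "b \<in> A" for b
  proof -
    have "hat (g' b) = b" using hat_A[OF g'A(1)[OF that]] g'A(2)[OF that] by simp
    then show ?thesis
      using bij_betw_inv_into_left[OF hat_bij Ac[OF g'A(1)[OF that]]] unfolding g_def by simp
  qed
  have "(\<sigma> ^^ k) a = (hat ^^ k) a \<and> (hat ^^ k) a \<in> A" for k
    by (induction k) (simp_all add: a hat_A \<sigma>A)
  moreover have "(g' ^^ k) a = (g ^^ k) a \<and> (g ^^ k) a \<in> A" for k
    by (induction k) (simp_all add: a g g'A)
  ultimately show "auto_pow A' \<sigma> n a = auto_pow F hat n a" and "auto_pow F hat n a \<in> A"
    unfolding auto_pow_def carr g_def[symmetric] g'_def[symmetric] by simp_all
qed

end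

sublocale fraction_auto \<subseteq> skew_series F "auto_pow F hat"
  by (rule skew_series_auto_pow[OF hat_bij hat_add hat_mult hat_sm hat_one])

lemma (in fraction_auto) auto_pow_one: "f \<in> carrier F \<Longrightarrow> auto_pow F hat 1 f = hat f"
  by (rule skew_series_auto_pow(2)[OF hat_bij hat_add hat_mult hat_sm hat_one])

subsection \<open>Restriction to subalgebras\<close>

context Kskew
begin

lemma finsum_subalg:
  assumes V: "subalg V" and f: "f \<in> S \<rightarrow> V"
  shows "finsum (F\<lparr>carrier := V\<rparr>) f S = finsum F f S"
proof -
  interpret G: Kalg "F\<lparr>carrier := V\<rparr>" by unfold_locales (rule K_algebra_subalg[OF V])
  have Vc: "v \<in> carrier F" if "v \<in> V" for v using subalg_carrier[OF V that] .
  show ?thesis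
    using f
  proof (induction S rule: infinite_finite_induct)
    case (infinite S)
    then show ?case by (simp add: G.finsum_infinite finsum_infinite)
  next
    case (insert i S)
    have fS: "f \<in> S \<rightarrow> V" "f i \<in> V" using insert.prems by auto
    have "finsum (F\<lparr>carrier := V\<rparr>) f (insert i S) = f i \<oplus> finsum (F\<lparr>carrier := V\<rparr>) f S"
      using G.finsum_insert[OF insert.hyps, of f] fS by simp
    moreover have "finsum F f (insert i S) = f i \<oplus> finsum F f S"
      using fS Vc by (intro finsum_insert[OF insert.hyps]) auto
    ultimately show ?case using insert.IH[OF fS(1)] by simp
  qed simp
qed

lemma Kgen_subalg:
  assumes V: "subalg V" and S: "S \<subseteq> V"
  shows "carrier (K_subalgebra_gen (F\<lparr>carrier := V\<rparr>) S) = Kgen S"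
proof -
  interpret G: Kalg "F\<lparr>carrier := V\<rparr>" by unfold_locales (rule K_algebra_subalg[OF V])
  have Vc: "V \<subseteq> carrier F" using subalg_carrier[OF V] by blast
  have iff: "G.subalg W \<longleftrightarrow> subalg W" if "W \<subseteq> V" for W
    using that Vc unfolding G.subalg_def G.subsp_def subalg_def subsp_def by simp blast
  have "subalg (Kgen S)" using S Vc by (intro subalg_Kgen) blast
  moreover have "Kgen S \<subseteq> V" by (rule Kgen_minimal[OF V S])
  ultimately have "G.Kgen S \<subseteq> Kgen S"
    by (intro G.Kgen_minimal Kgen_incl) (simp add: iff)
  moreover have GS: "G.subalg (G.Kgen S)" using S by (intro G.subalg_Kgen) simp
  have "G.Kgen S \<subseteq> V" using G.subalg_carrier[OF GS] by auto
  then have "Kgen S \<subseteq> G.Kgen S"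
    using GS by (intro Kgen_minimal G.Kgen_incl) (simp add: iff)
  ultimately show ?thesis unfolding G.carrier_K_subalgebra_gen by blast
qed

end

context skew_series
begin

lemma tm_sm: "a \<in> carrier F \<Longrightarrow> c \<odot>\<^bsub>LS\<^esub> tm a n = tm (c \<odot> a) n"
  by (auto simp: tm_def LS_simps)

lemma tm_add: "a \<in> carrier F \<Longrightarrow> b \<in> carrier F \<Longrightarrow> tm a n \<oplus>\<^bsub>LS\<^esub> tm b n = tm (a \<oplus> b) n"
  by (auto simp: tm_def LS_simps)

lemma tm_Units: "a \<in> Units F \<Longrightarrow> tm a n \<in> Units LS"
  by (simp add: L.Units_iff Units_iff)

text \<open>The inverse is \<open>y^(- n)\<close> times \<open>inv a\<close>, with
  \<open>y^(- n)\<close> moved to the right.\<close>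

lemma inv_tm:
  assumes a: "a \<in> Units F"
  shows "inv\<^bsub>LS\<^esub> (tm a n) = tm (s (- n) (inv a)) (- n)"
proof (rule L.inv_unique'[symmetric])
  show "tm a n \<otimes>\<^bsub>LS\<^esub> tm (s (- n) (inv a)) (- n) = \<one>\<^bsub>LS\<^esub>"
    using a by (simp add: tm_mult one_LS)
  have "s (- n) (inv a) \<otimes> s (- n) a = s (- n) (inv a \<otimes> a)"
    by (rule s_mult[symmetric]) (use a in simp_all)
  then show "tm (s (- n) (inv a)) (- n) \<otimes>\<^bsub>LS\<^esub> tm a n = \<one>\<^bsub>LS\<^esub>"
    using a by (simp add: tm_mult one_LS)
qed (use a in simp_all)

text \<open>The witness for \<open>F'\<close> in the theorem.\<close>

abbreviation FF :: "(qfield, int \<Rightarrow> 'a) module" where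
  "FF \<equiv> LS\<lparr>carrier := Fr\<rparr>"

lemma Kskew_FF: "Kskew FF"
  and inv_FF: "f \<in> Fr \<Longrightarrow> f \<noteq> \<zero>\<^bsub>LS\<^esub> \<Longrightarrow> inv\<^bsub>FF\<^esub> f = inv\<^bsub>LS\<^esub> f"
  by (rule L.Kskew_subalg[OF subalg_Fr inv_Fr]; assumption)+

end

sublocale skew_series \<subseteq> FF: Kskew FF
  by (rule Kskew_FF)

context skew_series
begin

lemma tm_Fr: "a \<in> carrier F \<Longrightarrow> tm a n \<in> Fr"
  using tm_P P_subset_Fr by blast

lemma tm_Units_FF: "a \<in> Units F \<Longrightarrow> tm a n \<in> Units FF"
  using tm_Fr[of a n] tm_Units[of a n] by (simp add: FF.Units_iff L.Units_iff)

lemma inv_FF_tm: "a \<in> Units F \<Longrightarrow> inv\<^bsub>FF\<^esub> (tm a n) = tm (s (- n) (inv a)) (- n)"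
  using inv_FF[OF tm_Fr, of a n] inv_tm[of a n] by (simp add: Units_iff)

lemma ipow_tm_0:
  assumes a: "a \<in> Units F"
  shows "tm a 0 [^]\<^bsub>FF\<^esub> (n::int) = tm (a [^] n) 0"
proof (induction n rule: int_induct[of _ 0])
  case base
  then show ?case by (simp add: one_LS)
next
  case (step1 i)
  then show ?case
    using a FF.ipow_add[OF tm_Units_FF[OF a], of 0 i 1] FF.ipow_one[OF tm_Units_FF[OF a], of 0]
    by (simp add: tm_mult ipow_add)
next
  case (step2 i)
  then show ?case
    using a FF.ipow_add[OF tm_Units_FF[OF a], of 0 i "-1"] FF.ipow_minus_one[OF tm_Units_FF[OF a], of 0]
      ipow_add[OF a, of i "-1"]
    by (simp add: tm_mult inv_FF_tm)
qed

lemma ipow_tm_one: "tm \<one> k [^]\<^bsub>FF\<^esub> (n::int) = tm \<one> (k * n)"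
proof (induction n rule: int_induct[of _ 0])
  case base
  then show ?case by (simp add: one_LS)
next
  case (step1 i)
  then show ?case
    using FF.ipow_add[OF tm_Units_FF[OF Units_one_closed], of k i 1]
      FF.ipow_one[OF tm_Units_FF[OF Units_one_closed], of k]
    by (simp add: tm_mult distrib_left)
next
  case (step2 i)
  then show ?case
    using FF.ipow_add[OF tm_Units_FF[OF Units_one_closed], of k i "-1"]
      FF.ipow_minus_one[OF tm_Units_FF[OF Units_one_closed], of k]
    by (simp add: tm_mult inv_FF_tm right_diff_distrib)
qed

lemma om_tm:
  assumes "\<And>i. i < r \<Longrightarrow> y i = tm (x i) 0" "\<And>i. i < r \<Longrightarrow> x i \<in> Units F"
  shows "ordered_monomial FF r y a = tm (ordered_monomial F r x a) 0"
  using assms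
proof (induction r)
  case 0
  show ?case by (simp add: one_LS)
next
  case (Suc r)
  have y: "y i \<in> Units FF" if "i < Suc r" for i
    unfolding Suc.prems(1)[OF that] by (rule tm_Units_FF[OF Suc.prems(2)[OF that]])
  have IH: "ordered_monomial FF r y a = tm (ordered_monomial F r x a) 0"
    by (rule Suc.IH) (use Suc.prems in simp_all)
  have p: "y r [^]\<^bsub>FF\<^esub> a r = tm (x r [^] a r) 0"
    using Suc.prems(1)[of r] ipow_tm_0[OF Suc.prems(2)[of r]] by simp
  have c: "ordered_monomial F r x a \<in> carrier F" "x r [^] a r \<in> carrier F"
    using om_Units[of r x a] Suc.prems(2) by simp_all
  have "ordered_monomial FF (Suc r) y a = ordered_monomial FF r y a \<otimes>\<^bsub>FF\<^esub> y r [^]\<^bsub>FF\<^esub> a r"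
    by (rule FF.om_Suc) (rule y)
  moreover have "ordered_monomial F (Suc r) x a = ordered_monomial F r x a \<otimes> x r [^] a r"
    by (rule om_Suc) (rule Suc.prems(2))
  ultimately show ?case
    unfolding IH p using tm_mult[OF c, of 0 0] c by simp
qed

lemma finsum_FF:
  assumes "\<And>i. i \<in> S \<Longrightarrow> f i \<in> Fr"
  shows "finsum FF f S n = (\<Oplus>i\<in>S. f i n)"
  using assms
proof (induction S rule: infinite_finite_induct)
  case (infinite S)
  then show ?case by (simp add: FF.finsum_infinite finsum_infinite LS_simps)
next
  case empty
  then show ?case by (simp add: LS_simps)
next
  case (insert i S)
  have Frc: "g k \<in> carrier F" if "g \<in> Fr" for g k using that LS_coeff by (auto simp: Fr_def)
  have "finsum FF f (insert i S) = f i \<oplus>\<^bsub>LS\<^esub> finsum FF f S"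
    using FF.finsum_insert[OF insert.hyps, of f] insert.prems by simp
  then have "finsum FF f (insert i S) n = f i n \<oplus> finsum FF f S n" by (simp add: LS_simps(4))
  also have "\<dots> = f i n \<oplus> (\<Oplus>i\<in>S. f i n)" using insert by simp
  also have "\<dots> = (\<Oplus>i\<in>insert i S. f i n)"
    using insert.prems Frc by (intro finsum_insert[OF insert.hyps, symmetric]) auto
  finally show ?case .
qed

end

subsection \<open>Mutation of the extended data\<close>

lemma ext_B_eq: "i < r \<Longrightarrow> j < r \<Longrightarrow> ext_B r B i j = B i j"
  and ext_B_zero: "r \<le> i \<or> r \<le> j \<Longrightarrow> ext_B r B i j = 0"
  by (auto simp: ext_B_def)

lemma sum_plus_2: "(\<Sum>i<r + 2. f i) = (\<Sum>i<r. f i) + (f r + f (r + 1))" for f :: "nat \<Rightarrow> int"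
  by (simp add: numeral_2_eq_2)

lemma mut_B_ext:
  assumes mut: "mut \<subseteq> {..<r}" and k: "k \<in> mut"
  shows "mut_B (r + 2) mut k (ext_B r B) = ext_B r (mut_B r mut k B)"
proof (intro ext)
  fix i j
  have kr: "k < r" using assms by auto
  show "mut_B (r + 2) mut k (ext_B r B) i j = ext_B r (mut_B r mut k B) i j"
  proof (cases "i < r \<and> j < r")
    case True
    have "mut_E (ext_B r B) k l s = mut_E B k l s" if "l < r" for l s
      using that kr by (simp add: mut_E_def ext_B_eq)
    then show ?thesis
      using True by (simp add: mut_B_def ext_B_eq ext_B_zero sum_plus_2)
  next
    case False
    have E: "mut_E (ext_B r B) k l t = (if l = t then 1 else 0)" if "l \<ge> r" for l t
      using that kr by (simp add: mut_E_def ext_B_zero)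
    have "mut_E (ext_B r B) k i s * ext_B r B s t * mut_E (ext_B r B) k j t = 0" for s t
      using False E[of i s] E[of j t] by (cases "i < r") (auto simp: ext_B_zero)
    then have "(\<Sum>s<r + 2. \<Sum>t<r + 2. mut_E (ext_B r B) k i s * ext_B r B s t * mut_E (ext_B r B) k j t) = 0"
      by (intro sum.neutral ballI)
    then have "mut_B (r + 2) mut k (ext_B r B) i j = 0" by (simp only: mut_B_def if_cancel)
    then show ?thesis using False by (auto simp: ext_B_def)
  qed
qed

text \<open>The exponents recorded for \<open>y\<close> transform by the columns of
  \<open>mut_E\<close>, so the mutated matrix is again of extended form, with a new vector in place
  of \<open>c\<close>.\<close>

lemma mut_L_ext:
  assumes kr: "k < r"
  shows "mut_L (r + 2) k (ext_B r B) (ext_L r L c) =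
    ext_L r (mut_L r k B L) (\<lambda>j. \<Sum>t<r. c t * mut_E B k t j)"
proof (intro ext)
  fix i j
  define E where "E = mut_E (ext_B r B) k"
  have E1: "E s i = mut_E B k s i" if "s < r" for s i
    using that kr by (simp add: E_def mut_E_def ext_B_eq)
  have E2: "E s i = (if i = s then 1 else 0)" if "s \<ge> r" for s i
    using that kr by (simp add: E_def mut_E_def ext_B_zero)
  have E3: "mut_E B k s i = 0" if "i \<ge> r" "s < r" for s i
    using that kr by (simp add: mut_E_def)
  have sum: "(\<Sum>s<r + 2. E s i * w s) =
      (if i < r then \<Sum>s<r. mut_E B k s i * w s else if i < r + 2 then w i else 0)" for i w
  proof -
    have "(\<Sum>s<r + 2. E s i * w s) = (\<Sum>s<r. mut_E B k s i * w s) + (E r i * w r + E (r + 1) i * w (r + 1))"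
      unfolding sum_plus_2 by (simp add: E1)
    moreover have "(\<Sum>s<r. mut_E B k s i * w s) = 0" if "i \<ge> r"
      using that by (simp add: E3)
    moreover have "i < r \<or> i = r \<or> i = r + 1 \<or> i \<ge> r + 2" by linarith
    ultimately show ?thesis by (elim disjE) (simp_all add: E2)
  qed
  have "mut_L (r + 2) k (ext_B r B) (ext_L r L c) i j =
      (\<Sum>s<r + 2. E s i * (\<Sum>t<r + 2. E t j * ext_L r L c s t))"
    unfolding mut_L_def E_def sum_distrib_left by (intro sum.cong refl) (simp add: ac_simps)
  also have "\<dots> = ext_L r (mut_L r k B L) (\<lambda>j. \<Sum>t<r. c t * mut_E B k t j) i j"
    unfolding sum
    by (auto simp: ext_L_def mut_L_def sum_distrib_left sum_negf ac_simps)
  finally show "mut_L (r + 2) k (ext_B r B) (ext_L r L c) i j =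
      ext_L r (mut_L r k B L) (\<lambda>j. \<Sum>t<r. c t * mut_E B k t j) i j" .
qed

section \<open>Monomials and mutated variables of the extended tuple\<close>

context skew_series
begin

definition ext_tm :: "nat \<Rightarrow> (nat \<Rightarrow> 'a) \<Rightarrow> nat \<Rightarrow> int \<Rightarrow> 'a" where
  "ext_tm r x i = (if i < r then tm (x i) 0 else if i = r then tm \<one> 1 else tm \<one> (-1))"

text \<open>As \<open>y\<close> and its inverse are both listed, only the difference of their
  exponents survives; this is the dependence on account of which index \<open>r + 1\<close> is
  omitted from the independence condition.\<close>

lemma om_ext_tm:
  assumes x: "\<And>i. i < r \<Longrightarrow> x i \<in> Units F"
  shows "ordered_monomial FF (r + 2) (ext_tm r x) a = tm (ordered_monomial F r x a) (a r - a (r + 1))"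
proof -
  have y: "ext_tm r x i \<in> Units FF" if "i < r + 2" for i
    using x by (simp add: ext_tm_def tm_Units_FF)
  have c: "ordered_monomial F r x a \<in> carrier F" using om_Units[of r x a] x by simp
  have "ordered_monomial FF (Suc (Suc r)) (ext_tm r x) a =
      ordered_monomial FF (Suc r) (ext_tm r x) a \<otimes>\<^bsub>FF\<^esub> ext_tm r x (Suc r) [^]\<^bsub>FF\<^esub> a (Suc r)"
    by (rule FF.om_Suc) (use y in simp)
  also have "ordered_monomial FF (Suc r) (ext_tm r x) a =
      ordered_monomial FF r (ext_tm r x) a \<otimes>\<^bsub>FF\<^esub> ext_tm r x r [^]\<^bsub>FF\<^esub> a r"
    by (rule FF.om_Suc) (use y in simp)
  also have "ordered_monomial FF r (ext_tm r x) a = tm (ordered_monomial F r x a) 0"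
    by (rule om_tm) (use x in \<open>simp_all add: ext_tm_def\<close>)
  finally have *: "ordered_monomial FF (Suc (Suc r)) (ext_tm r x) a = tm (ordered_monomial F r x a) 0 \<otimes>\<^bsub>FF\<^esub>
      ext_tm r x r [^]\<^bsub>FF\<^esub> a r \<otimes>\<^bsub>FF\<^esub> ext_tm r x (Suc r) [^]\<^bsub>FF\<^esub> a (Suc r)" .
  have e: "ext_tm r x r = tm \<one> 1" "ext_tm r x (Suc r) = tm \<one> (-1)" "r + 2 = Suc (Suc r)"
    by (simp_all add: ext_tm_def)
  show ?thesis
    unfolding e(3) * e(1,2) using c by (simp add: ipow_tm_one tm_mult)
qed

lemma nm_ext_tm:
  assumes x: "\<And>i. i < r \<Longrightarrow> x i \<in> Units F"
    and a: "a r = 0" "a (r + 1) = 0" and b: "\<And>i. i < r \<Longrightarrow> a i = b i"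
  shows "normalised_monomial FF (r + 2) (ext_tm r x) (ext_L r N c) a = tm (normalised_monomial F r x N b) 0"
proof -
  have "(\<Sum>j<r + 2. \<Sum>i<j. a i * a j * ext_L r N c j i) = (\<Sum>j<r. \<Sum>i<j. a i * a j * ext_L r N c j i)"
    unfolding sum_plus_2 using a by simp
  also have "\<dots> = (\<Sum>j<r. \<Sum>i<j. b i * b j * N j i)"
    by (intro sum.cong refl) (simp add: ext_L_def b)
  finally have e: "(\<Sum>j<r + 2. \<Sum>i<j. a i * a j * ext_L r N c j i) = (\<Sum>j<r. \<Sum>i<j. b i * b j * N j i)" .
  have om: "ordered_monomial F r x a = ordered_monomial F r x b" by (rule om_cong) (simp_all add: b)
  have c: "ordered_monomial F r x b \<in> carrier F" using om_Units[of r x b] x by simp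
  have "ordered_monomial FF (r + 2) (ext_tm r x) a = tm (ordered_monomial F r x b) 0"
    using om_ext_tm[OF x, where a = a] a om by simp
  then show ?thesis
    unfolding normalised_monomial_def e using tm_sm[OF c] by simp
qed

lemma mut_X_ext:
  assumes x: "\<And>i. i < r \<Longrightarrow> x i \<in> Units F" and k: "k < r"
  shows "mut_X FF (r + 2) k (ext_tm r x) (ext_B r B) (ext_L r N c) = ext_tm r (mut_X F r k x B N)"
proof -
  have nm: "normalised_monomial F r x N a \<in> carrier F" for a
    unfolding normalised_monomial_def using om_Units[of r x a] x by simp
  have "normalised_monomial FF (r + 2) (ext_tm r x) (ext_L r N c) (b_plus (ext_B r B) k) =
      tm (normalised_monomial F r x N (b_plus B k)) 0"
    by (rule nm_ext_tm[OF x]) (use k in \<open>simp_all add: b_plus_def ext_B_def\<close>)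
  moreover have "normalised_monomial FF (r + 2) (ext_tm r x) (ext_L r N c) (b_minus (ext_B r B) k) =
      tm (normalised_monomial F r x N (b_minus B k)) 0"
    by (rule nm_ext_tm[OF x]) (use k in \<open>simp_all add: b_minus_def ext_B_def\<close>)
  ultimately have "mut_X FF (r + 2) k (ext_tm r x) (ext_B r B) (ext_L r N c) =
      (ext_tm r x)(k := tm (normalised_monomial F r x N (b_plus B k) \<oplus> normalised_monomial F r x N (b_minus B k)) 0)"
    using tm_add[OF nm nm] by (simp add: mut_X_def)
  also have "\<dots> = ext_tm r (mut_X F r k x B N)"
    using k by (auto simp: mut_X_def ext_tm_def)
  finally show ?thesis .
qed

end

locale seed_series = preseed F r mut x B L d + skew_series F s
  for F :: "(qfield, 'a) module" (structure) and r mut x B L d s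
begin

text \<open>The vector of exponents of \<open>y\<close> changes with each mutation, hence the
  existential quantifier.\<close>

lemma mutation_class_ext:
  "(Y, C, N) \<in> mutation_class F r mut x B L \<Longrightarrow>
    \<exists>c'. (ext_tm r Y, ext_B r C, ext_L r N c') \<in> mutation_class FF (r + 2) mut (ext_tm r x) (ext_B r B) (ext_L r L c)"
proof (induction rule: mutation_class.induct)
  case initial
  show ?case using mutation_class.initial by blast
next
  case (mutate Y C N k)
  then obtain c' where c': "(ext_tm r Y, ext_B r C, ext_L r N c') \<in>
      mutation_class FF (r + 2) mut (ext_tm r x) (ext_B r B) (ext_L r L c)" by blast
  interpret S: preseed F r mut Y C N d using mutation_class_U[OF mutate.hyps(1)] by blast
  have kr: "k < r" by (rule mut_less[OF mutate.hyps(2)])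
  have ms: "mut \<subseteq> {..<r}" using mut_less by blast
  have mut_X: "mut_X FF (r + 2) k (ext_tm r Y) (ext_B r C) (ext_L r N c') = ext_tm r (mut_X F r k Y C N)"
    by (rule mut_X_ext[OF _ kr]) (rule S.x_Units)
  from mutation_class.mutate[OF c' mutate.hyps(2)] show ?case
    unfolding mut_X mut_B_ext[OF ms mutate.hyps(2)] mut_L_ext[OF kr] by blast
qed

lemma mutation_class_ext_inv:
  "(Y', C', N') \<in> mutation_class FF (r + 2) mut (ext_tm r x) (ext_B r B) (ext_L r L c) \<Longrightarrow>
    \<exists>Y C N c'. (Y, C, N) \<in> mutation_class F r mut x B L \<and> Y' = ext_tm r Y \<and> C' = ext_B r C \<and> N' = ext_L r N c'"
proof (induction rule: mutation_class.induct)
  case initial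
  show ?case using mutation_class.initial by blast
next
  case (mutate Y' C' N' k)
  then obtain Y C N c' where Y: "(Y, C, N) \<in> mutation_class F r mut x B L"
    "Y' = ext_tm r Y" "C' = ext_B r C" "N' = ext_L r N c'" by blast
  interpret S: preseed F r mut Y C N d using mutation_class_U[OF Y(1)] by blast
  have kr: "k < r" by (rule mut_less[OF mutate.hyps(2)])
  have ms: "mut \<subseteq> {..<r}" using mut_less by blast
  have mut_X: "mut_X FF (r + 2) k (ext_tm r Y) (ext_B r C) (ext_L r N c') = ext_tm r (mut_X F r k Y C N)"
    by (rule mut_X_ext[OF _ kr]) (rule S.x_Units)
  show ?case
    unfolding Y(2-4) mut_X mut_B_ext[OF ms mutate.hyps(2)] mut_L_ext[OF kr]
    using mutation_class.mutate[OF Y(1) mutate.hyps(2)] by blast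
qed

lemma cluster_variables_ext:
  "quantum_cluster_variables FF (r + 2) mut (ext_tm r x) (ext_B r B) (ext_L r L c) =
    (\<lambda>a. tm a 0) ` quantum_cluster_variables F r mut x B L \<union> {tm \<one> 1, tm \<one> (-1)}"
  (is "?lhs = ?rhs")
proof
  show "?lhs \<subseteq> ?rhs"
  proof
    fix v assume "v \<in> ?lhs"
    then obtain Y' C' N' i where v: "(Y', C', N') \<in>
        mutation_class FF (r + 2) mut (ext_tm r x) (ext_B r B) (ext_L r L c)" "i < r + 2" "v = Y' i"
      unfolding quantum_cluster_variables_def by blast
    then obtain Y C N where Y: "(Y, C, N) \<in> mutation_class F r mut x B L" "Y' = ext_tm r Y"
      using mutation_class_ext_inv by blast
    show "v \<in> ?rhs"
    proof (cases "i < r")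
      case True
      then have "Y i \<in> quantum_cluster_variables F r mut x B L"
        unfolding quantum_cluster_variables_def using Y(1) by blast
      then show ?thesis using True v(3) Y(2) by (simp add: ext_tm_def)
    next
      case False
      then show ?thesis using v(3) Y(2) by (simp add: ext_tm_def)
    qed
  qed
  show "?rhs \<subseteq> ?lhs"
  proof
    fix v assume "v \<in> ?rhs"
    then consider a where "a \<in> quantum_cluster_variables F r mut x B L" "v = tm a 0"
      | "v = ext_tm r x r" | "v = ext_tm r x (r + 1)" by (auto simp: ext_tm_def)
    then show "v \<in> ?lhs"
    proof cases
      case 1
      then obtain Y C N i where Y: "(Y, C, N) \<in> mutation_class F r mut x B L" "i < r" "a = Y i"
        unfolding quantum_cluster_variables_def by blast
      obtain c' where "(ext_tm r Y, ext_B r C, ext_L r N c') \<in>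
          mutation_class FF (r + 2) mut (ext_tm r x) (ext_B r B) (ext_L r L c)"
        using mutation_class_ext[OF Y(1)] by blast
      moreover have "v = ext_tm r Y i" "i < r + 2" using 1(2) Y(2,3) by (simp_all add: ext_tm_def)
      ultimately show ?thesis unfolding quantum_cluster_variables_def by blast
    next
      case 2
      moreover have "r < r + 2" by simp
      ultimately show ?thesis unfolding quantum_cluster_variables_def using mutation_class.initial by blast
    next
      case 3
      moreover have "r + 1 < r + 2" by simp
      ultimately show ?thesis unfolding quantum_cluster_variables_def using mutation_class.initial by blast
    qed
  qed
qed

lemma cluster_algebra_ext:
  assumes st: "\<And>n a. a \<in> carrier (quantum_cluster_algebra F r mut x B L) \<Longrightarrow>
    s n a \<in> carrier (quantum_cluster_algebra F r mut x B L)"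
  shows "carrier (quantum_cluster_algebra FF (r + 2) mut (ext_tm r x) (ext_B r B) (ext_L r L c)) =
    LP (carrier (quantum_cluster_algebra F r mut x B L))"
proof -
  define Q where "Q = quantum_cluster_variables F r mut x B L"
  have A: "carrier (quantum_cluster_algebra F r mut x B L) = Kgen Q"
    unfolding quantum_cluster_algebra_def carrier_K_subalgebra_gen Q_def ..
  have Q: "Q \<subseteq> carrier F"
    using subalg_carrier[OF subalg_cluster_algebra] Kgen_incl[of Q] unfolding A by blast
  have "(\<lambda>a. tm a 0) ` Q \<union> {tm \<one> 1, tm \<one> (-1)} \<subseteq> Fr"
    using Q by (auto intro!: tm_Fr)
  then have "carrier (K_subalgebra_gen FF ((\<lambda>a. tm a 0) ` Q \<union> {tm \<one> 1, tm \<one> (-1)})) =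
      L.Kgen ((\<lambda>a. tm a 0) ` Q \<union> {tm \<one> 1, tm \<one> (-1)})"
    by (rule L.Kgen_subalg[OF subalg_Fr])
  also have "\<dots> = LP (Kgen Q)"
    by (rule LP_generated[OF Q]) (use st in \<open>simp add: A\<close>)
  finally show ?thesis
    unfolding A by (simp only: quantum_cluster_algebra_def cluster_variables_ext Q_def)
qed

end

subsection \<open>The extended seed\<close>

locale skew_extension = preseed F r mut x B L d
  for F :: "(qfield, 'a) module" (structure) and r mut x B L d +
  fixes Pr :: "(nat \<times> nat) set" and G :: "nat \<Rightarrow> int" and \<sigma> :: "'a \<Rightarrow> 'a" and c :: "nat \<Rightarrow> int"
  assumes seed: "graded_quantum_seed F r mut Pr x B L G"
    and auto: "\<sigma> \<in> K_algebra_iso (quantum_cluster_algebra F r mut x B L)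
                               (quantum_cluster_algebra F r mut x B L)"
    and scale: "i < r \<Longrightarrow> \<sigma> (x i) = qpow (c i) \<odot> x i"
begin

definition I :: "nat set" where
  "I = {..<r} - snd ` Pr"

text \<open>The torus whose fractions fill \<open>F\<close> by the definition of a seed, with the
  omitted inverses left out of the generators.\<close>

definition T0 :: "'a set" where
  "T0 = Kgen (x ` I \<union> (\<lambda>i. inv (x i)) ` I)"

lemma torus: "quantum_torus_fractions F r I x L"
  using seed by (simp add: graded_quantum_seed_def quantum_seed_def I_def)

lemma I_less: "i \<in> I \<Longrightarrow> i < r"
  by (simp add: I_def)

lemma T0_gens: "x ` I \<union> (\<lambda>i. inv (x i)) ` I \<subseteq> carrier F"
  using I_less x_Units by auto

lemma subalg_T0: "subalg T0"
  unfolding T0_def by (rule subalg_Kgen[OF T0_gens])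

lemma T0_fraction: "f \<in> carrier F \<Longrightarrow> \<exists>s\<in>T0. \<exists>t\<in>T0. t \<noteq> \<zero> \<and> f = s \<otimes> inv t"
  using torus unfolding quantum_torus_fractions_def Let_def carrier_K_subalgebra_gen T0_def by blast

lemma independent:
  "finite S \<Longrightarrow> S \<subseteq> {a. \<forall>i. i \<notin> I \<longrightarrow> a i = 0} \<Longrightarrow>
    (\<Oplus>a\<in>S. u a \<odot> ordered_monomial F r x a) = \<zero> \<Longrightarrow> a \<in> S \<Longrightarrow> u a = 0"
  using torus unfolding quantum_torus_fractions_def by blast

lemma T0_denominator:
  assumes "f \<in> carrier F"
  shows "\<exists>b\<in>T0. b \<noteq> \<zero> \<and> f \<otimes> b \<in> T0"
proof -
  obtain s t where st: "s \<in> T0" "t \<in> T0" "t \<noteq> \<zero>" "f = s \<otimes> inv t" using T0_fraction[OF assms] by blast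
  have "s \<in> carrier F" "t \<in> carrier F" using st subalg_carrier[OF subalg_T0] by blast+
  then have "f \<otimes> t = s" using st(3,4) by (simp add: m_assoc Units_iff)
  then show ?thesis using st by metis
qed

end

sublocale skew_extension \<subseteq> H: fraction_auto F "carrier (quantum_cluster_algebra F r mut x B L)" \<sigma>
proof
  let ?A = "quantum_cluster_algebra F r mut x B L"
  have ops: "?A = F\<lparr>carrier := carrier ?A\<rparr>"
    by (simp add: quantum_cluster_algebra_def K_subalgebra_gen_def)
  have ring_ops: "monoid.mult ?A = monoid.mult F" "ring.add ?A = ring.add F" "one ?A = one F"
      "module.smult ?A = module.smult F"
    by (simp_all add: quantum_cluster_algebra_def K_subalgebra_gen_def)
  have hom: "\<sigma> \<in> ring_hom ?A ?A" "bij_betw \<sigma> (carrier ?A) (carrier ?A)"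
    and sm: "\<And>c a. a \<in> carrier ?A \<Longrightarrow> \<sigma> (c \<odot>\<^bsub>?A\<^esub> a) = c \<odot>\<^bsub>?A\<^esub> \<sigma> a"
    using auto unfolding K_algebra_iso_def ring_iso_def by blast+
  show "subalg (carrier ?A)" by (rule subalg_cluster_algebra)
  show "bij_betw \<sigma> (carrier ?A) (carrier ?A)" by (rule hom(2))
  show "\<sigma> (a \<oplus> b) = \<sigma> a \<oplus> \<sigma> b" "\<sigma> (a \<otimes> b) = \<sigma> a \<otimes> \<sigma> b"
    if "a \<in> carrier ?A" "b \<in> carrier ?A" for a b
    using ring_hom_add[OF hom(1) that] ring_hom_mult[OF hom(1) that] unfolding ring_ops by blast+
  show "\<sigma> \<one> = \<one>" using ring_hom_one[OF hom(1)] unfolding ring_ops .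
  show "\<sigma> (c \<odot> a) = c \<odot> \<sigma> a" if "a \<in> carrier ?A" for a c using sm[OF that] unfolding ring_ops .
  fix f assume "f \<in> carrier F"
  then show "\<exists>b\<in>carrier ?A. b \<noteq> \<zero> \<and> f \<otimes> b \<in> carrier ?A"
    using denominator_exists[OF subalg_cluster_algebra cluster_variable_in_algebra[OF mutation_class.initial], of I f]
      I_less T0_fraction[of f] unfolding T0_def by blast
qed

sublocale skew_extension \<subseteq> X: seed_series F r mut x B L d "auto_pow F H.hat"
  by unfold_locales

context skew_extension
begin

abbreviation s :: "int \<Rightarrow> 'a \<Rightarrow> 'a" where
  "s \<equiv> auto_pow F H.hat"

lemma x_in_A: "i < r \<Longrightarrow> x i \<in> carrier (quantum_cluster_algebra F r mut x B L)"
  by (rule cluster_variable_in_algebra[OF mutation_class.initial])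

lemma hat_x: "i < r \<Longrightarrow> H.hat (x i) = hp (2 * c i) \<odot> x i"
  using H.hat_A[OF x_in_A] scale by (simp add: qpow_def)

lemma s_x:
  assumes i: "i < r"
  shows "s n (x i) = hp (2 * c i * n) \<odot> x i"
proof -
  have xc: "x i \<in> carrier F" using x_Units[OF i] by simp
  have p: "s 1 (x i) = hp (2 * c i) \<odot> x i"
    using H.auto_pow_one[OF xc] hat_x[OF i] by simp
  have "s (-1) (s 1 (x i)) = x i" using H.s_comp[OF xc, of "-1" 1] H.s_0[OF xc] by simp
  then have "hp (2 * c i) \<odot> s (-1) (x i) = x i" unfolding p using xc by (simp add: H.s_sm)
  from sm_move[OF H.s_closed[OF xc] this]
  have m: "s (-1) (x i) = hp (- (2 * c i)) \<odot> x i" .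
  show ?thesis
  proof (induction n rule: int_induct[of _ 0])
    case base
    show ?case using xc by simp
  next
    case (step1 k)
    have "s (k + 1) (x i) = s k (s 1 (x i))" using H.s_comp[OF xc, of k 1] by simp
    also have "\<dots> = hp (2 * c i * k + 2 * c i) \<odot> x i"
      unfolding p hp_add using step1(2) xc by (simp add: H.s_sm mult.commute)
    finally show ?case by (simp add: distrib_left)
  next
    case (step2 k)
    have "s (k - 1) (x i) = s k (s (-1) (x i))" using H.s_comp[OF xc, of k "-1"] by simp
    also have "\<dots> = hp (2 * c i * k + - (2 * c i)) \<odot> x i"
      unfolding m hp_add using step2(2) xc by (simp add: H.s_sm mult.commute)
    finally show ?case by (simp add: right_diff_distrib)
  qed
qed

text \<open>The automorphism scales the generators of the torus. Hence the Laurent polynomials over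
  the torus form a ring, the torus of the extended seed.\<close>

lemma s_T0: "a \<in> T0 \<Longrightarrow> s n a \<in> T0"
proof -
  have sub: "subsp T0" by (rule subalg_subsp[OF subalg_T0])
  have "subalg {a \<in> carrier F. s n a \<in> T0}"
    using subalg_T0 sub
    by (intro subalgI subspI)
      (auto simp: H.s_add H.s_mult H.s_sm subsp_zero subalg_one subsp_add subsp_sm subalg_mult)
  moreover have "x ` I \<union> (\<lambda>i. inv (x i)) ` I \<subseteq> {a \<in> carrier F. s n a \<in> T0}"
  proof -
    have gen: "x i \<in> T0" "inv (x i) \<in> T0" if "i \<in> I" for i
      using Kgen_incl[of "x ` I \<union> (\<lambda>i. inv (x i)) ` I"] that unfolding T0_def by blast+
    have "s n (x i) \<in> T0" "s n (inv (x i)) \<in> T0" if "i \<in> I" for i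
    proof -
      have i: "i < r" by (rule I_less[OF that])
      show "s n (x i) \<in> T0" unfolding s_x[OF i] by (rule subsp_sm[OF sub gen(1)[OF that]])
      have "s n (x i [^] (-1::int)) = hp (2 * c i * n * (-1)) \<odot> x i [^] (-1::int)"
        by (rule hom_ipow[where h = "s n", OF _ _ _ x_Units[OF i] s_x[OF i]]) (simp_all add: H.s_mult)
      then have "s n (inv (x i)) = hp (2 * c i * n * (-1)) \<odot> inv (x i)"
        unfolding ipow_minus_one[OF x_Units[OF i]] .
      then show "s n (inv (x i)) \<in> T0" using subsp_sm[OF sub gen(2)[OF that]] by simp
    qed
    then show ?thesis using T0_gens by blast
  qed
  ultimately have "T0 \<subseteq> {a \<in> carrier F. s n a \<in> T0}"
    unfolding T0_def[symmetric] by (subst (1) T0_def) (rule Kgen_minimal)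
  then show "a \<in> T0 \<Longrightarrow> s n a \<in> T0" by blast
qed

text \<open>These sums are, up to sign, the entries of the compatibility condition in the columns of
  \<open>y\<close> and its inverse.\<close>

lemma balanced: "i \<in> mut \<Longrightarrow> (\<Sum>j<r. B j i * c j) = 0"
  by (rule weight_balanced[OF H.hat(1) H.hat_one H.hat_mult H.hat_sm H.hat_add hat_x])
    (simp_all add: H.hat_A H.\<sigma>A)

lemma r_notin_Pr: "(i, j) \<in> Pr \<Longrightarrow> i < r \<and> j < r"
  using seed unfolding graded_quantum_seed_def quantum_seed_def inverse_pairs_def by fastforce

lemma ext_comm:
  assumes "i < r + 2" "j < r + 2"
  shows "H.ext_tm r x i \<otimes>\<^bsub>H.FF\<^esub> H.ext_tm r x j =
    qpow (ext_L r L c i j) \<odot>\<^bsub>H.FF\<^esub> (H.ext_tm r x j \<otimes>\<^bsub>H.FF\<^esub> H.ext_tm r x i)"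
proof -
  \<comment> \<open>All entries of the tuple are written uniformly as \<open>g i\<close> times
    \<open>y\<close> to the power \<open>e i\<close>, which reduces the relations to the action of
    \<open>s\<close> on the \<open>g i\<close>.\<close>
  define g where "g = (\<lambda>i. if i < r then x i else \<one>)"
  define e :: "nat \<Rightarrow> int" where "e = (\<lambda>i. if i < r then 0 else if i = r then 1 else -1)"
  have tm: "H.ext_tm r x i = H.tm (g i) (e i)" for i
    by (simp add: H.ext_tm_def g_def e_def)
  have gc: "g i \<in> carrier F" for i using x_Units by (simp add: g_def)
  have sg: "s n (g i) = hp (if i < r then 2 * c i * n else 0) \<odot> g i" for n i
    by (simp add: g_def s_x)
  have "g i \<otimes> s (e i) (g j) = qpow (ext_L r L c i j) \<odot> (g j \<otimes> s (e j) (g i))"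
  proof (cases "i < r \<and> j < r")
    case True
    then show ?thesis using x_comm[of i j] x_Units by (simp add: g_def e_def ext_L_def)
  next
    case False
    then have comm: "g i \<otimes> g j = g j \<otimes> g i" using x_Units by (auto simp: g_def)
    have "i < r \<or> i = r \<or> i = r + 1" "j < r \<or> j = r \<or> j = r + 1" using assms by linarith+
    then have "(if j < r then 2 * c j * e i else 0) = 2 * ext_L r L c i j + (if i < r then 2 * c i * e j else 0)"
      using False by (elim disjE) (simp_all add: e_def ext_L_def)
    then show ?thesis
      unfolding sg qpow_def using gc comm by (simp add: hp_add[symmetric])
  qed
  then show ?thesis
    unfolding tm using gc by (simp add: H.tm_mult H.tm_sm add.commute)
qed

text \<open>Monomials with different exponents of \<open>y\<close> occupy different degrees of the
  series. The coefficient of \<open>y^n\<close> is a relation among monomials of the given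
  seed.\<close>

lemma ext_independent:
  assumes S: "finite S" "S \<subseteq> {a. \<forall>i. i \<notin> insert r I \<longrightarrow> a i = 0}"
    and sum: "(\<Oplus>\<^bsub>H.FF\<^esub>a\<in>S. u a \<odot>\<^bsub>H.FF\<^esub> ordered_monomial H.FF (r + 2) (H.ext_tm r x) a) = \<zero>\<^bsub>H.FF\<^esub>"
    and b: "b \<in> S"
  shows "u b = 0"
proof -
  define m where "m = (\<lambda>a. ordered_monomial F r x a)"
  have mc: "m a \<in> carrier F" for a using om_Units[of r x a] x_Units by (simp add: m_def)
  define f where "f = (\<lambda>a. u a \<odot>\<^bsub>H.FF\<^esub> ordered_monomial H.FF (r + 2) (H.ext_tm r x) a)"
  have f: "f a = H.tm (u a \<odot> m a) (a r)" if "a \<in> S" for a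
  proof -
    have "a (r + 1) = 0" using that S(2) by (auto simp: I_def)
    moreover have "ordered_monomial H.FF (r + 2) (H.ext_tm r x) a = H.tm (m a) (a r - a (r + 1))"
      unfolding m_def by (rule H.om_ext_tm) (rule x_Units)
    ultimately show ?thesis using mc by (simp add: f_def H.tm_sm)
  qed
  define n where "n = b r"
  define Sn where "Sn = {a \<in> S. a r = n}"
  \<comment> \<open>The exponent of \<open>y\<close> is set to 0 to obtain exponent vectors
    supported on \<open>I\<close>; it is constant on \<open>Sn\<close>, so nothing is lost.\<close>
  define \<rho> where "\<rho> = (\<lambda>a :: nat \<Rightarrow> int. a(r := 0))"
  have restore: "(\<rho> a)(r := n) = a" if "a \<in> Sn" for a
    using that by (simp add: Sn_def \<rho>_def fun_upd_idem)
  have inj: "inj_on \<rho> Sn"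
  proof (rule inj_onI)
    fix a a' assume "a \<in> Sn" "a' \<in> Sn" "\<rho> a = \<rho> a'"
    then show "a = a'" using restore by metis
  qed
  have "\<zero> = (finsum H.FF f S) n" using sum by (simp add: f_def H.LS_simps(3))
  also have "\<dots> = (\<Oplus>a\<in>S. f a n)"
    by (rule H.finsum_FF) (use f mc in \<open>simp add: H.tm_Fr\<close>)
  also have "\<dots> = (\<Oplus>a\<in>Sn. u a \<odot> m a)"
  proof (rule add.finprod_mono_neutral_cong_right[OF S(1)])
    show "(\<lambda>a. f a n) \<in> S \<rightarrow> carrier F" using f mc by (auto simp: H.tm_def)
  qed (use f mc in \<open>auto simp: Sn_def H.tm_def\<close>)
  also have "\<dots> = (\<Oplus>a\<in>Sn. u ((\<rho> a)(r := n)) \<odot> m (\<rho> a))"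
  proof (rule finsum_cong')
    fix a assume "a \<in> Sn"
    then have "(\<rho> a)(r := n) = a" by (rule restore)
    moreover have "m (\<rho> a) = m a" unfolding m_def \<rho>_def by (rule om_cong) simp_all
    ultimately show "u a \<odot> m a = u ((\<rho> a)(r := n)) \<odot> m (\<rho> a)" by simp
  qed (use mc in auto)
  also have "\<dots> = (\<Oplus>a\<in>\<rho> ` Sn. u (a(r := n)) \<odot> m a)"
    by (rule finsum_reindex[symmetric]) (use mc inj in auto)
  finally have zero: "(\<Oplus>a\<in>\<rho> ` Sn. u (a(r := n)) \<odot> ordered_monomial F r x a) = \<zero>" by (simp add: m_def)
  have "b \<in> Sn" using b by (simp add: Sn_def n_def)
  then have b': "\<rho> b \<in> \<rho> ` Sn" by blast
  have fin: "finite (\<rho> ` Sn)" using S(1) by (simp add: Sn_def)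
  have "\<rho> ` Sn \<subseteq> {a. \<forall>i. i \<notin> I \<longrightarrow> a i = 0}"
    using S(2) by (auto simp: Sn_def \<rho>_def)
  from independent[OF fin this zero b'] have "u ((\<rho> b)(r := n)) = 0" .
  then show ?thesis unfolding restore[OF \<open>b \<in> Sn\<close>] .
qed

lemma inv_ext_tm:
  "i < r \<Longrightarrow> inv\<^bsub>H.FF\<^esub> (H.ext_tm r x i) = H.tm (inv (x i)) 0"
  "inv\<^bsub>H.FF\<^esub> (H.ext_tm r x r) = H.tm \<one> (-1)"
proof -
  show "inv\<^bsub>H.FF\<^esub> (H.ext_tm r x i) = H.tm (inv (x i)) 0" if i: "i < r"
  proof -
    have "inv (x i) \<in> carrier F" using x_Units[OF i] by simp
    then show ?thesis using H.inv_FF_tm[OF x_Units[OF i], of 0] i by (simp add: H.ext_tm_def)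
  qed
  show "inv\<^bsub>H.FF\<^esub> (H.ext_tm r x r) = H.tm \<one> (-1)"
    using H.inv_FF_tm[OF Units_one_closed, of 1] by (simp add: H.ext_tm_def)
qed

lemma ext_torus:
  "carrier (K_subalgebra_gen H.FF (H.ext_tm r x ` insert r I \<union> (\<lambda>i. inv\<^bsub>H.FF\<^esub> (H.ext_tm r x i)) ` insert r I)) = H.LP T0"
proof -
  define S where "S = x ` I \<union> (\<lambda>i. inv (x i)) ` I"
  have "H.ext_tm r x ` I = (\<lambda>a. H.tm a 0) ` x ` I"
    unfolding image_image by (rule image_cong) (simp_all add: H.ext_tm_def I_less)
  moreover have "(\<lambda>i. inv\<^bsub>H.FF\<^esub> (H.ext_tm r x i)) ` I = (\<lambda>a. H.tm a 0) ` (\<lambda>i. inv (x i)) ` I"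
    unfolding image_image by (rule image_cong) (simp_all add: inv_ext_tm I_less)
  moreover have "H.ext_tm r x r = H.tm \<one> 1" by (simp add: H.ext_tm_def)
  moreover have "insert y Y \<union> insert z Z = Y \<union> Z \<union> {y, z}" for y z :: "int \<Rightarrow> 'a" and Y Z by blast
  moreover have "inv\<^bsub>H.FF\<^esub> (H.tm \<one> 1) = H.tm \<one> (-1)"
    using H.inv_FF_tm[OF Units_one_closed, of 1] by simp
  ultimately have gens: "H.ext_tm r x ` insert r I \<union> (\<lambda>i. inv\<^bsub>H.FF\<^esub> (H.ext_tm r x i)) ` insert r I =
      (\<lambda>a. H.tm a 0) ` S \<union> {H.tm \<one> 1, H.tm \<one> (-1)}"
    by (simp only: image_insert image_Un S_def)
  have Sc: "S \<subseteq> carrier F" unfolding S_def by (rule T0_gens)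
  have "(\<lambda>a. H.tm a 0) ` S \<union> {H.tm \<one> 1, H.tm \<one> (-1)} \<subseteq> H.Fr"
    using Sc by (auto intro!: H.tm_Fr)
  from H.L.Kgen_subalg[OF H.subalg_Fr this] show ?thesis
    unfolding gens using H.LP_generated[OF Sc] s_T0 by (simp add: T0_def S_def)
qed

lemma ext_quantum_torus:
  "quantum_torus_fractions H.FF (r + 2) (insert r I) (H.ext_tm r x) (ext_L r L c)"
  unfolding quantum_torus_fractions_def Let_def ext_torus
proof (intro conjI allI impI ballI)
  show "H.ext_tm r x i \<in> carrier H.FF - {\<zero>\<^bsub>H.FF\<^esub>}" for i
  proof -
    define a n where "a = (if i < r then x i else \<one>)" and "n = (if i < r then 0 else if i = r then 1 else -1 :: int)"
    have "a \<in> Units F" using x_Units by (simp add: a_def)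
    then have "H.tm a n \<in> Units H.FF" by (rule H.tm_Units_FF)
    then have "H.tm a n \<in> carrier H.FF - {\<zero>\<^bsub>H.FF\<^esub>}" using H.FF.Units_eq by blast
    moreover have "H.ext_tm r x i = H.tm a n" by (simp add: H.ext_tm_def a_def n_def)
    ultimately show ?thesis by simp
  qed
  show "H.ext_tm r x i \<otimes>\<^bsub>H.FF\<^esub> H.ext_tm r x j =
      qpow (ext_L r L c i j) \<odot>\<^bsub>H.FF\<^esub> (H.ext_tm r x j \<otimes>\<^bsub>H.FF\<^esub> H.ext_tm r x i)"
    if "i < r + 2" "j < r + 2" for i j
    by (rule ext_comm[OF that])
next
  fix S u a
  assume "finite S \<and> S \<subseteq> {a. \<forall>i. i \<notin> insert r I \<longrightarrow> a i = 0} \<and>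
     (\<Oplus>\<^bsub>H.FF\<^esub>a\<in>S. u a \<odot>\<^bsub>H.FF\<^esub> ordered_monomial H.FF (r + 2) (H.ext_tm r x) a) = \<zero>\<^bsub>H.FF\<^esub>" "a \<in> S"
  then show "u a = 0" using ext_independent by blast
next
  fix f assume "f \<in> carrier H.FF"
  then have "f \<in> H.Fr" by simp
  then obtain p t where pt: "p \<in> H.LP T0" "t \<in> H.LP T0" "t \<noteq> \<zero>\<^bsub>H.LS\<^esub>" "f = p \<otimes>\<^bsub>H.LS\<^esub> inv\<^bsub>H.LS\<^esub> t"
    using H.Fr_fraction[OF subalg_T0 s_T0 T0_denominator] by blast
  have "t \<in> H.P" using pt(2) subalg_carrier[OF subalg_T0] by (auto simp: H.LP_def)
  then have "inv\<^bsub>H.FF\<^esub> t = inv\<^bsub>H.LS\<^esub> t" using H.inv_FF H.P_subset_Fr pt(3) by blast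
  then show "\<exists>p\<in>H.LP T0. \<exists>t\<in>H.LP T0. t \<noteq> \<zero>\<^bsub>H.FF\<^esub> \<and> f = p \<otimes>\<^bsub>H.FF\<^esub> inv\<^bsub>H.FF\<^esub> t"
    using pt by (intro bexI[of _ p] bexI[of _ t]) simp_all
qed

lemma ext_graded_seed:
  "graded_quantum_seed H.FF (r + 2) mut (insert (r, r + 1) Pr) (H.ext_tm r x) (ext_B r B) (ext_L r L c) (ext_G r G)"
proof -
  have qs: "quantum_seed F r mut Pr x B L"
    and G: "\<forall>i\<in>mut. (\<Sum>j<r. B i j * G j) = 0" "\<forall>(i, j)\<in>Pr. G j = - G i"
    using seed unfolding graded_quantum_seed_def by blast+
  have q: "mut \<subseteq> {..<r}" "\<And>i j. i \<in> {..<r} - mut \<Longrightarrow> j \<in> {..<r} - mut \<Longrightarrow> B i j = 0"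
    and ip: "inverse_pairs F r mut Pr x B"
    using qs unfolding quantum_seed_def by blast+
  have rm: "r \<notin> mut" "r + 1 \<notin> mut" using q(1) by auto
  have compat: "compatible (r + 2) mut (ext_B r B) (ext_L r L c)"
    unfolding compatible_def
  proof (intro exI[of _ d] conjI ballI allI impI)
    show "d > 0" by (rule d_pos)
    fix i j assume i: "i \<in> mut" and j: "j < r + 2"
    have ir: "i < r" by (rule mut_less[OF i])
    have sum: "(\<Sum>k<r + 2. ext_B r B k i * ext_L r L c k j) = (\<Sum>k<r. B k i * ext_L r L c k j)"
      unfolding sum_plus_2 using ir by (simp add: ext_B_eq ext_B_zero)
    consider "j < r" | "j = r" | "j = r + 1" using j by linarith
    then show "(\<Sum>k<r + 2. ext_B r B k i * ext_L r L c k j) = (if i = j then d else 0)"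
    proof cases
      case 1
      then have "(\<Sum>k<r. B k i * ext_L r L c k j) = (\<Sum>k<r. B k i * L k j)"
        by (intro sum.cong refl) (simp add: ext_L_def)
      then show ?thesis unfolding sum using compat[OF i 1] by simp
    next
      case 2
      then have "(\<Sum>k<r. B k i * ext_L r L c k j) = (\<Sum>k<r. - (B k i * c k))"
        by (intro sum.cong refl) (simp add: ext_L_def)
      then show ?thesis unfolding sum using balanced[OF i] 2 ir by (simp add: sum_negf)
    next
      case 3
      then have "(\<Sum>k<r. B k i * ext_L r L c k j) = (\<Sum>k<r. B k i * c k)"
        by (intro sum.cong refl) (simp add: ext_L_def)
      then show ?thesis unfolding sum using balanced[OF i] 3 ir by simp
    qed
  qed
  have pairs: "inverse_pairs H.FF (r + 2) mut (insert (r, r + 1) Pr) (H.ext_tm r x) (ext_B r B)"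
    unfolding inverse_pairs_def
  proof (intro conjI)
    have ip': "fst ` Pr \<inter> snd ` Pr = {}" "inj_on fst Pr" "inj_on snd Pr"
      and ipx: "\<And>i j. (i, j) \<in> Pr \<Longrightarrow> i \<in> {..<r} - mut \<and> j \<in> {..<r} - mut \<and> x j = inv x i \<and>
        (\<forall>k<r. B i k = 0 \<and> B k i = 0 \<and> B j k = 0 \<and> B k j = 0)"
      using ip unfolding inverse_pairs_def by blast+
    have out: "r \<notin> fst ` Pr" "r \<notin> snd ` Pr" "r + 1 \<notin> fst ` Pr" "r + 1 \<notin> snd ` Pr"
      using r_notin_Pr by force+
    show "fst ` insert (r, r + 1) Pr \<inter> snd ` insert (r, r + 1) Pr = {}"
      using ip'(1) out by simp
    show "inj_on fst (insert (r, r + 1) Pr)" "inj_on snd (insert (r, r + 1) Pr)"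
      using ip'(2,3) out by (auto simp: inj_on_insert)
    show "\<forall>(i, j)\<in>insert (r, r + 1) Pr. i \<in> {..<r + 2} - mut \<and> j \<in> {..<r + 2} - mut \<and>
        H.ext_tm r x j = inv\<^bsub>H.FF\<^esub> H.ext_tm r x i \<and>
        (\<forall>k<r + 2. ext_B r B i k = 0 \<and> ext_B r B k i = 0 \<and> ext_B r B j k = 0 \<and> ext_B r B k j = 0)"
    proof (intro ballI, clarify)
      fix i j assume "(i, j) \<in> insert (r, r + 1) Pr"
      then consider "i = r" "j = r + 1" | "(i, j) \<in> Pr" by blast
      then show "i \<in> {..<r + 2} - mut \<and> j \<in> {..<r + 2} - mut \<and>
        H.ext_tm r x j = inv\<^bsub>H.FF\<^esub> H.ext_tm r x i \<and>
        (\<forall>k<r + 2. ext_B r B i k = 0 \<and> ext_B r B k i = 0 \<and> ext_B r B j k = 0 \<and> ext_B r B k j = 0)"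
      proof cases
        case 1
        have "H.ext_tm r x (r + 1) = inv\<^bsub>H.FF\<^esub> H.ext_tm r x r"
          unfolding inv_ext_tm(2) by (simp add: H.ext_tm_def)
        then show ?thesis using 1 rm by (simp add: ext_B_zero)
      next
        case 2
        note p = ipx[OF 2]
        have "H.ext_tm r x j = inv\<^bsub>H.FF\<^esub> H.ext_tm r x i"
          using p inv_ext_tm(1)[of i] by (simp add: H.ext_tm_def)
        moreover have "ext_B r B i k = 0 \<and> ext_B r B k i = 0 \<and> ext_B r B j k = 0 \<and> ext_B r B k j = 0" for k
          using p by (simp add: ext_B_def)
        ultimately show ?thesis using p by simp
      qed
    qed
  qed
  have I': "{..<r + 2} - snd ` insert (r, r + 1) Pr = insert r I"
    using r_notin_Pr by (force simp: I_def)
  have "quantum_seed H.FF (r + 2) mut (insert (r, r + 1) Pr) (H.ext_tm r x) (ext_B r B) (ext_L r L c)"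
    unfolding quantum_seed_def I'
  proof (intro conjI allI impI ballI)
    show "K_skew_field H.FF" using H.Kskew_FF by (simp add: K_skew_field_iff_Kskew)
    show "mut \<subseteq> {..<r + 2}" using q(1) by auto
    show "ext_L r L c i j = - ext_L r L c j i" for i j
    proof (cases "i < r \<and> j < r")
      case True
      then have e: "ext_L r L c i j = L i j" "ext_L r L c j i = L j i" by (simp_all add: ext_L_def)
      show ?thesis unfolding e by (rule L_skew) (use True in blast)+
    qed (cases "i < r"; cases "j < r"; simp add: ext_L_def)
    show "ext_B r B i j = - ext_B r B j i" for i j
    proof (cases "i < r \<and> j < r")
      case True
      then have e: "ext_B r B i j = B i j" "ext_B r B j i = B j i" by (simp_all add: ext_B_def)
      show ?thesis unfolding e by (rule B_skew) (use True in blast)+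
    qed (cases "i < r"; cases "j < r"; simp add: ext_B_def)
    show "ext_B r B i j = 0" if "i \<in> {..<r + 2} - mut" "j \<in> {..<r + 2} - mut" for i j
      using that q(2)[of i j] by (auto simp: ext_B_def)
  qed (rule compat pairs ext_quantum_torus)+
  moreover have "(\<Sum>j<r + 2. ext_B r B i j * ext_G r G j) = 0" if "i \<in> mut" for i
  proof -
    have "(\<Sum>j<r. ext_B r B i j * ext_G r G j) = (\<Sum>j<r. B i j * G j)"
      using mut_less[OF that] by (intro sum.cong refl) (simp add: ext_B_eq ext_G_def)
    then show ?thesis unfolding sum_plus_2 using bspec[OF G(1) that] by (simp add: ext_B_zero)
  qed
  moreover have "\<forall>(i, j)\<in>insert (r, r + 1) Pr. ext_G r G j = - ext_G r G i"
  proof (intro ballI, clarify)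
    fix i j assume "(i, j) \<in> insert (r, r + 1) Pr"
    then consider "i = r" "j = r + 1" | "(i, j) \<in> Pr" by blast
    then show "ext_G r G j = - ext_G r G i"
    proof cases
      case 2
      then show ?thesis using bspec[OF G(2) 2] r_notin_Pr[OF 2] by (simp add: ext_G_def)
    qed (simp add: ext_G_def)
  qed
  ultimately show ?thesis by (simp add: graded_quantum_seed_def)
qed

lemma s_A: "a \<in> carrier (quantum_cluster_algebra F r mut x B L) \<Longrightarrow>
    s n a \<in> carrier (quantum_cluster_algebra F r mut x B L)"
  by (rule H.auto_pow_restrict(2)[OF refl])

text \<open>Both algebras consist of functions from the integers to the same type, and they agree as
  sets and in their operations, so the identity is the isomorphism. The work lies in the product:
  sums formed in the cluster algebra and powers of \<open>\<sigma>\<close> have to be matched with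
  those of \<open>F\<close> and of the extension of \<open>\<sigma>\<close>.\<close>

lemma ext_iso:
  "(\<lambda>f. f) \<in> K_algebra_iso (skew_laurent (quantum_cluster_algebra F r mut x B L) \<sigma>)
    (quantum_cluster_algebra H.FF (r + 2) mut (H.ext_tm r x) (ext_B r B) (ext_L r L c))"
proof -
  let ?A = "quantum_cluster_algebra F r mut x B L"
  let ?SL = "skew_laurent ?A \<sigma>"
  define A' where "A' = quantum_cluster_algebra H.FF (r + 2) mut (H.ext_tm r x) (ext_B r B) (ext_L r L c)"
  have A: "?A = F\<lparr>carrier := carrier ?A\<rparr>"
    by (simp add: quantum_cluster_algebra_def K_subalgebra_gen_def)
  have A': "monoid.mult A' = monoid.mult H.LS" "ring.add A' = ring.add H.LS" "one A' = one H.LS"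
      "module.smult A' = module.smult H.LS"
    by (simp_all add: A'_def quantum_cluster_algebra_def K_subalgebra_gen_def)
  have carr: "carrier A' = H.LP (carrier ?A)" unfolding A'_def by (rule X.cluster_algebra_ext) (rule s_A)
  have ops: "\<zero>\<^bsub>?A\<^esub> = \<zero>" "\<one>\<^bsub>?A\<^esub> = \<one>" "monoid.mult ?A = monoid.mult F" "ring.add ?A = ring.add F"
      "module.smult ?A = module.smult F"
    by (simp_all add: quantum_cluster_algebra_def K_subalgebra_gen_def)
  have SLc: "carrier ?SL = H.LP (carrier ?A)"
    by (simp add: skew_laurent_def H.LP_def ops)
  have Ac: "carrier ?A \<subseteq> carrier F" using H.Ac by blast
  have mult: "f \<otimes>\<^bsub>?SL\<^esub> g = f \<otimes>\<^bsub>H.LS\<^esub> g" if fg: "f \<in> H.LP (carrier ?A)" "g \<in> H.LP (carrier ?A)" for f g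
  proof
    fix n
    have fin: "finite {m. f m \<noteq> \<zero>}" and fA: "f m \<in> carrier ?A" and gA: "g m \<in> carrier ?A" for m
      using fg by (simp_all add: H.LP_def)
    have fc: "f \<in> carrier H.LS" and gc: "g \<in> carrier H.LS" using fg H.LP_carrier[OF Ac] by blast+
    have "(f \<otimes>\<^bsub>?SL\<^esub> g) n = finsum ?A (\<lambda>m. f m \<otimes> auto_pow ?A \<sigma> m (g (n - m))) {m. f m \<noteq> \<zero>}"
      by (simp add: skew_laurent_def ops)
    also have "(\<lambda>m. f m \<otimes> auto_pow ?A \<sigma> m (g (n - m))) = (\<lambda>m. f m \<otimes> s m (g (n - m)))"
      using H.auto_pow_restrict(1)[OF refl gA] by simp
    also have "finsum ?A (\<lambda>m. f m \<otimes> s m (g (n - m))) {m. f m \<noteq> \<zero>} =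
        (\<Oplus>m\<in>{m. f m \<noteq> \<zero>}. f m \<otimes> s m (g (n - m)))"
      by (subst A, rule finsum_subalg[OF subalg_cluster_algebra])
        (use subalg_mult[OF subalg_cluster_algebra fA s_A[OF gA]] in blast)
    also have "\<dots> = (f \<otimes>\<^bsub>H.LS\<^esub> g) n"
      by (rule H.LS_mult[OF fc gc fin, symmetric]) simp
    finally show "(f \<otimes>\<^bsub>?SL\<^esub> g) n = (f \<otimes>\<^bsub>H.LS\<^esub> g) n" .
  qed
  have rest: "f \<oplus>\<^bsub>?SL\<^esub> g = f \<oplus>\<^bsub>H.LS\<^esub> g" "\<one>\<^bsub>?SL\<^esub> = \<one>\<^bsub>H.LS\<^esub>" "k \<odot>\<^bsub>?SL\<^esub> f = k \<odot>\<^bsub>H.LS\<^esub> f" for f g k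
    by (simp_all add: skew_laurent_def H.LS_simps ops cong: if_cong)
  show ?thesis
    unfolding A'_def[symmetric] K_algebra_iso_def ring_iso_def ring_hom_def carr SLc
    by (auto simp: mult rest A' bij_betw_def inj_on_def)
qed

lemma ext_X_eq: "ext_X (quantum_cluster_algebra F r mut x B L) r x = H.ext_tm r x"
  by (rule ext) (simp add: ext_X_def H.ext_tm_def H.tm_def laurent_term_def
      quantum_cluster_algebra_def K_subalgebra_gen_def cong: if_cong)

end

theorem proposition4p1:
  fixes F :: "(qfield, 'a) module"
    and r :: nat and mut :: "nat set" and P :: "(nat \<times> nat) set"
    and x :: "nat \<Rightarrow> 'a" and B L :: "nat \<Rightarrow> nat \<Rightarrow> int" and G :: "nat \<Rightarrow> int"
    and \<sigma> :: "'a \<Rightarrow> 'a" and c :: "nat \<Rightarrow> int"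
  assumes seed: "graded_quantum_seed F r mut P x B L G"
    and auto: "\<sigma> \<in> K_algebra_iso (quantum_cluster_algebra F r mut x B L)
                               (quantum_cluster_algebra F r mut x B L)"
    and scale: "\<And>i. i < r \<Longrightarrow> \<sigma> (x i) = qpow (c i) \<odot>\<^bsub>F\<^esub> x i"
  shows "\<exists>(F' :: (qfield, int \<Rightarrow> 'a) module) \<phi>.
     let A = quantum_cluster_algebra F r mut x B L;
         x' = \<phi> \<circ> ext_X A r x; B' = ext_B r B; L' = ext_L r L c; G' = ext_G r G
     in graded_quantum_seed F' (r + 2) mut (insert (r, r + 1) P) x' B' L' G' \<and>
        \<phi> \<in> K_algebra_iso (skew_laurent A \<sigma>) (quantum_cluster_algebra F' (r + 2) mut x' B' L')"
proof -
  have qs: "quantum_seed F r mut P x B L" using seed by (simp add: graded_quantum_seed_def)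
  then interpret Kskew F unfolding quantum_seed_def K_skew_field_iff_Kskew by blast
  \<comment> \<open>The compatibility constant of the given seed is fixed here; it serves for all
    mutated seeds and for the extended one.\<close>
  obtain d where d: "d > 0" "\<forall>i\<in>mut. \<forall>j<r. (\<Sum>k<r. B k i * L k j) = (if i = j then d else 0)"
    using qs unfolding quantum_seed_def compatible_def by blast
  have t: "quantum_torus_fractions F r ({..<r} - snd ` P) x L" using qs unfolding quantum_seed_def by blast
  interpret preseed F r mut x B L d
  proof unfold_locales
    show "x i \<in> Units F" if "i < r" for i
      using t[unfolded quantum_torus_fractions_def, THEN conjunct1] that by (simp add: Units_iff)
    show "x i \<otimes>\<^bsub>F\<^esub> x j = qpow (L i j) \<odot>\<^bsub>F\<^esub> (x j \<otimes>\<^bsub>F\<^esub> x i)" if "i < r" "j < r" for i j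
      using t[unfolded quantum_torus_fractions_def, THEN conjunct2, THEN conjunct1] that by blast
    show "L i j = - L j i" "B i j = - B j i" if "i < r" "j < r" for i j
      using qs that unfolding quantum_seed_def by blast+
    show "i < r" if "i \<in> mut" for i using qs that unfolding quantum_seed_def by blast
    show "(\<Sum>k<r. B k i * L k j) = (if i = j then d else 0)" if "i \<in> mut" "j < r" for i j
      using d(2) that by blast
  qed (rule d(1))
  interpret skew_extension F r mut x B L d P G \<sigma> c
    by unfold_locales (rule seed auto scale; assumption?)+
  have "(\<lambda>f. f) \<circ> ext_X (quantum_cluster_algebra F r mut x B L) r x = H.ext_tm r x"
    by (simp only: ext_X_eq comp_def)
  then show ?thesis
    using ext_graded_seed ext_iso unfolding Let_def
    by (intro exI[of _ H.FF] exI[of _ "\<lambda>f. f"]) (simp only: simp_thms)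
qed

end
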